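(* Let $n\ge 3$. Then there exist infinitely many integers $k\ge 1$ which have a finite critical length associated with them. Moreover, if $(k_i)_{i=1}^\infty$ is the increasing sequence of all such $k$ and $(L_i)_{i=1}^\infty$ is the associated sequence of finite critical lengths (i.e. $L_i$ is a finite critical length associated with $k_i$), then $$\lim_{i\to\infty} L_i = 0.$$
   Context: Metric of revolution: for $L>0$ and $M=[0,L]\times\mathbb{S}^{n-1}$, a metric of revolution on $M$ is a Riemannian metric of the form $g(r,p) = dr^2 + h^2(r) g_0(p)$, $(r,p)\in[0,L]\times\mathbb{S}^{n-1}$, where $g_0$ is the canonical metric of the unit $(n-1)$-sphere and $h:[0,L]\to(0,\infty)$ is a smooth function satisfying (1) $|h'(r)|\le 1$ for all $r\in[0,L]$ and (2) $h(0)=h(L)=1$. Steklov eigenvalues: for a smooth compact connected Riemannian manifold $(M,g)$ with smooth boundary $\Sigma$, these are the real numbers $\sigma$ for which there is a nonzero harmonic function $f:M\to\mathbb{R}$ with $\partial_\nu f = \sigma f$ on $\Sigma$ ($\nu$ the outward unit normal). They form a sequence $0=\sigma_0(M,g)<\sigma_1(M,g)\le\sigma_2(M,g)\le\dots\nearrow\infty$, repeated according to multiplicity. Sharp bounds: for $n\ge 3$, $k\ge 1$ and $L>0$, $B_n^k(L)$ denotes the sharp upper bound for $\sigma_k$ at meridian length $L$, i.e. $B_n^k(L)=\sup_g \sigma_k([0,L]\times\mathbb{S}^{n-1},g)$, the supremum being over all metrics of revolution $g$ on $[0,L]\times\mathbb{S}^{n-1}$ (it is finite). Put $B_n^k:=\sup_{L>0}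 B_n^k(L)$. Critical length: a number $L_k\in(0,\infty)$ is a finite critical length associated with $k$ if $B_n^k=B_n^k(L_k)$. *)

theory Defs
  imports "HOL-Analysis.Analysis" "HOL-Library.Function_Algebras"
begin

primrec Ck_on :: "nat \<Rightarrow> 'a::euclidean_space set \<Rightarrow> ('a \<Rightarrow> real) \<Rightarrow> bool" where
  "Ck_on 0 U f \<longleftrightarrow> continuous_on U f"
| "Ck_on (Suc k) U f \<longleftrightarrow>
     (\<forall>x\<in>U. f differentiable (at x)) \<and>
     (\<forall>b\<in>Basis. Ck_on k U (\<lambda>x. frechet_derivative f (at x) b))"

text \<open>Smoothness on a subset that need not be open (a compact interval, a submanifold with
  boundary): the function is the restriction of a \<open>C\<^sup>\<infinity>\<close> function on an open neighbourhood.\<close>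

definition smooth_on :: "'a::euclidean_space set \<Rightarrow> ('a \<Rightarrow> real) \<Rightarrow> bool" where
  "smooth_on A f \<longleftrightarrow>
     (\<exists>U F. open U \<and> A \<subseteq> U \<and> (\<forall>k. Ck_on k U F) \<and> (\<forall>x\<in>A. F x = f x))"

text \<open>The manifold \<open>[0,L] \<times> S\<^sup>n\<^sup>-\<^sup>1\<close> is the following subset of \<open>\<real> \<times> \<real>\<^sup>n\<close>, where \<open>n = CARD('n)\<close>. A tangent
  vector at \<open>(r, p)\<close> is a pair \<open>(a, u)\<close> with \<open>u\<close> orthogonal to \<open>p\<close>, and the canonical metric of
  the sphere is the restriction of the inner product of \<open>\<real>\<^sup>n\<close>.\<close>

definition cyl :: "real \<Rightarrow> (real \<times> (real^'n)) set" where
  "cyl L = {0..L} \<times> sphere 0 1"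

definition revolution_profile :: "real \<Rightarrow> (real \<Rightarrow> real) \<Rightarrow> bool" where
  "revolution_profile L h \<longleftrightarrow>
     smooth_on {0..L} h \<and>
     (\<forall>r\<in>{0..L}. h r > 0) \<and>
     (\<forall>r\<in>{0..L}. \<bar>vector_derivative h (at r within {0..L})\<bar> \<le> 1) \<and>
     h 0 = 1 \<and> h L = 1"

definition revolution_metric ::
    "(real \<Rightarrow> real) \<Rightarrow> real \<times> (real^'n) \<Rightarrow> real \<times> (real^'n) \<Rightarrow> real \<times> (real^'n) \<Rightarrow> real" where
  "revolution_metric h q v w = fst v * fst w + (h (fst q))\<^sup>2 * (snd v \<bullet> snd w)"

text \<open>Polar coordinates: a diffeomorphism from the punctured ball \<open>0 < |x| < L\<close> of \<open>\<real>\<^sup>n\<close> onto the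
  interior \<open>(0,L) \<times> S\<^sup>n\<^sup>-\<^sup>1\<close>, hence a single coordinate system for the whole interior.\<close>

definition polar_param :: "real^'n \<Rightarrow> real \<times> (real^'n)" where
  "polar_param x = (norm x, x /\<^sub>R norm x)"

definition metric_coeffs :: "(real \<Rightarrow> real) \<Rightarrow> real^'n \<Rightarrow> real^'n^'n" where
  "metric_coeffs h x = (\<chi> i j. revolution_metric h (polar_param x)
     (frechet_derivative polar_param (at x) (axis i 1))
     (frechet_derivative polar_param (at x) (axis j 1)))"

text \<open>The Laplace--Beltrami operator in local coordinates, for an arbitrary field \<open>G\<close> of metric
  coefficients: \<open>|G|\<^sup>-\<^sup>1\<^sup>/\<^sup>2 \<Sum>\<^sub>i \<partial>\<^sub>i (|G|\<^sup>1\<^sup>/\<^sup>2 \<Sum>\<^sub>j G\<^sup>i\<^sup>j \<partial>\<^sub>j u)\<close>, with \<open>|G|\<close> the determinant and \<open>G\<^sup>i\<^sup>j\<close> the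
  entries of the inverse matrix.\<close>

definition partial_deriv :: "'n \<Rightarrow> (real^'n \<Rightarrow> real) \<Rightarrow> real^'n \<Rightarrow> real" where
  "partial_deriv i u x = frechet_derivative u (at x) (axis i 1)"

definition laplace_beltrami ::
    "(real^'n \<Rightarrow> real^'n^'n) \<Rightarrow> (real^'n \<Rightarrow> real) \<Rightarrow> real^'n \<Rightarrow> real" where
  "laplace_beltrami G u x =
     (\<Sum>i\<in>UNIV. partial_deriv i
        (\<lambda>y. sqrt (det (G y)) * (\<Sum>j\<in>UNIV. matrix_inv (G y) $ i $ j * partial_deriv j u y)) x)
     / sqrt (det (G x))"

definition harmonic_on_cyl ::
    "(real \<Rightarrow> real) \<Rightarrow> real \<Rightarrow> (real \<times> (real^'n) \<Rightarrow> real) \<Rightarrow> bool" where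
  "harmonic_on_cyl h L f \<longleftrightarrow>
     smooth_on (cyl L) f \<and>
     (\<forall>x. 0 < norm x \<and> norm x < L \<longrightarrow>
        laplace_beltrami (metric_coeffs h) (f \<circ> polar_param) x = 0)"

text \<open>For every metric of revolution the outward unit normal is \<open>-\<partial>\<^sub>r\<close> on \<open>{0} \<times> S\<^sup>n\<^sup>-\<^sup>1\<close> and \<open>\<partial>\<^sub>r\<close> on
  \<open>{L} \<times> S\<^sup>n\<^sup>-\<^sup>1\<close>. The derivatives are one-sided.\<close>

definition steklov_condition :: "real \<Rightarrow> real \<Rightarrow> (real \<times> (real^'n) \<Rightarrow> real) \<Rightarrow> bool" where
  "steklov_condition L \<sigma> f \<longleftrightarrow>
     (\<forall>p\<in>sphere 0 1.
        - vector_derivative (\<lambda>r. f (r, p)) (at 0 within {0..L}) = \<sigma> * f (0, p) \<and>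
        vector_derivative (\<lambda>r. f (r, p)) (at L within {0..L}) = \<sigma> * f (L, p))"

text \<open>Functions on the manifold are represented by functions that vanish off it, so that the
  dimension of a space of such functions is the intended one.\<close>

definition steklov_space ::
    "(real \<Rightarrow> real) \<Rightarrow> real \<Rightarrow> real \<Rightarrow> (real \<times> (real^'n) \<Rightarrow> real) set" where
  "steklov_space h L \<sigma> =
     {f. (\<forall>q. q \<notin> cyl L \<longrightarrow> f q = 0) \<and> harmonic_on_cyl h L f \<and> steklov_condition L \<sigma> f}"

interpretation fun_space: vector_space "\<lambda>(c::real) (f::'a \<Rightarrow> real) x. c * f x"
  by unfold_locales (auto simp: fun_eq_iff algebra_simps)

definition steklov_spectrum :: "'n::finite itself \<Rightarrow> (real \<Rightarrow> real) \<Rightarrow> real \<Rightarrow> real set" where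
  "steklov_spectrum _ h L =
     {\<sigma>. \<exists>f \<in> (steklov_space h L \<sigma> :: (real \<times> (real^'n) \<Rightarrow> real) set). f \<noteq> (\<lambda>_. 0)}"

definition steklov_multiplicity :: "'n::finite itself \<Rightarrow> (real \<Rightarrow> real) \<Rightarrow> real \<Rightarrow> real \<Rightarrow> nat" where
  "steklov_multiplicity _ h L \<sigma> =
     fun_space.dim (steklov_space h L \<sigma> :: (real \<times> (real^'n) \<Rightarrow> real) set)"

definition steklov_sequence ::
    "'n::finite itself \<Rightarrow> (real \<Rightarrow> real) \<Rightarrow> real \<Rightarrow> (nat \<Rightarrow> real) \<Rightarrow> bool" where
  "steklov_sequence N h L s \<longleftrightarrow>
     mono s \<and> filterlim s at_top sequentially \<and>
     range s = steklov_spectrum N h L \<and>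
     (\<forall>\<sigma>\<in>steklov_spectrum N h L. card {k. s k = \<sigma>} = steklov_multiplicity N h L \<sigma>)"

definition steklov_eigenvalue ::
    "'n::finite itself \<Rightarrow> (real \<Rightarrow> real) \<Rightarrow> real \<Rightarrow> nat \<Rightarrow> real" where
  "steklov_eigenvalue N h L = (THE s. steklov_sequence N h L s)"

text \<open>The suprema are taken in \<^typ>\<open>ereal\<close>, so that they are genuine suprema without any prior
  boundedness proof.\<close>

definition sharp_bound_at :: "'n::finite itself \<Rightarrow> nat \<Rightarrow> real \<Rightarrow> ereal" where
  "sharp_bound_at N k L =
     (SUP h\<in>{h. revolution_profile L h}. ereal (steklov_eigenvalue N h L k))"

definition sharp_bound :: "'n::finite itself \<Rightarrow> nat \<Rightarrow> ereal" where
  "sharp_bound N k = (SUP L\<in>{0<..}. sharp_bound_at N k L)"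

definition finite_critical_length :: "'n::finite itself \<Rightarrow> nat \<Rightarrow> real \<Rightarrow> bool" where
  "finite_critical_length N k L \<longleftrightarrow> 0 < L \<and> sharp_bound N k = sharp_bound_at N k L"

definition critical_indices :: "'n::finite itself \<Rightarrow> nat set" where
  "critical_indices N = {k. 1 \<le> k \<and> (\<exists>L. finite_critical_length N k L)}"

end

theory Submission
  imports Defs
begin

text \<open>
  Spherical harmonics of degree \<open>e\<close> reduce the Steklov problem with profile \<open>h\<close> to the two Dirichlet-to-Neumann eigenvalues of a
  radial equation. By Dirichlet's principle these increase with \<open>h\<close>. Every profile lies below \<open>tent L r = 1 + min r (L - r)\<close>,
  which is a limit of smooth profiles, so \<open>B\<^sub>n\<^sup>k(L)\<close> is the \<open>k\<close>-th smallest element of the family \<open>N\<^sub>e(L)\<close>, \<open>D\<^sub>e(L)\<close> of tent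
  eigenvalues, counted with the multiplicities of the spherical harmonics. For \<open>L \<rightarrow> \<infinity>\<close> the value \<open>N\<^sub>e(L)\<close> increases and \<open>D\<^sub>e(L)\<close>
  decreases to \<open>e + n - 2\<close> (for \<open>e \<ge> 1\<close>).

  Let \<open>M\<^sub>i\<close> be the number of harmonics of degree below \<open>i\<close>, and \<open>2 M\<^sub>i \<le> k < 2 M\<^sub>i\<^sub>+\<^sub>1\<close>. If \<open>k \<ge> M\<^sub>i + M\<^sub>i\<^sub>+\<^sub>1\<close>, then for large \<open>L\<close> the
  bound is \<open>D\<^sub>i(L)\<close>, which exceeds its limit, so the supremum over \<open>L\<close> is attained. A fixed \<open>L \<ge> \<epsilon>\<close> cannot be critical for large
  \<open>k\<close>: the distances of \<open>N\<^sub>e(\<epsilon>)\<close> and \<open>D\<^sub>e(\<epsilon>)\<close> to \<open>e + n - 2\<close> are exponentially small in \<open>e\<close>, hence below the gap 1. So \<open>D\<^sub>i\<close> still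
  rules at \<open>\<epsilon> / 2\<close>, where it is larger; and for \<open>k < M\<^sub>i + M\<^sub>i\<^sub>+\<^sub>1\<close> the bound at \<open>L\<close> is below \<open>i + n - 2\<close>, the limit for large \<open>L\<close>.
\<close>

section \<open>Smooth functions\<close>

text \<open>The corner of the tent shapes the radial part: the equation is kept as a first-order
  system in \<open>a\<close> and \<open>p = h^(n-1) a'\<close>, which never differentiates
  \<open>h\<close>, so two smooth pieces are joined by matching \<open>a\<close> and
  \<open>p\<close>. On each slope the tent metric is the flat metric of an annulus, so solid
  harmonics give its eigenvalues in closed form. Functions on the sphere are carried by functions on
  R^n minus 0 that are constant along rays, and surface integrals by weighted integrals over a
  shell. The Euclidean Laplacian then does the work of the spherical one, and Green's identity comes
  from translation invariance of the integral. Since \<open>steklov_eigenvalue\<close> is a definite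
  description, the full spectrum with multiplicities has to be found before any estimate: explicit
  modes give one half, their completeness (Stone-Weierstrass on the sphere, uniqueness of the radial
  Dirichlet problem) the other. Ordered eigenvalues are handled through counting functions. Modes
  may cross as \<open>L\<close> varies; attainment of the supremum rests on upper semicontinuity of
  the ordered values alone.\<close>

definition dd :: "'a::euclidean_space \<Rightarrow> ('a \<Rightarrow> real) \<Rightarrow> 'a \<Rightarrow> real" where
  "dd v f x = frechet_derivative f (at x) v"

definition Cinf :: "'a::euclidean_space set \<Rightarrow> ('a \<Rightarrow> real) \<Rightarrow> bool" where
  "Cinf U f \<longleftrightarrow> (\<forall>k. Ck_on k U f)"

lemma dd_eqI: "(f has_derivative f') (at x) \<Longrightarrow> dd v f x = f' v"
  unfolding dd_def by (metis frechet_derivative_at)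

lemma has_derivative_dd: "f differentiable (at x) \<Longrightarrow> (f has_derivative (\<lambda>v. dd v f x)) (at x)"
  unfolding dd_def using frechet_derivative_works by (metis eta_contract_eq)

lemma dd_linear: assumes "f differentiable (at x)" shows "linear (\<lambda>v. dd v f x)"
  using has_derivative_dd[OF assms] has_derivative_linear by blast

lemma dd_sum_Basis:
  assumes "f differentiable (at x)"
  shows "dd v f x = (\<Sum>b\<in>Basis. (v \<bullet> b) * dd b f x)"
proof -
  interpret linear "\<lambda>v. dd v f x" by (rule dd_linear[OF assms])
  have "dd v f x = dd (\<Sum>b\<in>Basis. (v \<bullet> b) *\<^sub>R b) f x" by (simp add: euclidean_representation)
  also have "\<dots> = (\<Sum>b\<in>Basis. (v \<bullet> b) * dd b f x)" by (simp add: sum scale)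
  finally show ?thesis .
qed

lemma dd_cong:
  assumes "open U" "x \<in> U" "\<And>y. y \<in> U \<Longrightarrow> f y = g y" shows "dd v f x = dd v g x"
proof -
  have "(f has_derivative D) (at x) \<longleftrightarrow> (g has_derivative D) (at x)" for D
    using has_derivative_transform_within_open[OF _ assms(1,2), of f D UNIV g]
      has_derivative_transform_within_open[OF _ assms(1,2), of g D UNIV f] assms(3) by auto
  then show ?thesis unfolding dd_def frechet_derivative_def by simp
qed

lemma differentiable_cong_open:
  assumes "open U" "x \<in> U" "\<And>y. y \<in> U \<Longrightarrow> f y = g y" "f differentiable (at x)"
  shows "g differentiable (at x)"
  using assms has_derivative_transform_within_open[OF _ assms(1,2)] unfolding differentiable_def by metis

lemma Ck_on_Suc: "Ck_on (Suc k) U f \<longleftrightarrow> (\<forall>x\<in>U. f differentiable (at x)) \<and> (\<forall>b\<in>Basis. Ck_on k U (dd b f))"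
  by (simp add: dd_def[abs_def])

declare Ck_on.simps(2) [simp del]

lemma Ck_on_cong:
  assumes "open U" "\<And>x. x \<in> U \<Longrightarrow> f x = g x" "Ck_on k U f" shows "Ck_on k U g"
  using assms(2,3)
proof (induction k arbitrary: f g)
  case 0 then show ?case by (auto cong: continuous_on_cong_simp)
next
  case (Suc k)
  have "g differentiable (at x)" if "x \<in> U" for x
    using Suc.prems differentiable_cong_open[OF assms(1) that, of f g] that by (auto simp: Ck_on_Suc)
  moreover have "Ck_on k U (dd b g)" if "b \<in> Basis" for b
    by (rule Suc.IH[of "dd b f"]) (use Suc.prems that dd_cong[OF assms(1), of _ f g] in \<open>auto simp: Ck_on_Suc\<close>)
  ultimately show ?case by (auto simp: Ck_on_Suc)
qed

lemma Ck_on_SucD: "Ck_on (Suc k) U f \<Longrightarrow> Ck_on k U f"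
proof (induction k arbitrary: f)
  case 0
  then have "continuous (at x within U) f" if "x \<in> U" for x
    using that differentiable_imp_continuous_within differentiable_at_withinI by (simp add: Ck_on_Suc, blast)
  then show ?case by (simp add: continuous_on_eq_continuous_within)
next
  case (Suc k) then show ?case by (subst Ck_on_Suc, subst (asm) Ck_on_Suc) blast
qed

lemma Ck_on_subset: "Ck_on k U f \<Longrightarrow> V \<subseteq> U \<Longrightarrow> Ck_on k V f"
  by (induction k arbitrary: f) (auto simp: Ck_on_Suc intro: continuous_on_subset)

lemma Ck_on_const: "Ck_on k U (\<lambda>x. c)"
proof (induction k arbitrary: c)
  case (Suc k)
  have "dd b (\<lambda>x::'a. c) = (\<lambda>x. 0)" for b by (rule ext, rule dd_eqI) (rule has_derivative_const)
  then show ?case unfolding Ck_on_Suc using Suc[of 0] by auto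
qed simp

lemma Ck_on_linear: "bounded_linear f \<Longrightarrow> Ck_on k U f"
proof (cases k)
  case (Suc j)
  assume f: "bounded_linear f"
  have "dd b f = (\<lambda>x. f b)" for b
    by (rule ext, rule dd_eqI) (rule bounded_linear_imp_has_derivative[OF f])
  then show ?thesis using Suc f Ck_on_const bounded_linear_imp_differentiable by (auto simp: Ck_on_Suc)
qed (simp add: linear_continuous_on)

lemma dd_add: "f differentiable (at x) \<Longrightarrow> g differentiable (at x) \<Longrightarrow>
    dd v (\<lambda>y. f y + g y) x = dd v f x + dd v g x"
  by (rule dd_eqI) (intro has_derivative_add has_derivative_dd)

lemma dd_mult: "f differentiable (at x) \<Longrightarrow> g differentiable (at x) \<Longrightarrow>
    dd v (\<lambda>y. f y * g y) x = f x * dd v g x + dd v f x * g x"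
  by (rule dd_eqI) (intro has_derivative_mult has_derivative_dd)

lemma dd_cmult: "f differentiable (at x) \<Longrightarrow> dd v (\<lambda>y. c * f y) x = c * dd v f x"
  by (rule dd_eqI) (intro has_derivative_mult_right has_derivative_dd)

lemma dd_sum: "(\<And>i. i \<in> I \<Longrightarrow> f i differentiable (at x)) \<Longrightarrow>
    dd v (\<lambda>y. \<Sum>i\<in>I. f i y) x = (\<Sum>i\<in>I. dd v (f i) x)"
  by (rule dd_eqI) (intro has_derivative_sum has_derivative_dd)

lemma dd_const [simp]: "dd v (\<lambda>x. c) x = 0"
  by (rule dd_eqI) (rule has_derivative_const)

lemma Ck_on_add:
  assumes "open U" shows "Ck_on k U f \<Longrightarrow> Ck_on k U g \<Longrightarrow> Ck_on k U (\<lambda>x. f x + g x)"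
proof (induction k arbitrary: f g)
  case (Suc k)
  have "Ck_on k U (dd b (\<lambda>x. f x + g x))" if "b \<in> Basis" for b
    by (rule Ck_on_cong[OF assms _ Suc.IH[of "dd b f" "dd b g"]]) (use Suc.prems that in \<open>auto simp: Ck_on_Suc dd_add\<close>)
  then show ?case using Suc.prems unfolding Ck_on_Suc by auto
qed (auto intro: continuous_on_add)

lemma Ck_on_mult:
  assumes "open U" shows "Ck_on k U f \<Longrightarrow> Ck_on k U g \<Longrightarrow> Ck_on k U (\<lambda>x. f x * g x)"
proof (induction k arbitrary: f g)
  case (Suc k)
  have fg: "Ck_on k U f" "Ck_on k U g" using Suc.prems Ck_on_SucD by blast+
  have "Ck_on k U (dd b (\<lambda>x. f x * g x))" if "b \<in> Basis" for b
    by (rule Ck_on_cong[OF assms _ Ck_on_add[OF assms Suc.IH[of f "dd b g"] Suc.IH[of "dd b f" g]]])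
      (use Suc.prems that fg in \<open>auto simp: Ck_on_Suc dd_mult\<close>)
  then show ?case using Suc.prems unfolding Ck_on_Suc by auto
qed (auto intro: continuous_on_mult)

lemma Ck_on_sum:
  assumes "open U" shows "(\<And>i. i \<in> I \<Longrightarrow> Ck_on k U (f i)) \<Longrightarrow> Ck_on k U (\<lambda>x. \<Sum>i\<in>I. f i x)"
  by (induction I rule: infinite_finite_induct) (auto intro: Ck_on_const Ck_on_add[OF assms])

lemma differentiable_euclidean:
  fixes \<Phi> :: "'a::euclidean_space \<Rightarrow> 'b::euclidean_space"
  assumes "\<And>c. c \<in> Basis \<Longrightarrow> (\<lambda>x. \<Phi> x \<bullet> c) differentiable (at x)"
  shows "(\<Phi> has_derivative (\<lambda>v. \<Sum>c\<in>Basis. dd v (\<lambda>x. \<Phi> x \<bullet> c) x *\<^sub>R c)) (at x)"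
  by (subst has_derivative_componentwise_within) (auto simp: inner_sum_left_Basis intro!: has_derivative_dd assms)

text \<open>Induction on \<open>k\<close> through the chain rule: each partial derivative of the
  composite is a finite sum of products of partial derivatives of the components of
  \<open>\<Phi>\<close> with some \<open>dd c F\<close> composed with \<open>\<Phi>\<close>. The
  induction hypothesis is applied to \<open>dd c F\<close>, so \<open>F\<close> is generalised while
  \<open>\<Phi>\<close> stays fixed.\<close>

lemma Ck_on_compose:
  fixes \<Phi> :: "'a::euclidean_space \<Rightarrow> 'b::euclidean_space"
  assumes "open U" "open V" and \<Phi>: "\<And>x. x \<in> U \<Longrightarrow> \<Phi> x \<in> V"
  shows "Ck_on k V F \<Longrightarrow> (\<And>c. c \<in> Basis \<Longrightarrow> Ck_on k U (\<lambda>x. \<Phi> x \<bullet> c)) \<Longrightarrow> Ck_on k U (\<lambda>x. F (\<Phi> x))"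
proof (induction k arbitrary: F)
  case 0
  have "continuous_on U \<Phi>" using 0 continuous_on_componentwise by (auto)
  then show ?case using 0 \<Phi> by (auto intro!: continuous_on_compose2[of V F U \<Phi>])
next
  case (Suc k)
  have \<Phi>': "(\<Phi> has_derivative (\<lambda>v. \<Sum>c\<in>Basis. dd v (\<lambda>x. \<Phi> x \<bullet> c) x *\<^sub>R c)) (at x)" if "x \<in> U" for x
    by (rule differentiable_euclidean) (use Suc.prems that in \<open>auto simp: Ck_on_Suc\<close>)
  have F': "(F has_derivative (\<lambda>v. dd v F (\<Phi> x))) (at (\<Phi> x))" if "x \<in> U" for x
    by (rule has_derivative_dd) (use Suc.prems \<Phi> that in \<open>auto simp: Ck_on_Suc\<close>)
  have comp: "((\<lambda>x. F (\<Phi> x)) has_derivative (\<lambda>v. dd (\<Sum>c\<in>Basis. dd v (\<lambda>x. \<Phi> x \<bullet> c) x *\<^sub>R c) F (\<Phi> x))) (at x)"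
    if "x \<in> U" for x using has_derivative_compose[OF \<Phi>'[OF that] F'[OF that]] by simp
  have diffF: "F differentiable (at (\<Phi> x))" if "x \<in> U" for x using F'[OF that] differentiable_def by blast
  have "Ck_on k U (dd b (\<lambda>x. F (\<Phi> x)))" if b: "b \<in> Basis" for b
  proof (rule Ck_on_cong[OF assms(1)])
    show "Ck_on k U (\<lambda>x. \<Sum>c\<in>Basis. dd b (\<lambda>x. \<Phi> x \<bullet> c) x * dd c F (\<Phi> x))"
    proof (rule Ck_on_sum[OF assms(1)], rule Ck_on_mult[OF assms(1)])
      fix c :: 'b assume c: "c \<in> Basis"
      show "Ck_on k U (dd b (\<lambda>x. \<Phi> x \<bullet> c))" using Suc.prems(2)[OF c] b by (simp add: Ck_on_Suc)
      show "Ck_on k U (\<lambda>x. dd c F (\<Phi> x))"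
      proof (rule Suc.IH)
        show "Ck_on k V (dd c F)" using Suc.prems(1) c by (simp add: Ck_on_Suc)
        show "Ck_on k U (\<lambda>x. \<Phi> x \<bullet> d)" if "d \<in> Basis" for d using Ck_on_SucD[OF Suc.prems(2)[OF that]] .
      qed
    qed
    show "(\<Sum>c\<in>Basis. dd b (\<lambda>x. \<Phi> x \<bullet> c) x * dd c F (\<Phi> x)) = dd b (\<lambda>x. F (\<Phi> x)) x" if "x \<in> U" for x
      unfolding dd_eqI[OF comp[OF that]]
      by (subst dd_sum_Basis[OF diffF[OF that]]) (simp only: inner_sum_left_Basis cong: sum.cong)
  qed
  moreover have "(\<lambda>x. F (\<Phi> x)) differentiable (at x)" if "x \<in> U" for x
    using comp[OF that] differentiable_def by blast
  ultimately show ?case by (simp add: Ck_on_Suc)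
qed

named_theorems cinf

lemma Cinf_cong: "Cinf U f \<Longrightarrow> open U \<Longrightarrow> (\<And>x. x \<in> U \<Longrightarrow> f x = g x) \<Longrightarrow> Cinf U g"
  using Ck_on_cong unfolding Cinf_def by blast
lemma Cinf_subset: "Cinf U f \<Longrightarrow> V \<subseteq> U \<Longrightarrow> Cinf V f"
  using Ck_on_subset unfolding Cinf_def by blast
lemma Cinf_const [cinf]: "Cinf U (\<lambda>x. c)" by (simp add: Cinf_def Ck_on_const)
lemma Cinf_linear: "bounded_linear f \<Longrightarrow> Cinf U f" by (simp add: Cinf_def Ck_on_linear)
lemma Cinf_add [cinf]: "open U \<Longrightarrow> Cinf U f \<Longrightarrow> Cinf U g \<Longrightarrow> Cinf U (\<lambda>x. f x + g x)"
  by (simp add: Cinf_def Ck_on_add)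
lemma Cinf_mult [cinf]: "open U \<Longrightarrow> Cinf U f \<Longrightarrow> Cinf U g \<Longrightarrow> Cinf U (\<lambda>x. f x * g x)"
  by (simp add: Cinf_def Ck_on_mult)
lemma Cinf_minus [cinf]: "open U \<Longrightarrow> Cinf U f \<Longrightarrow> Cinf U (\<lambda>x. - f x)"
  using Cinf_mult[OF _ Cinf_const[of U "-1"], of f] by simp
lemma Cinf_diff [cinf]: "open U \<Longrightarrow> Cinf U f \<Longrightarrow> Cinf U g \<Longrightarrow> Cinf U (\<lambda>x. f x - g x)"
  using Cinf_add[OF _ _ Cinf_minus, of U f g] by simp
lemma Cinf_sum [cinf]: "open U \<Longrightarrow> (\<And>i. i \<in> I \<Longrightarrow> Cinf U (f i)) \<Longrightarrow> Cinf U (\<lambda>x. \<Sum>i\<in>I. f i x)"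
  by (simp add: Cinf_def Ck_on_sum)
lemma Cinf_power [cinf]: "open U \<Longrightarrow> Cinf U f \<Longrightarrow> Cinf U (\<lambda>x. f x ^ m)"
  by (induction m) (auto intro: Cinf_const Cinf_mult)
lemma Cinf_continuous_on: "Cinf U f \<Longrightarrow> continuous_on U f"
  unfolding Cinf_def by (metis Ck_on.simps(1))
lemma Cinf_differentiable: "Cinf U f \<Longrightarrow> x \<in> U \<Longrightarrow> f differentiable (at x)"
  unfolding Cinf_def by (metis Ck_on_Suc)
lemma Cinf_has_derivative: "Cinf U f \<Longrightarrow> x \<in> U \<Longrightarrow> (f has_derivative (\<lambda>v. dd v f x)) (at x)"
  using Cinf_differentiable has_derivative_dd by blast

lemma Cinf_dd [cinf]: assumes "open U" "Cinf U f" shows "Cinf U (dd v f)"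
proof (rule Cinf_cong[OF _ assms(1)])
  have "Cinf U (dd b f)" if "b \<in> Basis" for b
    using assms(2) that unfolding Cinf_def by (metis Ck_on_Suc)
  then show "Cinf U (\<lambda>x. \<Sum>b\<in>Basis. (v \<bullet> b) * dd b f x)" by (intro cinf assms) auto
  show "(\<Sum>b\<in>Basis. (v \<bullet> b) * dd b f x) = dd v f x" if "x \<in> U" for x
    by (rule dd_sum_Basis[symmetric]) (rule Cinf_differentiable[OF assms(2) that])
qed

lemma Cinf_compose:
  fixes \<Phi> :: "'a::euclidean_space \<Rightarrow> 'b::euclidean_space"
  assumes "Cinf V F" "open U" "open V" "\<And>x. x \<in> U \<Longrightarrow> \<Phi> x \<in> V" "\<And>c. c \<in> Basis \<Longrightarrow> Cinf U (\<lambda>x. \<Phi> x \<bullet> c)"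
  shows "Cinf U (\<lambda>x. F (\<Phi> x))"
  using Ck_on_compose[OF assms(2,3), of \<Phi>] assms unfolding Cinf_def by blast

lemma Cinf_compose_real:
  assumes "Cinf V F" "open U" "open V" "\<And>x. x \<in> U \<Longrightarrow> f x \<in> V" "Cinf U f"
  shows "Cinf U (\<lambda>x. F (f x :: real))"
  by (rule Cinf_compose[OF assms(1-4)]) (use assms in auto)

lemma Cinf_compose_Pair:
  fixes f :: "'a::euclidean_space \<Rightarrow> 'b::euclidean_space" and g :: "'a \<Rightarrow> 'c::euclidean_space"
  assumes "Cinf V F" "open U" "open V" "\<And>x. x \<in> U \<Longrightarrow> (f x, g x) \<in> V"
    "\<And>c. c \<in> Basis \<Longrightarrow> Cinf U (\<lambda>x. f x \<bullet> c)" "\<And>c. c \<in> Basis \<Longrightarrow> Cinf U (\<lambda>x. g x \<bullet> c)"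
  shows "Cinf U (\<lambda>x. F (f x, g x))"
proof (rule Cinf_compose[OF assms(1-4)])
  fix c :: "'b \<times> 'c" assume "c \<in> Basis"
  then show "Cinf U (\<lambda>x. (f x, g x) \<bullet> c)" using assms(5,6) by (auto simp: Basis_prod_def inner_prod_def)
qed

text \<open>The derivative is a polynomial in the function itself, so each order of smoothness
  yields the next.\<close>

lemma Cinf_inverse_real: "Cinf {x::real. x \<noteq> 0} inverse"
proof -
  have op: "open {x::real. x \<noteq> 0}" using open_Collect_neq[of "\<lambda>x. x" "\<lambda>x. 0"] by simp
  have "Ck_on k {x::real. x \<noteq> 0} inverse" for k
  proof (induction k)
    case 0 show ?case by (auto intro!: continuous_intros)
  next
    case (Suc k)
    have d: "(inverse has_derivative (\<lambda>v. - (inverse x * v * inverse x))) (at x)" if "x \<noteq> 0" for x :: real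
      using that by (auto intro!: derivative_eq_intros)
    have "Ck_on k {x::real. x \<noteq> 0} (dd 1 inverse)"
    proof (rule Ck_on_cong[OF op])
      show "Ck_on k {x::real. x \<noteq> 0} (\<lambda>x. (-1) * (inverse x * inverse x))"
        by (intro Ck_on_mult[OF op] Ck_on_const Suc)
    qed (use dd_eqI[OF d] in auto)
    then show ?case unfolding Ck_on_Suc using d by (auto simp: differentiable_def)
  qed
  then show ?thesis by (simp add: Cinf_def)
qed

lemma Cinf_inverse [cinf]:
  assumes "open U" "Cinf U f" "\<And>x. x \<in> U \<Longrightarrow> f x \<noteq> 0" shows "Cinf U (\<lambda>x. inverse (f x))"
  by (rule Cinf_compose_real[OF Cinf_inverse_real])
    (use assms open_Collect_neq[of "\<lambda>x::real. x" "\<lambda>x. 0"] in auto)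

lemma Cinf_divide [cinf]:
  assumes "open U" "Cinf U f" "Cinf U g" "\<And>x. x \<in> U \<Longrightarrow> g x \<noteq> 0" shows "Cinf U (\<lambda>x. f x / g x)"
  unfolding divide_inverse using assms by (intro cinf) auto

text \<open>The derivative is half of \<open>inverse (sqrt x)\<close>, which has order
  \<open>k\<close> by composing the induction hypothesis with \<open>inverse\<close>.\<close>

lemma Cinf_sqrt_real: "Cinf {0<..} sqrt"
proof -
  have "Ck_on k {0<..} sqrt" for k
  proof (induction k)
    case 0 show ?case by (auto intro!: continuous_intros)
  next
    case (Suc k)
    have d: "(sqrt has_derivative (\<lambda>v. (inverse (sqrt x) / 2) * v)) (at x)" if "x > 0" for x :: real
      by (rule DERIV_real_sqrt[OF that, unfolded has_field_derivative_def])
    have op: "open {x::real. x \<noteq> 0}" using open_Collect_neq[of "\<lambda>x::real. x" "\<lambda>x. 0"] by simp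
    have "Ck_on k {0<..} (dd 1 sqrt)"
    proof (rule Ck_on_cong)
      have "Ck_on k {0<..} (\<lambda>x. inverse (sqrt x))"
        by (rule Ck_on_compose[OF _ op]) (use Suc Cinf_inverse_real in \<open>auto simp: Cinf_def\<close>)
      then show "Ck_on k {0<..} (\<lambda>x. (1/2) * inverse (sqrt x))"
        by (intro Ck_on_mult Ck_on_const) auto
    qed (use dd_eqI[OF d] in auto)
    then show ?case unfolding Ck_on_Suc using d by (auto simp: differentiable_def)
  qed
  then show ?thesis by (simp add: Cinf_def)
qed

lemma Cinf_sqrt [cinf]:
  assumes "open U" "Cinf U f" "\<And>x. x \<in> U \<Longrightarrow> f x > 0" shows "Cinf U (\<lambda>x. sqrt (f x))"
  by (rule Cinf_compose_real[OF Cinf_sqrt_real]) (use assms in auto)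

lemma Cinf_inner [cinf]: "Cinf U (\<lambda>x. x \<bullet> c)"
  by (rule Cinf_linear) (rule bounded_linear_inner_left)
lemma Cinf_nth [cinf]: "Cinf U (\<lambda>x::real^'n. x $ i)"
  by (rule Cinf_linear) (rule bounded_linear_vec_nth)
lemma Cinf_snd_nth [cinf]: "Cinf U (\<lambda>q::real \<times> (real^'n). snd q $ i)"
  by (rule Cinf_linear) (intro bounded_linear_compose[OF bounded_linear_vec_nth] bounded_linear_snd)
lemma Cinf_fst [cinf]: "Cinf U (\<lambda>q::real \<times> 'a::euclidean_space. fst q)"
  by (rule Cinf_linear) (rule bounded_linear_fst)
lemma Cinf_fst_inner [cinf]: "Cinf U (\<lambda>q::'b::euclidean_space \<times> 'a::euclidean_space. fst q \<bullet> c)"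
  by (rule Cinf_linear) (intro bounded_linear_compose[OF bounded_linear_inner_left] bounded_linear_fst)
lemma Cinf_snd_inner [cinf]: "Cinf U (\<lambda>q::'b::euclidean_space \<times> 'a::euclidean_space. snd q \<bullet> c)"
  by (rule Cinf_linear) (intro bounded_linear_compose[OF bounded_linear_inner_left] bounded_linear_snd)
lemma Cinf_ident [cinf]: "Cinf U (\<lambda>x::real. x)"
  by (rule Cinf_linear) (rule bounded_linear_ident)

lemma Cinf_inner_self [cinf]:
  assumes "open U" shows "Cinf U (\<lambda>x::'a::euclidean_space. x \<bullet> x)"
proof (rule Cinf_cong[OF _ assms])
  show "Cinf U (\<lambda>x::'a. \<Sum>b\<in>Basis. (x \<bullet> b) * (x \<bullet> b))" by (intro cinf assms)
qed (rule euclidean_inner[symmetric])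

lemma Cinf_norm [cinf]:
  assumes "open U" "0 \<notin> U" shows "Cinf U (\<lambda>x::'a::euclidean_space. norm x)"
  unfolding norm_eq_sqrt_inner by (intro cinf assms) (use assms(2) in auto)

lemma dd_compose_linear:
  assumes "bounded_linear l" "g differentiable (at (l x + c))"
  shows "dd v (\<lambda>y. g (l y + c)) x = dd (l v) g (l x + c)"
proof (rule dd_eqI)
  have "((\<lambda>y. l y + c) has_derivative l) (at x)"
    using bounded_linear_imp_has_derivative[OF assms(1)] by (auto intro!: derivative_eq_intros)
  from has_derivative_compose[OF this has_derivative_dd[OF assms(2)]]
  show "((\<lambda>y. g (l y + c)) has_derivative (\<lambda>v. dd (l v) g (l x + c))) (at x)" .
qed

lemma dd_scale: "g differentiable (at (t *\<^sub>R x)) \<Longrightarrow> dd v (\<lambda>y. g (t *\<^sub>R y)) x = t * dd v g (t *\<^sub>R x)"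
  using dd_compose_linear[OF bounded_linear_scaleR_right, of g t x 0 v]
    linear_scale[OF dd_linear, of g "t *\<^sub>R x" t v] by simp

lemma dd_slice_snd: "q differentiable (at (r, x)) \<Longrightarrow> dd v (\<lambda>y. q (r, y)) x = dd (0, v) q (r, x)"
  using dd_compose_linear[of "\<lambda>y. (0, y)" q x "(r, 0)" v]
  by (simp add: bounded_linear_Pair bounded_linear_zero bounded_linear_ident)

lemma dd_slice_fst: "q differentiable (at (r, x)) \<Longrightarrow> dd v (\<lambda>s. q (s, x)) r = dd (v, 0) q (r, x)"
  using dd_compose_linear[of "\<lambda>y. (y, 0)" q r "(0, x)" v]
  by (simp add: bounded_linear_Pair bounded_linear_zero bounded_linear_ident)

section \<open>The Laplace--Beltrami operator in polar coordinates\<close>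

text \<open>Functions on the unit sphere are represented by extensions that are constant along rays;
  only values off the origin matter. For such \<open>g\<close> the expression
  \<open>(x \<bullet> x) * lapl g x\<close> is the Laplacian of the sphere.\<close>

definition hom0 :: "('a::euclidean_space \<Rightarrow> real) \<Rightarrow> bool" where
  "hom0 g \<longleftrightarrow> (\<forall>t x. t > 0 \<longrightarrow> x \<noteq> 0 \<longrightarrow> g (t *\<^sub>R x) = g x)"

definition lapl :: "(real^'n \<Rightarrow> real) \<Rightarrow> real^'n \<Rightarrow> real" where
  "lapl g x = (\<Sum>i\<in>UNIV. dd (axis i 1) (dd (axis i 1) g) x)"

lemma open_punctured [simp]: "open (- {0::'a::euclidean_space})" by auto

lemma dd_homogeneous:
  assumes g: "Cinf (-{0}) g" and h: "\<And>y. y \<noteq> 0 \<Longrightarrow> g (t *\<^sub>R y) = c * g y" and "t > 0" "x \<noteq> 0"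
  shows "dd v g (t *\<^sub>R x) = c / t * dd v g x"
proof -
  have d: "g differentiable (at y)" if "y \<noteq> 0" for y using Cinf_differentiable[OF g] that by auto
  have "dd v (\<lambda>y. g (t *\<^sub>R y)) x = dd v (\<lambda>y. c * g y) x"
    by (rule dd_cong[of "-{0}"]) (use h assms in auto)
  then show ?thesis using dd_scale[of g t x v] dd_cmult[of g x v c] d assms by (simp add: field_simps)
qed

text \<open>Each derivative lowers the degree of homogeneity by one, here from 0 to -2.\<close>

lemma lapl_hom0:
  assumes g: "Cinf (-{0}) g" "hom0 g" and t: "t > 0" and x: "x \<noteq> 0"
  shows "lapl g (t *\<^sub>R x) = lapl g x / t\<^sup>2"
proof -
  have 1: "dd v g (t *\<^sub>R y) = 1 / t * dd v g y" if "y \<noteq> 0" for v y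
    using dd_homogeneous[OF g(1), of t 1] g(2) t that by (auto simp: hom0_def)
  have "dd v (dd v g) (t *\<^sub>R x) = 1 / t / t * dd v (dd v g) x" for v
    by (rule dd_homogeneous) (use 1 t x g Cinf_dd[of "-{0}" g] in auto)
  then show ?thesis by (simp add: lapl_def sum_divide_distrib power2_eq_square field_simps)
qed

text \<open>The function is constant on the ray through \<open>x\<close>. This orthogonality of
  gradient and position is what later decouples radial and spherical derivatives.\<close>

lemma hom0_euler:
  assumes g: "g differentiable (at x)" "hom0 g" and x: "x \<noteq> 0"
  shows "dd x g x = 0"
proof -
  have "dd 1 (\<lambda>t. g (t *\<^sub>R x)) (1::real) = dd x g x"
    using dd_compose_linear[OF bounded_linear_scaleR_left[of x], where g=g and x=1 and c=0 and v=1] g by simp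
  moreover have "dd 1 (\<lambda>t. g (t *\<^sub>R x)) (1::real) = dd 1 (\<lambda>t. g x) (1::real)"
    by (rule dd_cong[of "{0<..}"]) (use g x in \<open>auto simp: hom0_def\<close>)
  ultimately show ?thesis by simp
qed

lemma dd_sum_axis:
  fixes g :: "real^'n \<Rightarrow> real"
  assumes "g differentiable (at x)" shows "dd v g x = (\<Sum>i\<in>UNIV. v $ i * dd (axis i 1) g x)"
proof -
  interpret linear "\<lambda>v. dd v g x" by (rule dd_linear[OF assms])
  have "(\<Sum>i\<in>UNIV. v $ i *\<^sub>R axis i 1) = v"
    using basis_expansion[of v] by (simp add: scalar_mult_eq_scaleR)
  then have "dd v g x = dd (\<Sum>i\<in>UNIV. v $ i *\<^sub>R axis i 1) g x" by (simp only:)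
  also have "\<dots> = (\<Sum>i\<in>UNIV. v $ i * dd (axis i 1) g x)" by (simp add: sum scale)
  finally show ?thesis .
qed

text \<open>The matrix \<open>a I + b e e\<^sup>T\<close>, where \<open>e = x / |x|\<close>.\<close>

definition axial :: "real \<Rightarrow> real \<Rightarrow> real^'n \<Rightarrow> real^'n^'n" where
  "axial a b x = (\<chi> i j. a * (if i = j then 1 else 0) + b * (x $ i * x $ j) / (x \<bullet> x))"

lemma inner_sum_sq: "(\<Sum>i\<in>UNIV. x $ i * x $ i) = x \<bullet> (x::real^'n)" by (simp add: inner_vec_def)

text \<open>With \<open>e = x / |x|\<close> the matrix \<open>e e^T\<close> is a projection, so
  these matrices form a commutative algebra.\<close>

lemma axial_mult:
  assumes "x \<noteq> 0" shows "axial a b x ** axial c d x = axial (a * c) (a * d + b * c + b * d) x"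
proof -
  let ?s = "x \<bullet> x"
  have s: "?s \<noteq> 0" using assms by simp
  have "(\<Sum>k\<in>UNIV. (a * (if i = k then 1 else 0) + b * (x $ i * x $ k) / ?s)
      * (c * (if k = j then 1 else 0) + d * (x $ k * x $ j) / ?s))
    = a * c * (if i = j then 1 else 0) + (a * d + b * c + b * d) * (x $ i * x $ j) / ?s" for i j
  proof -
    have "(\<Sum>k\<in>UNIV. (a * (if i = k then 1 else 0) + b * (x $ i * x $ k) / ?s)
      * (c * (if k = j then 1 else 0) + d * (x $ k * x $ j) / ?s))
     = (\<Sum>k\<in>UNIV. (if i = k then a * c * (if k = j then 1 else 0) else 0) + (if i = k then a * d * (x $ k * x $ j) / ?s else 0)
      + (if k = j then b * c * (x $ i * x $ k) / ?s else 0) + (b * d * (x $ i * x $ j) / ?s / ?s) * (x $ k * x $ k))"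
      by (intro sum.cong refl) (auto simp: algebra_simps add_divide_distrib)
    also have "\<dots> = a * c * (if i = j then 1 else 0) + a * d * (x $ i * x $ j) / ?s
      + b * c * (x $ i * x $ j) / ?s + (b * d * (x $ i * x $ j) / ?s / ?s) * ?s"
      by (simp only: sum.distrib sum_distrib_left[symmetric] inner_sum_sq sum.delta sum.delta' finite_class.finite_UNIV UNIV_I if_True)
    also have "\<dots> = a * c * (if i = j then 1 else 0) + (a * d + b * c + b * d) * (x $ i * x $ j) / ?s"
      using s by (simp add: field_simps)
    finally show ?thesis .
  qed
  then show ?thesis by (simp add: axial_def matrix_matrix_mult_def vec_eq_iff)
qed

text \<open>\<open>axial c (1 - c) x\<close> acts as 1 on the line of \<open>x\<close> and as
  \<open>c\<close> on its orthogonal complement.\<close>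

lemma axial_inverse:
  assumes "x \<noteq> 0" "c \<noteq> 0" shows "matrix_inv (axial c (1 - c) x) = axial (1 / c) (1 - 1 / c) x"
proof -
  have one: "axial 1 0 x = mat 1" by (simp add: axial_def mat_def vec_eq_iff)
  have "axial c (1 - c) x ** axial (1 / c) (1 - 1 / c) x = mat 1"
    unfolding axial_mult[OF assms(1)] one[symmetric] using assms(2) by (intro arg_cong2[where f="\<lambda>a b. axial a b x"]) (simp_all add: field_simps)
  moreover from this have "axial (1 / c) (1 - 1 / c) x ** axial c (1 - c) x = mat 1"
    using matrix_left_right_inverse by blast
  ultimately show ?thesis unfolding matrix_inv_def
    by (intro some_equality) (metis matrix_mul_assoc matrix_mul_lid matrix_mul_rid)+
qed

text \<open>A rotation carrying a coordinate vector to \<open>x / |x|\<close> conjugates a diagonal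
  matrix, with one entry \<open>a + b\<close> and all others \<open>a\<close>, into
  \<open>axial a b x\<close>.\<close>

lemma axial_det:
  fixes x :: "real^'n"
  assumes "x \<noteq> 0" "CARD('n) \<ge> 2" shows "det (axial a b x) = a ^ (CARD('n) - 1) * (a + b)"
proof -
  obtain k :: 'n where True by blast
  obtain A :: "real^'n^'n" where A: "rotation_matrix A" "A *v axis k 1 = x /\<^sub>R norm x"
    using rotation_matrix_exists_basis[of "x /\<^sub>R norm x" k] assms by auto
  have orth: "A ** transpose A = mat 1" and dA: "det A = 1"
    using A(1) by (auto simp: rotation_matrix_def orthogonal_matrix_def)
  define Dg :: "real^'n^'n" where "Dg = (\<chi> i j. if i = j then (if i = k then a + b else a) else 0)"
  have Ak: "A $ i $ k = x $ i / norm x" for i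
    using arg_cong[OF A(2), of "\<lambda>v. v $ i"] by (simp add: matrix_vector_mul_component inner_axis divide_inverse mult.commute)
  have "(A ** Dg ** transpose A) $ i $ j = axial a b x $ i $ j" for i j
  proof -
    have "(A ** Dg) $ i $ l = A $ i $ l * (if l = k then a + b else a)" for l
      by (simp add: matrix_matrix_mult_def Dg_def if_distrib[of "\<lambda>t. _ * t"] cong: if_cong)
    then have "(A ** Dg ** transpose A) $ i $ j = (\<Sum>l\<in>UNIV. A $ i $ l * (if l = k then a + b else a) * A $ j $ l)"
      by (simp add: matrix_matrix_mult_def[of "A ** Dg"] transpose_def)
    also have "\<dots> = (\<Sum>l\<in>UNIV. a * (A $ i $ l * A $ j $ l) + (if l = k then b * A $ i $ l * A $ j $ l else 0))"
      by (intro sum.cong) (auto simp: algebra_simps)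
    also have "\<dots> = a * (A ** transpose A) $ i $ j + b * A $ i $ k * A $ j $ k"
      by (simp add: sum.distrib sum_distrib_left[symmetric] matrix_matrix_mult_def transpose_def)
    also have "\<dots> = axial a b x $ i $ j"
      by (simp add: orth mat_def axial_def Ak dot_square_norm power2_eq_square)
    finally show ?thesis .
  qed
  then have eq: "A ** Dg ** transpose A = axial a b x" by (simp add: vec_eq_iff)
  have "det Dg = (\<Prod>i\<in>UNIV. if i = k then a + b else a)"
    by (subst det_diagonal) (auto simp: Dg_def)
  also have "\<dots> = (a + b) * a ^ (CARD('n) - 1)"
    by (subst prod.remove[of _ k]) (auto simp: card_Diff_singleton)
  finally show ?thesis using eq det_mul[of "A ** Dg" "transpose A"] det_mul[of A Dg] dA by (simp add: mult.commute)
qed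

lemma polar_param_derivative:
  fixes x :: "real^'n"
  assumes "x \<noteq> 0"
  shows "(polar_param has_derivative (\<lambda>v. ((x \<bullet> v) / norm x, v /\<^sub>R norm x - ((x \<bullet> v) / norm x ^ 3) *\<^sub>R x))) (at x)"
proof -
  have n: "(norm has_derivative (\<lambda>v. (x \<bullet> v) / norm x)) (at x)"
    using has_derivative_norm[OF assms] by (simp add: sgn_div_norm inner_commute divide_inverse mult.commute)
  have i: "((\<lambda>x. inverse (norm x)) has_derivative (\<lambda>v. - (inverse (norm x) * ((x \<bullet> v) / norm x) * inverse (norm x)))) (at x)"
    by (rule Deriv.has_derivative_inverse[OF _ n]) (use assms in auto)
  have "(\<lambda>v. inverse (norm x) *\<^sub>R v + (- (inverse (norm x) * ((x \<bullet> v) / norm x) * inverse (norm x))) *\<^sub>R x)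
    = (\<lambda>v. v /\<^sub>R norm x - ((x \<bullet> v) / norm x ^ 3) *\<^sub>R x)"
    by (auto simp: fun_eq_iff divide_inverse power3_eq_cube inner_commute)
  with has_derivative_scaleR[OF i has_derivative_ident]
  have "((\<lambda>x. x /\<^sub>R norm x) has_derivative (\<lambda>v. v /\<^sub>R norm x - ((x \<bullet> v) / norm x ^ 3) *\<^sub>R x)) (at x)" by simp
  from has_derivative_Pair[OF n this] show ?thesis by (simp add: polar_param_def[abs_def])
qed

text \<open>Radial vectors keep their length, and vectors tangent to the sphere of radius
  \<open>norm x\<close> are stretched by \<open>h (norm x) / norm x\<close>.\<close>

lemma metric_coeffs_axial:
  fixes x :: "real^'n"
  assumes "x \<noteq> 0"
  shows "metric_coeffs h x = axial ((h (norm x) / norm x)\<^sup>2) (1 - (h (norm x) / norm x)\<^sup>2) x"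
proof -
  let ?r = "norm x"
  have fd: "frechet_derivative polar_param (at x) v = ((x \<bullet> v) / ?r, v /\<^sub>R ?r - ((x \<bullet> v) / ?r ^ 3) *\<^sub>R x)" for v
    by (rule fun_cong[OF frechet_derivative_at[OF polar_param_derivative[OF assms], symmetric]])
  have r: "?r > 0" "x \<bullet> x = ?r\<^sup>2" using assms by (auto simp: dot_square_norm)
  have alg: "(1 / r * (1 / r)) * d - b / r^3 * (1 / r * a) - (a / r^3 * (1 / r * b) - a / r^3 * (b / r^3 * r\<^sup>2))
    = (d - a * b / r\<^sup>2) / r\<^sup>2" if "r > 0" for r a b d :: real
    using that by (simp add: divide_simps power2_eq_square power3_eq_cube)
  have ip: "(axis i 1 /\<^sub>R ?r - (x $ i / ?r ^ 3) *\<^sub>R x) \<bullet> (axis j 1 /\<^sub>R ?r - (x $ j / ?r ^ 3) *\<^sub>R x)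
    = ((if i = j then 1 else 0) - x $ i * x $ j / ?r\<^sup>2) / ?r\<^sup>2" for i j
  proof -
    have "(axis i 1 /\<^sub>R ?r - (x $ i / ?r ^ 3) *\<^sub>R x) \<bullet> (axis j 1 /\<^sub>R ?r - (x $ j / ?r ^ 3) *\<^sub>R x)
      = (1 / ?r * (1 / ?r)) * (axis i 1 \<bullet> axis j (1::real)) - x $ j / ?r^3 * (1 / ?r * x $ i)
        - (x $ i / ?r^3 * (1 / ?r * x $ j) - x $ i / ?r^3 * (x $ j / ?r^3 * (x \<bullet> x)))"
      by (simp add: inner_diff_left inner_diff_right inner_axis inner_axis' divide_inverse right_diff_distrib mult_ac)
    also have "axis i 1 \<bullet> axis j (1::real) = (if i = j then 1 else 0)" by (simp add: inner_axis_axis)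
    finally show ?thesis unfolding r(2) alg[OF r(1)] .
  qed
  have alg2: "a * b / r / r + c\<^sup>2 * ((d - a * b / r\<^sup>2) / r\<^sup>2) = (c / r)\<^sup>2 * d + (1 - (c / r)\<^sup>2) * (a * b) / r\<^sup>2"
    if "r > 0" for r a b c d :: real
    using that by (simp add: field_simps power2_eq_square)
  have "metric_coeffs h x $ i $ j = x $ i * x $ j / ?r / ?r + (h ?r)\<^sup>2 * (((if i = j then 1 else 0) - x $ i * x $ j / ?r\<^sup>2) / ?r\<^sup>2)" for i j
    unfolding ip[symmetric] by (simp add: metric_coeffs_def revolution_metric_def polar_param_def fd inner_axis)
  then show ?thesis unfolding alg2[OF r(1)] by (simp add: vec_eq_iff axial_def r(2))
qed

lemma dd_snd_nth [simp]: "dd v (\<lambda>q::'a::euclidean_space \<times> (real^'n). snd q $ i) z = snd v $ i"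
  by (rule dd_eqI) (auto intro!: bounded_linear_imp_has_derivative
      bounded_linear_compose[OF bounded_linear_vec_nth] bounded_linear_snd)

lemma dd_fst_fun:
  assumes "(k has_real_derivative k') (at (fst z))"
  shows "dd v (\<lambda>q::real \<times> 'b::euclidean_space. k (fst q)) z = k' * fst v"
  by (rule dd_eqI) (use has_derivative_compose[OF has_derivative_fst[OF has_derivative_ident] assms[unfolded has_field_derivative_def]]
     in \<open>simp\<close>)

text \<open>Functions are written as \<open>w (norm y, y)\<close>, so that radius and direction
  become independent variables; the chain rule recombines the two derivatives.\<close>

lemma dd_diagonal:
  fixes w :: "real \<times> (real^'n) \<Rightarrow> real"
  assumes "w differentiable (at (norm y, y))" "y \<noteq> 0"
  shows "dd v (\<lambda>y. w (norm y, y)) y = (y \<bullet> v) / norm y * dd (1, 0) w (norm y, y) + dd (0, v) w (norm y, y)"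
proof -
  have n: "(norm has_derivative (\<lambda>v. (y \<bullet> v) / norm y)) (at y)"
    using has_derivative_norm[OF assms(2)] by (simp add: sgn_div_norm inner_commute divide_inverse mult.commute)
  have "((\<lambda>y. w (norm y, y)) has_derivative (\<lambda>v. dd ((y \<bullet> v) / norm y, v) w (norm y, y))) (at y)"
    by (rule has_derivative_compose[OF has_derivative_Pair[OF n has_derivative_ident] has_derivative_dd[OF assms(1)]])
  then have "dd v (\<lambda>y. w (norm y, y)) y = dd ((y \<bullet> v) / norm y, v) w (norm y, y)" by (rule dd_eqI)
  also have "((y \<bullet> v) / norm y, v) = ((y \<bullet> v) / norm y) *\<^sub>R (1, 0) + (0, v)" by simp
  finally show ?thesis
    by (simp only: linear_add[OF dd_linear[OF assms(1)]] linear_scale[OF dd_linear[OF assms(1)]] real_scaleR_def)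
qed

lemma sqrt_det_axial:
  fixes x :: "real^'n"
  assumes "x \<noteq> 0" "CARD('n) \<ge> 2" "c \<ge> 0"
  shows "sqrt (det (axial (c\<^sup>2) (1 - c\<^sup>2) x)) = c ^ (CARD('n) - 1)"
  using assms by (simp add: axial_det real_sqrt_power)

text \<open>With \<open>u x = q (norm x, x)\<close> the Euler relation removes all mixed terms and
  leaves the warped-product formula: the radial part \<open>h^(1-n) (h^(n-1) q_r)_r\<close> plus the
  spherical Laplacian divided by \<open>h^2\<close>. The latter appears as
  \<open>(norm x)^2 * lapl\<close>, because the slice is constant along rays.\<close>

lemma laplace_beltrami_polar:
  fixes q :: "real \<times> (real^'n) \<Rightarrow> real"
  assumes n: "CARD('n) \<ge> 2" and hC: "Cinf {0<..<L} h" and hpos: "\<And>r. 0 < r \<Longrightarrow> r < L \<Longrightarrow> h r > 0"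
    and qC: "Cinf ({0<..<L} \<times> - {0}) q" and hom: "\<And>r. 0 < r \<Longrightarrow> r < L \<Longrightarrow> hom0 (\<lambda>x. q (r, x))"
    and u: "\<And>x. 0 < norm x \<Longrightarrow> norm x < L \<Longrightarrow> u x = q (norm x, x)"
    and x: "0 < norm x" "norm x < L"
  shows "laplace_beltrami (metric_coeffs h) u x =
    dd (1, 0) (\<lambda>z. h (fst z) ^ (CARD('n) - 1) * dd (1, 0) q z) (norm x, x) / h (norm x) ^ (CARD('n) - 1)
    + lapl (\<lambda>y. q (norm x, y)) x * (norm x / h (norm x))\<^sup>2"
proof -
  define nu where "nu = CARD('n) - 1"
  define O' where "O' = {0<..<L} \<times> - {0::real^'n}"
  define \<Omega> where "\<Omega> = {x::real^'n. 0 < norm x \<and> norm x < L}"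
  have opO: "open O'" unfolding O'_def by (intro open_Times) auto
  have op\<Omega>: "open \<Omega>" unfolding \<Omega>_def by (intro open_Collect_conj open_Collect_less continuous_intros)
  have qC: "Cinf O' q" using qC by (simp add: O'_def)
  have hC2: "Cinf O' (\<lambda>z. h (fst z))"
    by (rule Cinf_compose_real[OF hC opO]) (auto simp: O'_def intro: cinf)
  have mem: "(norm y, y) \<in> O'" if "y \<in> \<Omega>" for y using that by (auto simp: \<Omega>_def O'_def)
  define e where "e i = ((0::real), axis i (1::real) :: real^'n)" for i
  define Z where "Z z = h (fst z) ^ nu * dd (1, 0) q z" for z
  \<comment> \<open>\<open>P\<close> and \<open>Q\<close> are the coefficients of the flux
    \<open>sqrt |G| G^(ij) d_j u\<close>: its radial part is \<open>P\<close> times the position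
    vector, its tangential part \<open>Q\<close> times the gradient of \<open>q\<close> in the
    second argument. Their sum is \<open>W i\<close>.\<close>
  define P where "P z = inverse (fst z ^ (nu + 1)) * Z z" for z
  define Q where "Q r = (h r / r) ^ nu * (r / h r)\<^sup>2" for r
  define W where "W i z = P z * (snd z $ i) + Q (fst z) * dd (e i) q z" for i z
  have fstpos: "fst z > 0" "fst z < L" "snd z \<noteq> 0" "h (fst z) > 0" if "z \<in> O'" for z
    using that hpos by (auto simp: O'_def)
  have ZC: "Cinf O' Z" unfolding Z_def by (intro cinf opO hC2 qC)
  have PC: "Cinf O' P" unfolding P_def by (intro cinf opO ZC) (metis fstpos(1) less_irrefl power_not_zero)
  have QC1: "Cinf {0<..<L} Q" unfolding Q_def
    by (intro cinf hC) (use hpos in \<open>auto dest: less_imp_neq\<close>, metis less_irrefl hpos)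
  have QC: "Cinf O' (\<lambda>z. Q (fst z))"
    by (rule Cinf_compose_real[OF QC1 opO]) (auto simp: O'_def intro: cinf)
  have WC: "Cinf O' (W i)" for i unfolding W_def by (intro cinf opO PC QC qC)
  have diff: "w differentiable (at z)" if "Cinf O' w" "z \<in> O'" for w z using that Cinf_differentiable by blast
  have euler: "(\<Sum>i\<in>UNIV. snd z $ i * dd (e i) w z) = 0"
    if w: "Cinf O' w" and hw: "hom0 (\<lambda>y. w (fst z, y))" and z: "z \<in> O'" for w z
  proof -
    obtain r y where zz: "z = (r, y)" by (cases z)
    have d: "w differentiable (at (r, y))" using diff w z zz by blast
    have "(\<lambda>y. w (r, y)) differentiable (at y)"
      by (rule differentiable_chain_at[of "\<lambda>y. (r, y)" y w, unfolded o_def])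
        (use d in \<open>auto intro!: differentiable_Pair\<close>)
    then have "dd y (\<lambda>y. w (r, y)) y = 0" and "dd y (\<lambda>y. w (r, y)) y = (\<Sum>i\<in>UNIV. y $ i * dd (axis i 1) (\<lambda>y. w (r, y)) y)"
      using hom0_euler[of "\<lambda>y. w (r, y)" y] hw z dd_sum_axis[of "\<lambda>y. w (r, y)" y y] by (auto simp: zz O'_def)
    then show ?thesis using dd_slice_snd[OF d] by (simp add: zz e_def)
  qed
  have homq: "hom0 (\<lambda>y. q (fst z, y))" if "z \<in> O'" for z using that hom by (auto simp: O'_def)
  have homP: "hom0 (\<lambda>y. P (fst z, y))" if z: "z \<in> O'" for z
  proof -
    have "dd (1, 0) q (fst z, t *\<^sub>R y) = dd (1, 0) q (fst z, y)" if t: "t > 0" "y \<noteq> 0" for t y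
    proof -
      have "dd 1 (\<lambda>s. q (s, t *\<^sub>R y)) (fst z) = dd 1 (\<lambda>s. q (s, y)) (fst z)"
        by (rule dd_cong[of "{0<..<L}"]) (use hom t z in \<open>auto simp: hom0_def O'_def\<close>)
      then show ?thesis using dd_slice_fst[OF diff[OF qC]] t z by (auto simp: O'_def)
    qed
    then show ?thesis by (simp add: hom0_def P_def Z_def)
  qed
  have V: "sqrt (det (metric_coeffs h y)) * (\<Sum>j\<in>UNIV. matrix_inv (metric_coeffs h y) $ i $ j * partial_deriv j u y)
     = W i (norm y, y)" if y: "y \<in> \<Omega>" for y i
  proof -
    let ?r = "norm y"
    have r: "?r > 0" "?r < L" "y \<noteq> 0" "h ?r > 0" "y \<bullet> y = ?r\<^sup>2" using y hpos by (auto simp: \<Omega>_def dot_square_norm)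
    have pd: "partial_deriv j u y = y $ j / ?r * dd (1, 0) q (?r, y) + dd (e j) q (?r, y)" for j
    proof -
      have "partial_deriv j u y = dd (axis j 1) (\<lambda>y. q (norm y, y)) y"
        unfolding partial_deriv_def dd_def[symmetric] by (rule dd_cong[OF op\<Omega> y]) (use u in \<open>auto simp: \<Omega>_def\<close>)
      then show ?thesis
        using dd_diagonal[OF diff[OF qC mem[OF y]] r(3)] by (simp add: inner_axis e_def)
    qed
    define c where "c = (?r / h ?r)\<^sup>2"
    have inv: "matrix_inv (metric_coeffs h y) = axial c (1 - c) y"
      unfolding metric_coeffs_axial[OF r(3)] using axial_inverse[OF r(3), of "(h ?r / ?r)\<^sup>2"] r
      by (simp add: c_def power_divide)
    have sq: "sqrt (det (metric_coeffs h y)) = (h ?r / ?r) ^ nu"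
      unfolding metric_coeffs_axial[OF r(3)] nu_def by (rule sqrt_det_axial) (use r n in auto)
    let ?u = "\<lambda>j. y $ j / ?r * dd (1, 0) q (?r, y) + dd (e j) q (?r, y)"
    have eu: "(\<Sum>j\<in>UNIV. y $ j * dd (e j) q (?r, y)) = 0" using euler[OF qC homq mem[OF y]] mem[OF y] by simp
    have "(\<Sum>j\<in>UNIV. y $ j * ?u j) = (\<Sum>j\<in>UNIV. y $ j * y $ j) * (dd (1, 0) q (?r, y) / ?r) + (\<Sum>j\<in>UNIV. y $ j * dd (e j) q (?r, y))"
      by (simp add: sum_distrib_left sum.distrib sum_divide_distrib distrib_left mult_ac)
    also have "\<dots> = ?r * dd (1, 0) q (?r, y)" unfolding eu inner_sum_sq using r by (simp add: power2_eq_square)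
    finally have yu: "(\<Sum>j\<in>UNIV. y $ j * ?u j) = ?r * dd (1, 0) q (?r, y)" .
    have "(\<Sum>j\<in>UNIV. axial c (1 - c) y $ i $ j * ?u j)
        = (\<Sum>j\<in>UNIV. (if i = j then c * ?u j else 0) + (1 - c) * y $ i / ?r\<^sup>2 * (y $ j * ?u j))"
    proof (intro sum.cong refl)
      fix j
      have "(c * (if i = j then 1 else 0) + d * (a * b) / s) * w = (if i = j then c * w else 0) + d * a / s * (b * w)"
        for a b d s w :: real by (simp add: algebra_simps)
      then show "axial c (1 - c) y $ i $ j * ?u j = (if i = j then c * ?u j else 0) + (1 - c) * y $ i / ?r\<^sup>2 * (y $ j * ?u j)"
        by (simp only: axial_def r(5) vec_lambda_beta)
    qed
    also have "\<dots> = c * ?u i + (1 - c) * y $ i / ?r\<^sup>2 * (?r * dd (1, 0) q (?r, y))"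
      by (simp only: sum.distrib sum_distrib_left[symmetric] yu sum.delta' finite_class.finite_UNIV UNIV_I if_True)
    also have "\<dots> = y $ i / ?r * dd (1, 0) q (?r, y) + c * dd (e i) q (?r, y)"
      using r by (simp add: field_simps power2_eq_square)
    finally show ?thesis unfolding pd inv sq using r
      by (simp add: W_def P_def Q_def Z_def c_def algebra_simps power_divide power_add divide_inverse power_inverse)
  qed
  let ?z = "(norm x, x)" and ?r = "norm x"
  have x\<Omega>: "x \<in> \<Omega>" using x by (simp add: \<Omega>_def)
  have zO: "?z \<in> O'" by (rule mem[OF x\<Omega>])
  have r: "?r > 0" "?r < L" "x \<noteq> 0" "h ?r > 0" "x \<bullet> x = ?r\<^sup>2" using x hpos by (auto simp: dot_square_norm)
  note D = diff[OF _ zO]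
  have sx: "(\<lambda>z::real\<times>(real^'n). snd z $ i) differentiable (at ?z)" for i by (rule D) (intro cinf)
  have eC: "Cinf O' (dd (e i) q)" for i by (intro cinf opO qC)
  obtain Q' where Q': "(Q has_real_derivative Q') (at ?r)"
    using Cinf_differentiable[OF QC1, of ?r] r by (auto simp: real_differentiable_def)
  have d1: "dd (1, 0) (W i) ?z = x $ i * dd (1, 0) P ?z + Q' * dd (e i) q ?z + Q ?r * dd (1, 0) (dd (e i) q) ?z" for i
    unfolding W_def
    by (subst dd_add, (intro differentiable_mult D PC QC eC sx)+, subst dd_mult[OF D[OF PC] sx], subst dd_mult[OF D[OF QC] D[OF eC]])
      (simp add: dd_fst_fun[of Q Q' ?z, simplified, OF Q'])
  have d2: "dd (e i) (W i) ?z = P ?z + x $ i * dd (e i) P ?z + Q ?r * dd (e i) (dd (e i) q) ?z" for i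
    unfolding W_def
    by (subst dd_add, (intro differentiable_mult D PC QC eC sx)+, subst dd_mult[OF D[OF PC] sx], subst dd_mult[OF D[OF QC] D[OF eC]])
      (simp add: dd_fst_fun[of Q Q' ?z, simplified, OF Q'] e_def)
  have e1: "(\<Sum>i\<in>UNIV. x $ i * dd (e i) q ?z) = 0" using euler[OF qC homq zO] zO by simp
  have e2: "(\<Sum>i\<in>UNIV. x $ i * dd (e i) P ?z) = 0" using euler[OF PC homP zO] zO by simp
  \<comment> \<open>The Euler relation holds at every radius, so it may be differentiated in the
    radial variable.\<close>
  have e3: "(\<Sum>i\<in>UNIV. x $ i * dd (1, 0) (dd (e i) q) ?z) = 0"
  proof -
    have "dd (1, 0) (\<lambda>z. \<Sum>i\<in>UNIV. snd z $ i * dd (e i) q z) ?z = dd (1, 0) (\<lambda>z. 0) ?z"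
      by (rule dd_cong[OF opO zO]) (use euler[OF qC homq] in auto)
    moreover have "dd (1, 0) (\<lambda>z. \<Sum>i\<in>UNIV. snd z $ i * dd (e i) q z) ?z = (\<Sum>i\<in>UNIV. x $ i * dd (1, 0) (dd (e i) q) ?z)"
      by (simp add: dd_sum[OF differentiable_mult[OF sx D[OF eC]]] dd_mult[OF sx D[OF eC]])
    ultimately show ?thesis by simp
  qed
  have k: "((\<lambda>s. inverse (s ^ (nu + 1))) has_real_derivative - (real nu + 1) / ?r ^ (nu + 2)) (at ?r)"
  proof -
    have "((\<lambda>s. s ^ (nu + 1)) has_real_derivative real (nu + 1) * ?r ^ nu) (at ?r)"
      using DERIV_pow[of "nu + 1" ?r] by simp
    from DERIV_inverse'[OF this] have "((\<lambda>s. inverse (s ^ (nu + 1))) has_real_derivative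
      - (inverse (?r ^ (nu + 1)) * (real (nu + 1) * ?r ^ nu) * inverse (?r ^ (nu + 1)))) (at ?r)" using r by simp
    moreover have "- (inverse (?r ^ (nu + 1)) * (real (nu + 1) * ?r ^ nu) * inverse (?r ^ (nu + 1))) = - (real nu + 1) / ?r ^ (nu + 2)"
      using r by (simp add: divide_simps)
    ultimately show ?thesis by (simp only:)
  qed
  have k': "dd (1, 0) (\<lambda>z. inverse (fst z ^ (nu + 1))) ?z = - (real nu + 1) / ?r ^ (nu + 2)"
    using dd_fst_fun[of "\<lambda>s. inverse (s ^ (nu + 1))" "- (real nu + 1) / ?r ^ (nu + 2)" ?z "(1, 0)"] k by simp
  have kC: "Cinf O' (\<lambda>z. inverse (fst z ^ (nu + 1)))" by (intro cinf opO) (metis fstpos(1) less_irrefl power_not_zero)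
  \<comment> \<open>The second term comes from the power of the radius in \<open>P\<close>. It
    cancels later against \<open>CARD('n) * P\<close>, which is produced by the divergence of the
    position field.\<close>
  have P': "dd (1, 0) P ?z = dd (1, 0) Z ?z / ?r ^ (nu + 1) - (real nu + 1) / ?r ^ (nu + 2) * Z ?z"
    unfolding P_def
    by (simp only: dd_mult[OF D[OF kC] D[OF ZC]] k' fst_conv) (simp add: divide_inverse algebra_simps)
  have n1: "real CARD('n) = real nu + 1" using n by (simp add: nu_def)
  have lap: "(\<Sum>i\<in>UNIV. dd (e i) (dd (e i) q) ?z) = lapl (\<lambda>y. q (?r, y)) x"
  proof -
    have "dd (axis i 1) (dd (axis i 1) (\<lambda>y. q (?r, y))) x = dd (e i) (dd (e i) q) ?z" for i
    proof -
      have "dd (axis i 1) (dd (axis i 1) (\<lambda>y. q (?r, y))) x = dd (axis i 1) (\<lambda>y. dd (e i) q (?r, y)) x"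
        by (rule dd_cong[of "-{0}"]) (use r in \<open>auto simp: e_def O'_def intro!: dd_slice_snd diff[OF qC]\<close>)
      then show ?thesis using dd_slice_snd[OF D[OF eC], of "axis i 1"] by (simp add: e_def)
    qed
    then show ?thesis by (simp add: lapl_def)
  qed
  have "laplace_beltrami (metric_coeffs h) u x * sqrt (det (metric_coeffs h x))
    = (\<Sum>i\<in>UNIV. dd (axis i 1) (\<lambda>y. W i (norm y, y)) x)"
  proof -
    have "partial_deriv i (\<lambda>y. sqrt (det (metric_coeffs h y)) * (\<Sum>j\<in>UNIV. matrix_inv (metric_coeffs h y) $ i $ j * partial_deriv j u y)) x
      = dd (axis i 1) (\<lambda>y. W i (norm y, y)) x" for i
      unfolding partial_deriv_def[of i] dd_def[symmetric] by (rule dd_cong[OF op\<Omega> x\<Omega>]) (rule V)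
    moreover have "sqrt (det (metric_coeffs h x)) \<noteq> 0"
      unfolding metric_coeffs_axial[OF r(3)] using r n by (subst sqrt_det_axial) auto
    ultimately show ?thesis by (simp add: laplace_beltrami_def)
  qed
  also have "\<dots> = (\<Sum>i\<in>UNIV. x $ i / ?r * dd (1, 0) (W i) ?z + dd (e i) (W i) ?z)"
    using dd_diagonal[OF D[OF WC] r(3)] by (simp add: inner_axis e_def)
  also have "\<dots> = (\<Sum>i\<in>UNIV. (dd (1, 0) P ?z / ?r) * (x $ i * x $ i) + (Q' / ?r) * (x $ i * dd (e i) q ?z)
      + (Q ?r / ?r) * (x $ i * dd (1, 0) (dd (e i) q) ?z) + P ?z + x $ i * dd (e i) P ?z + Q ?r * dd (e i) (dd (e i) q) ?z)"
    unfolding d1 d2 by (intro sum.cong refl) (simp add: algebra_simps)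
  also have "\<dots> = (dd (1, 0) P ?z / ?r) * (x \<bullet> x) + real CARD('n) * P ?z + Q ?r * lapl (\<lambda>y. q (?r, y)) x"
    by (simp only: sum.distrib sum_distrib_left[symmetric] inner_sum_sq e1 e2 e3 lap sum_constant)
  also have "\<dots> = dd (1, 0) Z ?z / ?r ^ nu + Q ?r * lapl (\<lambda>y. q (?r, y)) x"
    unfolding P' n1 r(5) P_def using r by (simp add: field_simps power2_eq_square)
  finally have "laplace_beltrami (metric_coeffs h) u x * (h ?r / ?r) ^ nu = dd (1, 0) Z ?z / ?r ^ nu + Q ?r * lapl (\<lambda>y. q (?r, y)) x"
    unfolding metric_coeffs_axial[OF r(3)] using r n sqrt_det_axial[of x "h ?r / ?r"] by (simp add: nu_def)
  then have "laplace_beltrami (metric_coeffs h) u x * h ?r ^ nu = dd (1, 0) Z ?z + h ?r ^ nu * ((?r / h ?r)\<^sup>2 * lapl (\<lambda>y. q (?r, y)) x)"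
    using r by (simp add: Q_def power_divide field_simps)
  then have "laplace_beltrami (metric_coeffs h) u x = dd (1, 0) Z ?z / h ?r ^ nu + lapl (\<lambda>y. q (?r, y)) x * (?r / h ?r)\<^sup>2"
    using r by (simp add: field_simps)
  then show ?thesis by (simp add: Z_def[abs_def] nu_def)
qed

section \<open>Integration over the sphere\<close>

text \<open>A weight that is evaluated at \<open>x \<bullet> x\<close>, hence supported in the shell
  \<open>1 \<le> |x| \<le> 2\<close>. It keeps integrals away from the origin, where functions
  constant along rays are singular. The square makes it differentiable with continuous derivative,
  as Green's identity requires.\<close>

definition bump :: "real \<Rightarrow> real" where "bump s = (max 0 ((s - 1) * (4 - s)))\<^sup>2"

definition bump' :: "real \<Rightarrow> real" where "bump' s = 2 * max 0 ((s - 1) * (4 - s)) * (5 - 2 * s)"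

lemma bump_zero: assumes "s \<le> 1 \<or> s \<ge> 4" shows "bump s = 0" "bump' s = 0"
  using assms mult_nonpos_nonneg[of "s - 1" "4 - s"] mult_nonneg_nonpos[of "s - 1" "4 - s"]
  by (auto simp: bump_def bump'_def max_def)
lemma bump_nonneg: "bump s \<ge> 0" by (simp add: bump_def)
lemma bump_pos: "1 < s \<Longrightarrow> s < 4 \<Longrightarrow> bump s > 0" by (simp add: bump_def max_def)
lemma continuous_on_bump [continuous_intros]: "continuous_on A f \<Longrightarrow> continuous_on A (\<lambda>x. bump (f x))"
  unfolding bump_def by (intro continuous_intros)
lemma continuous_on_bump' [continuous_intros]: "continuous_on A f \<Longrightarrow> continuous_on A (\<lambda>x. bump' (f x))"
  unfolding bump'_def by (intro continuous_intros)

lemma max0_sq_deriv: "((\<lambda>t::real. (max 0 t)\<^sup>2) has_real_derivative 2 * max 0 t) (at t)"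
proof -
  consider "t > 0" | "t < 0" | "t = 0" by linarith
  then show ?thesis
  proof cases
    case 1
    have "((\<lambda>t::real. t\<^sup>2) has_real_derivative 2 * max 0 t) (at t)"
      using 1 by (auto intro!: derivative_eq_intros)
    then show ?thesis
      by (rule has_field_derivative_transform_within_open[of _ _ _ "{0<..}"]) (use 1 in auto)
  next
    case 2
    have "((\<lambda>t::real. 0) has_real_derivative 2 * max 0 t) (at t)"
      using 2 by (auto intro!: derivative_eq_intros)
    then show ?thesis
      by (rule has_field_derivative_transform_within_open[of _ _ _ "{..<0}"]) (use 2 in auto)
  next
    case 3
    have "((\<lambda>y::real. max 0 y) \<longlongrightarrow> max 0 0) (at 0)" by (intro tendsto_intros)
    moreover have "(\<lambda>y::real. (max 0 y)\<^sup>2 / y) = (\<lambda>y. max 0 y)" by (auto simp: fun_eq_iff max_def power2_eq_square)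
    ultimately show ?thesis using 3 by (simp add: has_field_derivative_iff)
  qed
qed

lemma bump_deriv: "(bump has_real_derivative bump' s) (at s)"
proof -
  have "((\<lambda>s::real. (s - 1) * (4 - s)) has_real_derivative (5 - 2 * s)) (at s)"
    by (auto intro!: derivative_eq_intros)
  from DERIV_chain2[OF max0_sq_deriv this] show ?thesis by (simp add: bump_def[abs_def] bump'_def)
qed

text \<open>The product is 0 on the closed unit ball and continuous outside the open one; the two
  closed pieces are glued.\<close>

lemma continuous_cutoff:
  fixes g :: "'a::topological_space \<times> 'b::euclidean_space \<Rightarrow> real"
  assumes R: "closed R" and b: "continuous_on UNIV b" "\<And>x. norm x \<le> 1 \<Longrightarrow> b x = 0"
    and g: "continuous_on (R \<times> - {0}) g"
  shows "continuous_on (R \<times> UNIV) (\<lambda>(r, x). b x * g (r, x))"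
proof -
  have "continuous_on (R \<times> {x. norm x \<le> 1} \<union> R \<times> {x. norm x \<ge> 1}) (\<lambda>z. b (snd z) * g z)"
  proof (rule continuous_on_closed_Un)
    show "closed (R \<times> {x::'b. norm x \<le> 1})" "closed (R \<times> {x::'b. norm x \<ge> 1})"
      by (intro closed_Times R closed_Collect_le continuous_intros)+
    have "continuous_on (R \<times> {x::'b. norm x \<le> 1}) (\<lambda>z. 0 :: real)" by (rule continuous_on_const)
    then show "continuous_on (R \<times> {x. norm x \<le> 1}) (\<lambda>z. b (snd z) * g z)"
      by (rule continuous_on_eq) (auto simp: b(2))
    show "continuous_on (R \<times> {x. norm x \<ge> 1}) (\<lambda>z. b (snd z) * g z)"
      by (intro continuous_on_mult continuous_on_subset[OF g] continuous_on_compose2[OF b(1) continuous_on_snd[OF continuous_on_id]]) auto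
  qed
  moreover have "R \<times> {x. norm x \<le> 1} \<union> R \<times> {x. norm x \<ge> 1} = R \<times> (UNIV :: 'b set)" by auto
  ultimately show ?thesis by (simp add: case_prod_unfold)
qed

lemma continuous_cutoff1:
  fixes g :: "'b::euclidean_space \<Rightarrow> real"
  assumes b: "continuous_on UNIV b" "\<And>x. norm x \<le> 1 \<Longrightarrow> b x = 0" and g: "continuous_on (- {0}) g"
  shows "continuous_on A (\<lambda>x. b x * g x)"
proof -
  have g2: "continuous_on (UNIV \<times> - {0}) (\<lambda>z::real\<times>'b. g (snd z))"
    by (rule continuous_on_compose2[OF g]) (auto intro!: continuous_intros)
  have "continuous_on A (\<lambda>x. (\<lambda>(r, x). b x * (\<lambda>z::real\<times>'b. g (snd z)) (r, x)) (0, x))"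
    by (rule continuous_on_compose2[OF continuous_cutoff[OF closed_UNIV b g2]]) (auto intro!: continuous_intros)
  then show ?thesis by simp
qed

text \<open>The half-width 3 leaves room for all shifts of length at most 1 of a function supported
  in the ball of radius 2.\<close>

abbreviation cube :: "(real^'n) set" where "cube \<equiv> cbox (\<chi> i. -3) (\<chi> i. 3)"

lemma not_in_cube: "x \<notin> cube \<Longrightarrow> norm x > 3"
proof -
  assume "x \<notin> cube"
  then obtain i where "\<not> (-3 \<le> x $ i \<and> x $ i \<le> 3)" by (auto simp: mem_box_cart)
  then have "\<bar>x $ i\<bar> > 3" by linarith
  then show ?thesis using component_le_norm_cart[of x i] by linarith
qed

text \<open>By translation invariance the integral of \<open>w (x + t e)\<close> over
  \<open>x\<close> does not depend on small \<open>t\<close>; differentiating under the integral at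
  \<open>t = 0\<close> gives the claim.\<close>

lemma integral_dd_zero:
  fixes w :: "real^'n \<Rightarrow> real"
  assumes d: "\<And>x. w differentiable (at x)" and c: "continuous_on UNIV (dd e w)"
    and z: "\<And>x. norm x \<ge> 2 \<Longrightarrow> w x = 0" and e: "norm e \<le> 1"
  shows "integral cube (dd e w) = 0"
proof -
  let ?U = "{-1<..<1::real}"
  have cw: "continuous_on A w" for A
    by (rule continuous_at_imp_continuous_on) (simp add: d differentiable_imp_continuous_within)
  define J where "J t = integral cube (\<lambda>x. w (x + t *\<^sub>R e))" for t
  define c0 where "c0 = integral UNIV w"
  have const: "J t = c0" if "t \<in> ?U" for t
  proof -
    have "integral cube (\<lambda>x. w (x + t *\<^sub>R e)) = integral (cbox ((\<chi> i. -3) + t *\<^sub>R e) ((\<chi> i. 3) + t *\<^sub>R e)) w"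
      using integral_shift_cbox_plus[of "\<chi> i. -3" "\<chi> i. 3" w "t *\<^sub>R e"] by (simp only: o_def add.commute[of "t *\<^sub>R e"])
    also have "\<dots> = integral UNIV w"
    proof (rule integral_unique[symmetric], rule has_integral_on_superset)
      show "(w has_integral integral (cbox ((\<chi> i. -3) + t *\<^sub>R e) ((\<chi> i. 3) + t *\<^sub>R e)) w) (cbox ((\<chi> i. -3) + t *\<^sub>R e) ((\<chi> i. 3) + t *\<^sub>R e))"
        by (rule integrable_integral) (intro integrable_continuous cw)
      fix x assume "x \<notin> cbox ((\<chi> i. -3) + t *\<^sub>R e) ((\<chi> i. 3) + t *\<^sub>R e)"
      moreover have "x \<in> cbox ((\<chi> i. -3) + t *\<^sub>R e) ((\<chi> i. 3) + t *\<^sub>R e)" if "x - t *\<^sub>R e \<in> cube"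
        using that by (simp add: mem_box_cart algebra_simps)
      ultimately have "x - t *\<^sub>R e \<notin> cube" by blast
      then have "norm (x - t *\<^sub>R e) > 3" by (rule not_in_cube)
      moreover have "norm (t *\<^sub>R e) \<le> 1" using that e mult_mono[of "\<bar>t\<bar>" 1 "norm e" 1] by auto
      ultimately have "norm x \<ge> 2" using norm_triangle_ineq4[of x "t *\<^sub>R e"] by linarith
      then show "w x = 0" by (rule z)
    qed simp
    finally show ?thesis by (simp only: J_def c0_def)
  qed
  have "((\<lambda>t. integral cube (\<lambda>x. w (x + t *\<^sub>R e))) has_field_derivative integral cube (\<lambda>x. dd e w (x + 0 *\<^sub>R e))) (at 0 within ?U)"
  proof (rule leibniz_rule_field_derivative)
    fix t x assume "t \<in> ?U"
    have "((\<lambda>t. x + t *\<^sub>R e) has_derivative (\<lambda>s. s *\<^sub>R e)) (at t)" by (auto intro!: derivative_eq_intros)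
    from has_derivative_compose[OF this has_derivative_dd[OF d]]
    have "((\<lambda>t. w (x + t *\<^sub>R e)) has_derivative (\<lambda>s. dd (s *\<^sub>R e) w (x + t *\<^sub>R e))) (at t)" .
    moreover have "dd (s *\<^sub>R e) w (x + t *\<^sub>R e) = dd e w (x + t *\<^sub>R e) * s" for s
      using linear_scale[OF dd_linear[OF d]] by simp
    ultimately have "((\<lambda>t. w (x + t *\<^sub>R e)) has_field_derivative dd e w (x + t *\<^sub>R e)) (at t)"
      by (simp add: has_field_derivative_def)
    then show "((\<lambda>t. w (x + t *\<^sub>R e)) has_field_derivative dd e w (x + t *\<^sub>R e)) (at t within ?U)"
      by (rule has_field_derivative_at_within)
  next
    show "(\<lambda>x. w (x + t *\<^sub>R e)) integrable_on cube" for t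
      by (intro integrable_continuous continuous_on_compose2[OF cw[of UNIV]] continuous_intros) auto
    show "continuous_on (?U \<times> cube) (\<lambda>(t, x). dd e w (x + t *\<^sub>R e))"
      unfolding case_prod_unfold by (intro continuous_on_compose2[OF c] continuous_intros) auto
  qed auto
  then have J1: "(J has_field_derivative integral cube (dd e w)) (at 0)"
    using at_within_open[of 0 ?U] by (simp add: J_def[abs_def])
  have "((\<lambda>t. c0) has_field_derivative 0) (at (0::real))" by (rule DERIV_const)
  then have "(J has_field_derivative 0) (at 0)"
    by (rule has_field_derivative_transform_within_open[where S="?U"]) (simp_all add: const)
  with J1 show ?thesis by (rule DERIV_unique)
qed

text \<open>For \<open>g\<close> constant along rays this is, up to a fixed positive factor, the
  surface integral over the unit sphere.\<close>

definition Isph :: "(real^'n \<Rightarrow> real) \<Rightarrow> real" where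
  "Isph g = integral cube (\<lambda>x. bump (x \<bullet> x) * g x)"

lemma bump_near_zero: "norm x \<le> 1 \<Longrightarrow> bump (x \<bullet> x) = 0 \<and> bump' (x \<bullet> x) = 0"
  by (simp add: bump_zero dot_square_norm power_le_one)

lemma continuous_on_bump_mult:
  "continuous_on (- {0}) g \<Longrightarrow> continuous_on A (\<lambda>x::'a::euclidean_space. bump (x \<bullet> x) * g x)"
  by (rule continuous_cutoff1) (auto intro!: continuous_intros simp: bump_near_zero)

lemma Isph_integrable: "continuous_on (- {0}) g \<Longrightarrow> (\<lambda>x. bump (x \<bullet> x) * g x) integrable_on cube"
  by (intro integrable_continuous continuous_on_bump_mult)

lemma Isph_add: "continuous_on (- {0}) f \<Longrightarrow> continuous_on (- {0}) g \<Longrightarrow> Isph (\<lambda>x. f x + g x) = Isph f + Isph g"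
  unfolding Isph_def by (simp add: distrib_left integral_add Isph_integrable)
lemma Isph_cmult: "Isph (\<lambda>x. c * f x) = c * Isph f"
  unfolding Isph_def by (subst integral_mult_right[symmetric]) (simp add: mult_ac)
lemma Isph_diff: "continuous_on (- {0}) f \<Longrightarrow> continuous_on (- {0}) g \<Longrightarrow> Isph (\<lambda>x. f x - g x) = Isph f - Isph g"
  unfolding Isph_def by (simp add: right_diff_distrib integral_diff Isph_integrable)
lemma Isph_sum: "finite I \<Longrightarrow> (\<And>i. i \<in> I \<Longrightarrow> continuous_on (- {0}) (f i)) \<Longrightarrow> Isph (\<lambda>x. \<Sum>i\<in>I. f i x) = (\<Sum>i\<in>I. Isph (f i))"
proof (induction I rule: finite_induct)
  case empty then show ?case by (simp add: Isph_def)
next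
  case (insert i I) then show ?case by (simp add: Isph_add continuous_on_sum)
qed
lemma Isph_cong: assumes "\<And>x. x \<noteq> 0 \<Longrightarrow> f x = g x" shows "Isph f = Isph g"
proof -
  have "(\<lambda>x. bump (x \<bullet> x) * f x) = (\<lambda>x. bump (x \<bullet> x) * g x)"
  proof
    show "bump (x \<bullet> x) * f x = bump (x \<bullet> x) * g x" for x
      using assms by (cases "x = 0") (auto simp: bump_zero)
  qed
  then show ?thesis by (simp add: Isph_def)
qed

text \<open>The weight is positive at radius 1.5. A continuous nonnegative integrand with integral 0
  vanishes there, and homogeneity spreads the zero along the ray.\<close>

lemma Isph_definite:
  assumes g: "continuous_on (- {0}) g" "hom0 g" and z: "Isph (\<lambda>x. g x * g x) = 0" and x: "x \<noteq> 0"
  shows "g x = 0"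
proof -
  have c: "continuous_on (- {0}) (\<lambda>x. g x * g x)" by (intro continuous_intros g)
  define y where "y = (1.5 / norm x) *\<^sub>R x"
  have ny: "norm y = 1.5" using x by (simp add: y_def)
  have "bump (y \<bullet> y) * (g y * g y) = 0"
  proof (rule has_integral_0_cbox_imp_0[where f = "\<lambda>x. bump (x \<bullet> x) * (g x * g x)"])
    show "continuous_on cube (\<lambda>x. bump (x \<bullet> x) * (g x * g x))" by (rule continuous_on_bump_mult[OF c])
    show "((\<lambda>x. bump (x \<bullet> x) * (g x * g x)) has_integral 0) cube"
      using integrable_integral[OF Isph_integrable[OF c]] z by (simp add: Isph_def)
    show "box (\<chi> i. -3) (\<chi> i. 3) \<noteq> ({}::(real^'a) set)" by (auto simp: interval_ne_empty_cart)
    show "y \<in> cube" using not_in_cube ny by fastforce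
  qed (simp add: bump_nonneg)
  moreover have "bump (y \<bullet> y) > 0" by (rule bump_pos) (simp_all add: dot_square_norm ny power2_eq_square)
  ultimately have "g y = 0" by simp
  moreover have "g y = g x" using g(2) x unfolding hom0_def y_def by simp
  ultimately show ?thesis by simp
qed

text \<open>The derivatives are taken within \<open>{0..L}\<close>, so that the boundary slices of
  the cylinder are included.\<close>

lemma Isph_leibniz:
  fixes G Gr :: "real \<times> (real^'n) \<Rightarrow> real"
  assumes d: "\<And>r x. r \<in> {0..L} \<Longrightarrow> x \<noteq> 0 \<Longrightarrow> ((\<lambda>r. G (r, x)) has_real_derivative Gr (r, x)) (at r within {0..L})"
    and cG: "continuous_on ({0..L} \<times> - {0}) G" and cGr: "continuous_on ({0..L} \<times> - {0}) Gr" and r: "r \<in> {0..L}"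
  shows "((\<lambda>r. Isph (\<lambda>x. G (r, x))) has_real_derivative Isph (\<lambda>x. Gr (r, x))) (at r within {0..L})"
  unfolding Isph_def
proof (rule leibniz_rule_field_derivative)
  fix r x assume r: "r \<in> {0..L}"
  show "((\<lambda>r. bump (x \<bullet> x) * G (r, x)) has_real_derivative bump (x \<bullet> x) * Gr (r, x)) (at r within {0..L})"
    using d[OF r, of x] by (cases "x = 0") (auto intro!: DERIV_cmult simp: bump_zero)
  show "(\<lambda>x. bump (x \<bullet> x) * G (r, x)) integrable_on cube"
    by (intro Isph_integrable continuous_on_compose2[OF cG] continuous_intros) (use r in auto)
next
  have "continuous_on ({0..L} \<times> UNIV) (\<lambda>(r, x). bump (x \<bullet> x) * Gr (r, x))"
    by (rule continuous_cutoff[OF _ _ _ cGr]) (auto intro!: continuous_intros simp: bump_near_zero)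
  then show "continuous_on ({0..L} \<times> cube) (\<lambda>(r, x). bump (x \<bullet> x) * Gr (r, x))"
    by (rule continuous_on_subset) auto
qed (use r in auto)

text \<open>Green's identity on the sphere: the vector field \<open>\<beta> (Y \<nabla>g - g \<nabla>Y)\<close> with radial \<open>\<beta>\<close> has divergence
  \<open>\<beta> (Y \<Delta>g - g \<Delta>Y)\<close>, because the gradients of 0-homogeneous functions are orthogonal to \<open>x\<close>.\<close>

lemma Isph_green:
  fixes g Y :: "real^'n \<Rightarrow> real"
  assumes g: "Cinf (- {0}) g" "hom0 g" and Y: "Cinf (- {0}) Y" "hom0 Y"
  shows "Isph (\<lambda>x. (x \<bullet> x) * lapl g x * Y x) = Isph (\<lambda>x. g x * ((x \<bullet> x) * lapl Y x))"
proof -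
  \<comment> \<open>The factor \<open>s\<close> supplies the \<open>x \<bullet> x\<close> in front
    of the Laplacian, which makes that operator preserve constancy along rays.\<close>
  define \<beta> where "\<beta> s = s * bump s" for s
  define \<beta>' where "\<beta>' s = bump s + s * bump' s" for s
  have \<beta>d: "(\<beta> has_real_derivative \<beta>' s) (at s)" for s
    unfolding \<beta>_def[abs_def] \<beta>'_def by (auto intro!: derivative_eq_intros bump_deriv)
  define e where "e i = (axis i 1 :: real^'n)" for i
  define k where "k i x = Y x * dd (e i) g x - g x * dd (e i) Y x" for i x
  define w where "w i x = \<beta> (x \<bullet> x) * k i x" for i x
  define W where "W i x = (\<beta>' (x \<bullet> x) * 2 * x $ i) * k i x + \<beta> (x \<bullet> x) * dd (e i) (k i) x" for i x
  have kC: "Cinf (- {0}) (k i)" for i unfolding k_def by (intro cinf open_punctured g Y)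
  have D: "f differentiable (at x)" if "Cinf (- {0}) f" "x \<noteq> 0" for f :: "real^'n \<Rightarrow> real" and x
    using Cinf_differentiable that by blast
  have wd: "(w i has_derivative (\<lambda>v. (\<beta>' (x \<bullet> x) * (2 * (x \<bullet> v))) * k i x + \<beta> (x \<bullet> x) * dd v (k i) x)) (at x)" for i x
  proof (cases "x = 0")
    case False
    have "((\<lambda>x. x \<bullet> x) has_derivative (\<lambda>v. 2 * (x \<bullet> v))) (at x)"
      by (auto intro!: derivative_eq_intros simp: inner_commute)
    from has_derivative_compose[OF this \<beta>d[unfolded has_field_derivative_def]]
    have "((\<lambda>x. \<beta> (x \<bullet> x)) has_derivative (\<lambda>v. \<beta>' (x \<bullet> x) * (2 * (x \<bullet> v)))) (at x)" .
    from has_derivative_mult[OF this Cinf_has_derivative[OF kC]] False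
    show ?thesis by (simp add: w_def[abs_def] add.commute)
  next
    case True
    have "((\<lambda>x. 0) has_derivative (\<lambda>v. 0)) (at x)" by simp
    then have "(w i has_derivative (\<lambda>v. 0)) (at x)"
      by (rule has_derivative_transform_within_open[of _ _ _ _ "ball 0 1"]) (auto simp: True w_def \<beta>_def bump_near_zero)
    then show ?thesis by (simp add: True \<beta>_def)
  qed
  have ddw: "dd (e i) (w i) = W i" for i
    by (rule ext) (simp add: dd_eqI[OF wd] W_def e_def inner_axis)
  have cW: "continuous_on A (W i)" for A i
    unfolding W_def
  proof (rule continuous_on_add)
    show "continuous_on A (\<lambda>x. (\<beta>' (x \<bullet> x) * 2 * x $ i) * k i x)"
      by (rule continuous_cutoff1[OF _ _ Cinf_continuous_on[OF kC]]) (auto intro!: continuous_intros simp: \<beta>'_def bump_near_zero)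
    show "continuous_on A (\<lambda>x. \<beta> (x \<bullet> x) * dd (e i) (k i) x)"
      by (rule continuous_cutoff1[OF _ _ Cinf_continuous_on[OF Cinf_dd[OF open_punctured kC]]]) (auto intro!: continuous_intros simp: \<beta>_def bump_near_zero)
  qed
  have int0: "integral cube (W i) = 0" for i
    unfolding ddw[symmetric]
  proof (rule integral_dd_zero)
    show "w i differentiable (at x)" for x using wd differentiable_def by blast
    show "continuous_on UNIV (dd (e i) (w i))" unfolding ddw by (rule cW)
    show "w i x = 0" if "norm x \<ge> 2" for x
    proof -
      have "x \<bullet> x \<ge> 2\<^sup>2" unfolding dot_square_norm using that by (intro power_mono) auto
      then show ?thesis by (simp add: w_def \<beta>_def bump_zero)
    qed
    show "norm (e i) \<le> 1" by (simp add: e_def)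
  qed
  have sumW: "(\<Sum>i\<in>UNIV. W i x) = bump (x \<bullet> x) * ((x \<bullet> x) * lapl g x * Y x - g x * ((x \<bullet> x) * lapl Y x))" for x
  proof (cases "x = 0")
    case False
    have 1: "(\<Sum>i\<in>UNIV. x $ i * k i x) = Y x * dd x g x - g x * dd x Y x"
      unfolding dd_sum_axis[OF D[OF g(1) False], of x] dd_sum_axis[OF D[OF Y(1) False], of x]
      by (simp add: k_def e_def sum_distrib_left sum_subtractf algebra_simps)
    have "dd (e i) (k i) x = Y x * dd (e i) (dd (e i) g) x - g x * dd (e i) (dd (e i) Y) x" for i
    proof -
      have "(k i has_derivative (\<lambda>v. (Y x * dd v (dd (e i) g) x + dd v Y x * dd (e i) g x)
          - (g x * dd v (dd (e i) Y) x + dd v g x * dd (e i) Y x))) (at x)"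
        unfolding k_def[abs_def] using False
        by (intro has_derivative_diff has_derivative_mult Cinf_has_derivative[of "- {0}"] g Y Cinf_dd open_punctured) auto
      from dd_eqI[OF this] show ?thesis by simp
    qed
    then have 2: "(\<Sum>i\<in>UNIV. dd (e i) (k i) x) = Y x * lapl g x - g x * lapl Y x"
      by (simp add: lapl_def e_def sum_subtractf sum_distrib_left)
    have "(\<Sum>i\<in>UNIV. W i x) = \<beta>' (x \<bullet> x) * 2 * (\<Sum>i\<in>UNIV. x $ i * k i x) + \<beta> (x \<bullet> x) * (\<Sum>i\<in>UNIV. dd (e i) (k i) x)"
      by (simp add: W_def sum.distrib sum_distrib_left mult.assoc)
    also have "\<dots> = \<beta> (x \<bullet> x) * (Y x * lapl g x - g x * lapl Y x)"
      unfolding 1 2 by (simp add: hom0_euler D g Y False)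
    finally show ?thesis by (simp add: \<beta>_def algebra_simps)
  qed (simp add: W_def \<beta>_def bump_zero)
  have cont: "continuous_on (- {0}) (\<lambda>x. (x \<bullet> x) * lapl g x * Y x)" "continuous_on (- {0}) (\<lambda>x. g x * ((x \<bullet> x) * lapl Y x))"
    unfolding lapl_def by (intro continuous_intros Cinf_continuous_on cinf open_punctured g Y)+
  have "0 = (\<Sum>i\<in>UNIV. integral cube (W i))" by (simp add: int0)
  also have "\<dots> = integral cube (\<lambda>x. \<Sum>i\<in>UNIV. W i x)"
    by (rule integral_sum[symmetric]) (auto intro!: integrable_continuous cW)
  also have "\<dots> = Isph (\<lambda>x. (x \<bullet> x) * lapl g x * Y x - g x * ((x \<bullet> x) * lapl Y x))"
    by (simp only: sumW Isph_def)
  also have "\<dots> = Isph (\<lambda>x. (x \<bullet> x) * lapl g x * Y x) - Isph (\<lambda>x. g x * ((x \<bullet> x) * lapl Y x))"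
    by (rule Isph_diff[OF cont])
  finally show ?thesis by simp
qed

section \<open>Spherical harmonics\<close>

lemma dd_fun_add: "Cinf UNIV f \<Longrightarrow> Cinf UNIV g \<Longrightarrow> dd v (f + g) = dd v f + dd v g"
  by (rule ext) (simp add: plus_fun_def dd_add Cinf_differentiable[OF _ UNIV_I])
lemma dd_fun_cmult: "Cinf UNIV f \<Longrightarrow> dd v (\<lambda>x. c * f x) = (\<lambda>x. c * dd v f x)"
  by (rule ext) (simp add: dd_cmult Cinf_differentiable[OF _ UNIV_I])
lemma dd_zero: "dd v (0 :: 'a::euclidean_space \<Rightarrow> real) = 0" "dd v (\<lambda>x::'a. 0) = 0" "dd v (\<lambda>x::'a. c) = 0"
  by (auto simp: fun_eq_iff zero_fun_def)

section \<open>Homogeneous polynomials\<close>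

primrec Mon :: "nat \<Rightarrow> (real^'n \<Rightarrow> real) set" where
  "Mon 0 = {\<lambda>x. 1}"
| "Mon (Suc e) = (\<lambda>(i, m) x. x $ i * m x) ` (UNIV \<times> Mon e)"

definition Pol :: "nat \<Rightarrow> (real^'n \<Rightarrow> real) set" where "Pol e = fun_space.span (Mon e)"

lemma finite_Mon: "finite (Mon e)" by (induction e) auto

lemma Pol_zero: "0 \<in> Pol e" "(\<lambda>x. 0) \<in> Pol e"
  using fun_space.span_zero[of "Mon e"] by (auto simp: Pol_def zero_fun_def)
lemma Pol_add: "p \<in> Pol e \<Longrightarrow> q \<in> Pol e \<Longrightarrow> (\<lambda>x. p x + q x) \<in> Pol e"
  using fun_space.span_add[of p "Mon e" q] by (simp add: Pol_def plus_fun_def)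
lemma Pol_cmult: "p \<in> Pol e \<Longrightarrow> (\<lambda>x. c * p x) \<in> Pol e"
  using fun_space.span_scale[of p "Mon e" c] by (simp add: Pol_def)
lemma Pol_sum: "(\<And>i. i \<in> I \<Longrightarrow> p i \<in> Pol e) \<Longrightarrow> (\<lambda>x. \<Sum>i\<in>I. p i x) \<in> Pol e"
  by (induction I rule: infinite_finite_induct) (auto intro: Pol_zero Pol_add)
lemma Pol_induct [consumes 1, case_names base zero add scale]:
  assumes "p \<in> Pol e" "\<And>m. m \<in> Mon e \<Longrightarrow> P m" "P (\<lambda>x. 0)"
    "\<And>p q. P p \<Longrightarrow> P q \<Longrightarrow> P (\<lambda>x. p x + q x)" "\<And>c p. P p \<Longrightarrow> P (\<lambda>x. c * p x)"
  shows "P p"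
proof -
  have "fun_space.subspace {p. P p}"
    using assms(3-5) by (auto simp: fun_space.subspace_def zero_fun_def plus_fun_def)
  then show ?thesis using fun_space.span_induct[of p "Mon e" P] assms(1,2) by (auto simp: Pol_def)
qed

lemma Pol_coord: assumes "p \<in> Pol e" shows "(\<lambda>x. x $ i * p x) \<in> Pol (Suc e)"
  using assms
proof (induction rule: Pol_induct)
  case (base m)
  then have "(\<lambda>x. x $ i * m x) \<in> Mon (Suc e)" by (auto simp: image_iff)
  then show ?case by (simp add: Pol_def fun_space.span_base)
next
  case zero then show ?case by (simp add: Pol_zero)
next
  case (add p q) then show ?case using Pol_add by (fastforce simp: distrib_left)
next
  case (scale c p) then show ?case using Pol_cmult[of _ "Suc e" c] by (fastforce simp: mult.left_commute)
qed

lemma Pol_Cinf: assumes "p \<in> Pol e" shows "Cinf UNIV p"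
proof -
  have "Cinf UNIV m" if "m \<in> Mon e" for m :: "real^'a \<Rightarrow> real"
    using that by (induction e arbitrary: m) (auto intro!: cinf)
  note m = this
  from assms show ?thesis by (induction rule: Pol_induct) (auto intro: cinf m)
qed

lemma Pol_hom: assumes "p \<in> Pol e" shows "p (t *\<^sub>R x) = t ^ e * p x"
proof -
  have "m (t *\<^sub>R x) = t ^ e * m x" if "m \<in> Mon e" for m :: "real^'a \<Rightarrow> real"
    using that by (induction e arbitrary: m) auto
  note m = this
  from assms show ?thesis by (induction rule: Pol_induct) (auto simp: algebra_simps m)
qed

lemma differentiable_nth [simp]: "(\<lambda>x::real^'n. x $ i) differentiable (at x)"
  using Cinf_differentiable[OF Cinf_nth[of UNIV i]] by simp

lemma dd_nth [simp]: "dd v (\<lambda>x::real^'n. x $ i) x = v $ i"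
  by (rule dd_eqI) (rule bounded_linear_imp_has_derivative[OF bounded_linear_vec_nth])

lemma dd_coord_mult: "Cinf UNIV m \<Longrightarrow> dd (axis j 1) (\<lambda>x::real^'n. x $ k * m x)
   = (\<lambda>x. (if j = k then 1 else 0) * m x + x $ k * dd (axis j 1) m x)"
  by (rule ext, subst dd_mult) (auto simp: Cinf_differentiable axis_def)

text \<open>The clause for \<open>e = 0\<close> compensates the truncated \<open>e - 1\<close> when
  a coordinate is multiplied back on. Commutation of partial derivatives is included so that the
  Laplacian can pass a partial derivative in \<open>Harm_dd\<close>.\<close>

lemma Mon_dd:
  "m \<in> Mon e \<Longrightarrow> dd (axis i 1) m \<in> Pol (e - 1) \<and> (e = 0 \<longrightarrow> dd (axis i 1) m = (\<lambda>x. 0))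
     \<and> dd (axis i 1) (dd (axis j 1) m) = dd (axis j 1) (dd (axis i 1) m)"
proof (induction e arbitrary: m i j)
  case 0 then show ?case using Pol_zero[of 0] by (auto simp: dd_zero zero_fun_def)
next
  case (Suc e)
  then obtain k p where m: "m = (\<lambda>x. x $ k * p x)" and p: "p \<in> Mon e" by auto
  have pP: "p \<in> Pol e" using p by (simp add: Pol_def fun_space.span_base)
  have pC: "Cinf UNIV p" by (rule Pol_Cinf[OF pP])
  have dC: "Cinf UNIV (dd v p)" for v by (intro cinf pC) auto
  have IH: "dd (axis i 1) p \<in> Pol (e - 1)" "e = 0 \<Longrightarrow> dd (axis i 1) p = (\<lambda>x. 0)"
    "dd (axis i 1) (dd (axis j 1) p) = dd (axis j 1) (dd (axis i 1) p)" for i j using Suc.IH[OF p] by blast+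
  have 1: "(\<lambda>x. x $ k * dd (axis i 1) p x) \<in> Pol e"
  proof (cases e)
    case 0 then show ?thesis using IH(2) Pol_zero by simp
  next
    case (Suc d) then show ?thesis using Pol_coord[OF IH(1)[of i]] by simp
  qed
  have "dd (axis i 1) m \<in> Pol e"
    unfolding m dd_coord_mult[OF pC] by (intro Pol_add Pol_cmult pP 1)
  moreover have "dd (axis i 1) (dd (axis j 1) m) = dd (axis j 1) (dd (axis i 1) m)"
  proof -
    have "dd (axis i 1) (dd (axis j 1) m) x = (if j = k then 1 else 0) * dd (axis i 1) p x
      + ((if i = k then 1 else 0) * dd (axis j 1) p x + x $ k * dd (axis i 1) (dd (axis j 1) p) x)" for i j x
    proof -
      have "dd (axis i 1) (dd (axis j 1) m) x
        = dd (axis i 1) (\<lambda>x. (if j = k then 1 else 0) * p x) x + dd (axis i 1) (\<lambda>x. x $ k * dd (axis j 1) p x) x"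
        unfolding m dd_coord_mult[OF pC] by (rule dd_add) (auto intro!: differentiable_mult Cinf_differentiable[OF pC] Cinf_differentiable[OF dC])
      then show ?thesis unfolding dd_coord_mult[OF dC] dd_fun_cmult[OF pC] .
    qed
    then show ?thesis using IH(3) by (auto simp: fun_eq_iff)
  qed
  ultimately show ?case by simp
qed

lemma Pol_dd:
  assumes "p \<in> Pol e"
  shows "dd (axis i 1) p \<in> Pol (e - 1) \<and> (e = 0 \<longrightarrow> dd (axis i 1) p = (\<lambda>x. 0))
     \<and> dd (axis i 1) (dd (axis j 1) p) = dd (axis j 1) (dd (axis i 1) p)"
proof -
  have "Cinf UNIV p \<and> dd (axis i 1) p \<in> Pol (e - 1) \<and> (e = 0 \<longrightarrow> dd (axis i 1) p = (\<lambda>x. 0))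
     \<and> dd (axis i 1) (dd (axis j 1) p) = dd (axis j 1) (dd (axis i 1) p)"
    using assms
  proof (induction rule: Pol_induct)
    case (base m) then show ?case using Mon_dd Pol_Cinf[of m e] by (auto simp: Pol_def fun_space.span_base)
  next
    case zero then show ?case using Pol_zero by (auto simp: dd_zero zero_fun_def intro: cinf)
  next
    case (add p q)
    have d: "Cinf UNIV (dd v p)" "Cinf UNIV (dd v q)" for v using add by (auto intro: cinf)
    from add show ?case
      using dd_fun_add[of p q, unfolded plus_fun_def] dd_fun_add[OF d, unfolded plus_fun_def] by (auto intro: Pol_add cinf)
  next
    case (scale c p)
    have d: "Cinf UNIV (dd v p)" for v using scale by (auto intro: cinf)
    from scale show ?case using dd_fun_cmult[of p] dd_fun_cmult[OF d] by (auto intro: Pol_cmult cinf)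
  qed
  then show ?thesis by blast
qed

lemma Pol_euler:
  fixes p :: "real^'n \<Rightarrow> real"
  assumes "p \<in> Pol e" shows "(\<Sum>i\<in>UNIV. x $ i * dd (axis i 1) p x) = real e * p x"
proof -
  have D: "p differentiable (at y)" for y using Cinf_differentiable[OF Pol_Cinf[OF assms]] by simp
  have "dd 1 (\<lambda>t. p (t *\<^sub>R x)) (1::real) = dd x p x"
    using dd_compose_linear[OF bounded_linear_scaleR_left[of x], where g=p and x=1 and c=0 and v=1] D by simp
  moreover have "dd 1 (\<lambda>t. p (t *\<^sub>R x)) (1::real) = real e * p x"
    unfolding Pol_hom[OF assms]
    by (rule dd_eqI[of _ "\<lambda>v. (real e * p x) * v", THEN trans]) (auto intro!: derivative_eq_intros)
  ultimately show ?thesis using dd_sum_axis[OF D, of x] by simp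
qed

lemma lapl_mult:
  fixes f g :: "real^'n \<Rightarrow> real"
  assumes U: "open U" and f: "Cinf U f" and g: "Cinf U g" and x: "x \<in> U"
  shows "lapl (\<lambda>x. f x * g x) x = f x * lapl g x + 2 * (\<Sum>i\<in>UNIV. dd (axis i 1) f x * dd (axis i 1) g x) + lapl f x * g x"
proof -
  note D = Cinf_differentiable[of U]
  have "dd v (dd v (\<lambda>x. f x * g x)) x = f x * dd v (dd v g) x + 2 * (dd v f x * dd v g x) + dd v (dd v f) x * g x" for v
  proof -
    have "dd v (dd v (\<lambda>x. f x * g x)) x = dd v (\<lambda>x. f x * dd v g x + dd v f x * g x) x"
      by (rule dd_cong[OF U x]) (simp add: dd_mult D f g)
    also have "\<dots> = dd v (\<lambda>x. f x * dd v g x) x + dd v (\<lambda>x. dd v f x * g x) x"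
      by (rule dd_add) (intro D[OF _ x] cinf U f g)+
    also have "\<dots> = (f x * dd v (dd v g) x + dd v f x * dd v g x) + (dd v f x * dd v g x + dd v (dd v f) x * g x)"
      by (intro arg_cong2[where f="(+)"] dd_mult D[OF _ x] cinf U f g)
    finally show ?thesis by simp
  qed
  then show ?thesis by (simp add: lapl_def sum.distrib sum_distrib_left sum_distrib_right)
qed

lemma lapl_add:
  assumes U: "open U" and f: "Cinf U f" and g: "Cinf U g" and x: "x \<in> U"
  shows "lapl (\<lambda>x. f x + g x) x = lapl f x + lapl g x"
proof -
  note D = Cinf_differentiable[of U]
  have "dd v (dd v (\<lambda>x. f x + g x)) x = dd v (dd v f) x + dd v (dd v g) x" for v
  proof -
    have "dd v (dd v (\<lambda>x. f x + g x)) x = dd v (\<lambda>x. dd v f x + dd v g x) x"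
      by (rule dd_cong[OF U x]) (simp add: dd_add D f g)
    also have "\<dots> = dd v (dd v f) x + dd v (dd v g) x" by (rule dd_add) (intro D[OF _ x] cinf U f g)+
    finally show ?thesis .
  qed
  then show ?thesis by (simp add: lapl_def sum.distrib)
qed

lemma lapl_cmult:
  assumes U: "open U" and f: "Cinf U f" and x: "x \<in> U"
  shows "lapl (\<lambda>x. c * f x) x = c * lapl f x"
proof -
  note D = Cinf_differentiable[of U]
  have "dd v (dd v (\<lambda>x. c * f x)) x = c * dd v (dd v f) x" for v
  proof -
    have "dd v (dd v (\<lambda>x. c * f x)) x = dd v (\<lambda>x. c * dd v f x) x"
      by (rule dd_cong[OF U x]) (simp add: dd_cmult D f)
    also have "\<dots> = c * dd v (dd v f) x" by (rule dd_cmult) (intro D[OF _ x] cinf U f)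
    finally show ?thesis .
  qed
  then show ?thesis by (simp add: lapl_def sum_distrib_left)
qed

lemma lapl_nth [simp]: "lapl (\<lambda>x. x $ i) x = 0"
proof -
  have "dd v (\<lambda>x. x $ i) = (\<lambda>x. v $ i)" for v :: "real^'a" by (rule ext) simp
  then show ?thesis by (simp add: lapl_def)
qed

lemma dd_inner_self: "dd v (\<lambda>x. x \<bullet> x) x = 2 * (x \<bullet> v)"
  by (rule dd_eqI) (auto intro!: derivative_eq_intros simp: inner_commute)

lemma lapl_inner_self: "lapl (\<lambda>x. x \<bullet> x) (x::real^'n) = 2 * real CARD('n)"
proof -
  have "dd (axis i 1) (\<lambda>x. x \<bullet> x) = (\<lambda>x. 2 * x $ i)" for i :: 'n by (rule ext) (simp add: dd_inner_self inner_axis)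
  moreover have "dd (axis i 1) (\<lambda>x. 2 * x $ i) x = 2" for i by (subst dd_cmult) auto
  ultimately show ?thesis by (simp add: lapl_def)
qed

section \<open>Harmonic polynomials\<close>

definition Harm :: "nat \<Rightarrow> (real^'n \<Rightarrow> real) set" where
  "Harm e = {p \<in> Pol e. \<forall>x. lapl p x = 0}"

text \<open>The Laplacian commutes with partial derivatives of polynomials.\<close>

lemma Harm_dd: assumes "p \<in> Harm e" shows "dd (axis i 1) p \<in> Harm (e - 1)"
proof -
  have p: "p \<in> Pol e" and l: "lapl p = (\<lambda>x. 0)" using assms by (auto simp: Harm_def)
  have C: "Cinf UNIV (dd v p)" for v by (intro cinf Pol_Cinf[OF p]) auto
  have "lapl (dd (axis i 1) p) x = 0" for x
  proof -
    have "dd (axis k 1) (dd (axis k 1) (dd (axis i 1) p)) = dd (axis i 1) (dd (axis k 1) (dd (axis k 1) p))" for k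
      using Pol_dd[OF p, of k i] Pol_dd[of "dd (axis k 1) p" "e - 1" k i] Pol_dd[OF p, of k] by metis
    then have "lapl (dd (axis i 1) p) x = (\<Sum>k\<in>UNIV. dd (axis i 1) (dd (axis k 1) (dd (axis k 1) p)) x)"
      by (simp add: lapl_def)
    also have "\<dots> = dd (axis i 1) (\<lambda>x. \<Sum>k\<in>UNIV. dd (axis k 1) (dd (axis k 1) p) x) x"
      by (rule dd_sum[symmetric]) (intro Cinf_differentiable[of UNIV] cinf C, auto)
    also have "\<dots> = 0" using l unfolding lapl_def[abs_def] by simp
    finally show ?thesis .
  qed
  then show ?thesis using Pol_dd[OF p] by (simp add: Harm_def)
qed

text \<open>The harmonic part of \<open>x\<^sub>i p\<close>.\<close>

definition raise :: "nat \<Rightarrow> 'n \<Rightarrow> (real^'n \<Rightarrow> real) \<Rightarrow> real^'n \<Rightarrow> real" where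
  "raise e i p x = x $ i * p x - (1 / (real CARD('n) + 2 * real e - 2)) * ((x \<bullet> x) * dd (axis i 1) p x)"

text \<open>Let \<open>w = dd (axis i 1) p\<close>. The Laplacian sends \<open>x $ i * p x\<close>
  to \<open>2 w x\<close> and \<open>(x \<bullet> x) * w x\<close> to
  \<open>2 (n + 2 e - 2) w x\<close>, since Euler's relation in degree \<open>e - 1\<close> gives
  \<open>4 (e - 1) + 2 n\<close>. This is the origin of the constant in
  \<open>raise\<close>.\<close>

lemma raise_Harm:
  fixes p :: "real^'n \<Rightarrow> real"
  assumes n: "CARD('n) \<ge> 3" and p: "p \<in> Harm e" shows "raise e i p \<in> Harm (Suc e)"
proof -
  define w where "w = dd (axis i 1) p"
  have pP: "p \<in> Pol e" using p by (simp add: Harm_def)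
  have wH: "w \<in> Harm (e - 1)" unfolding w_def by (rule Harm_dd[OF p])
  have wP: "w \<in> Pol (e - 1)" using wH by (simp add: Harm_def)
  have w0: "w = (\<lambda>x. 0)" if "e = 0" using Pol_dd[OF pP, of i] that by (simp add: w_def)
  have pC: "Cinf UNIV p" and wC: "Cinf UNIV w" using Pol_Cinf pP wP by blast+
  let ?c = "real CARD('n) + 2 * real e - 2"
  have c: "?c > 0" using n by simp
  have r: "raise e i p = (\<lambda>x. x $ i * p x + (- 1 / ?c) * ((x \<bullet> x) * w x))" by (rule ext) (simp add: raise_def w_def)
  have sw: "(\<lambda>x. (x \<bullet> x) * w x) \<in> Pol (Suc e)"
  proof (cases e)
    case 0 then show ?thesis using w0 Pol_zero by simp
  next
    case (Suc d)
    have "(\<lambda>x. x $ k * (x $ k * w x)) \<in> Pol (Suc e)" for k using Pol_coord[OF Pol_coord[OF wP]] Suc by simp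
    then have "(\<lambda>x. \<Sum>k\<in>UNIV. x $ k * (x $ k * w x)) \<in> Pol (Suc e)" by (rule Pol_sum)
    then show ?thesis by (simp add: inner_vec_def sum_distrib_right mult.assoc)
  qed
  have "raise e i p \<in> Pol (Suc e)" unfolding r by (intro Pol_add Pol_coord Pol_cmult pP sw)
  moreover have "lapl (raise e i p) x = 0" for x
  proof -
    have l1: "lapl (\<lambda>x. x $ i * p x) x = 2 * w x"
    proof -
      have "(\<Sum>k\<in>UNIV. dd (axis k 1) (\<lambda>x. x $ i) x * dd (axis k 1) p x) = (\<Sum>k\<in>UNIV. if k = i then dd (axis k 1) p x else 0)"
        by (intro sum.cong refl) (auto simp: axis_def)
      then show ?thesis using p by (subst lapl_mult[of UNIV]) (auto simp: pC cinf w_def Harm_def)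
    qed
    have l2: "lapl (\<lambda>x. (x \<bullet> x) * w x) x = 2 * ?c * w x"
    proof -
      have "(\<Sum>k\<in>UNIV. dd (axis k 1) (\<lambda>x. x \<bullet> x) x * dd (axis k 1) w x) = 2 * (\<Sum>k\<in>UNIV. x $ k * dd (axis k 1) w x)"
        by (simp add: dd_inner_self inner_axis sum_distrib_left mult.assoc)
      then have "lapl (\<lambda>x. (x \<bullet> x) * w x) x = 2 * (2 * (real (e - 1) * w x)) + 2 * real CARD('n) * w x"
        using wH by (subst lapl_mult[of UNIV]) (auto simp: wC cinf lapl_inner_self Harm_def Pol_euler[OF wP])
      then show ?thesis using w0 by (cases "e = 0") (auto simp: of_nat_diff algebra_simps)
    qed
    have "lapl (raise e i p) x = 2 * w x + (- 1 / ?c) * (2 * ?c * w x)"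
    proof -
      have "Cinf UNIV (\<lambda>x. (x \<bullet> x) * w x)" "Cinf UNIV (\<lambda>x. x $ i * p x)" by (intro cinf pC wC open_UNIV)+
      then show ?thesis unfolding r
        by (simp only: lapl_add[OF open_UNIV _ Cinf_mult[OF open_UNIV Cinf_const]] lapl_cmult[OF open_UNIV] UNIV_I l1 l2)
    qed
    also have "\<dots> = 0" using c by (simp add: field_simps)
    finally show ?thesis .
  qed
  ultimately show ?thesis by (simp add: Harm_def)
qed

text \<open>The sum of \<open>x $ i * raise e i p x\<close> over \<open>i\<close> is
  \<open>(x \<bullet> x) * p x\<close> times the positive factor
  \<open>(n + e - 2) / (n + 2 e - 2)\<close>, so some raised polynomial is nonzero at the same
  point.\<close>

lemma Harm_nonzero:
  assumes n: "CARD('n) \<ge> 3"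
  shows "\<exists>p \<in> Harm e. \<exists>x::real^'n. x \<noteq> 0 \<and> p x \<noteq> 0"
proof (induction e)
  case 0
  have "(\<lambda>x::real^'n. 1) \<in> Harm 0" by (auto simp: Harm_def Pol_def fun_space.span_base lapl_def dd_zero zero_fun_def)
  moreover have "axis undefined 1 \<noteq> (0::real^'n)" by (simp add: axis_eq_0_iff)
  ultimately show ?case by fastforce
next
  case (Suc e)
  then obtain p and x :: "real^'n" where p: "p \<in> Harm e" and x: "x \<noteq> 0" "p x \<noteq> 0" by blast
  have pP: "p \<in> Pol e" using p by (simp add: Harm_def)
  let ?c = "real CARD('n) + 2 * real e - 2"
  have c: "?c > 0" "?c - real e > 0" using n by simp_all
  have "(\<Sum>i\<in>UNIV. x $ i * raise e i p x) = (\<Sum>i\<in>UNIV. x $ i * x $ i) * p x - (x \<bullet> x) / ?c * (\<Sum>i\<in>UNIV. x $ i * dd (axis i 1) p x)"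
    by (simp add: raise_def right_diff_distrib sum_subtractf sum_distrib_left sum_distrib_right sum_divide_distrib mult_ac)
  also have "\<dots> = (x \<bullet> x) * p x * ((?c - real e) / ?c)"
    unfolding inner_sum_sq Pol_euler[OF pP] using c by (simp add: field_simps)
  also have "\<dots> \<noteq> 0" using x c by simp
  finally obtain i where "x $ i * raise e i p x \<noteq> 0" by (metis (no_types, lifting) sum.neutral)
  then show ?case using raise_Harm[OF n p, of i] x(1) by (intro bexI[of _ "raise e i p"] exI[of _ x]) auto
qed

section \<open>Harmonic polynomials restricted to the sphere\<close>

definition rad :: "(real^'n \<Rightarrow> real) \<Rightarrow> real^'n \<Rightarrow> real" where
  "rad p x = p (x /\<^sub>R norm x)"

lemma Cinf_rad: fixes p :: "real^'n \<Rightarrow> real" assumes "Cinf UNIV p" shows "Cinf (- {0}) (rad p)"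
  unfolding rad_def[abs_def]
proof (rule Cinf_compose[OF assms])
  fix c :: "real^'n"
  have "Cinf (- {0}) (\<lambda>x::real^'n. inverse (norm x) * (x \<bullet> c))" by (intro cinf) auto
  then show "Cinf (- {0}) (\<lambda>x. (x /\<^sub>R norm x) \<bullet> c)" by simp
qed auto

lemma hom0_rad: "hom0 (rad p)" by (auto simp: hom0_def rad_def field_simps)

text \<open>The form \<open>norm x ^ e * inverse (x \<bullet> x)\<close> avoids the exponents
  \<open>e - 1\<close> and \<open>e - 2\<close>, which are truncated for small
  \<open>e\<close>.\<close>

lemma dd_norm_power:
  fixes x :: "real^'n"
  assumes "x \<noteq> 0"
  shows "dd v (\<lambda>x. norm x ^ e) x = real e * (norm x ^ e * inverse (x \<bullet> x) * (x \<bullet> v))"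
proof -
  have n: "(norm has_derivative (\<lambda>v. (x \<bullet> v) / norm x)) (at x)"
    using has_derivative_norm[OF assms] by (simp add: sgn_div_norm inner_commute divide_inverse mult.commute)
  have "((\<lambda>x. norm x ^ e) has_derivative (\<lambda>v. real e * ((x \<bullet> v) / norm x) * norm x ^ (e - 1))) (at x)"
    by (rule has_derivative_power[OF n])
  from dd_eqI[OF this, of v] show ?thesis using assms
    by (cases e) (simp_all add: dot_square_norm power2_eq_square field_simps)
qed

lemma lapl_norm_power:
  fixes x :: "real^'n"
  assumes x: "x \<noteq> 0"
  shows "lapl (\<lambda>x. norm x ^ e) x = real e * (real e + real CARD('n) - 2) * norm x ^ e / (x \<bullet> x)"
proof -
  let ?R = "\<lambda>x::real^'n. norm x ^ e"
  let ?s = "x \<bullet> x"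
  have s: "?s \<noteq> 0" using x by simp
  have N: "?R differentiable (at x)" by (rule Cinf_differentiable[of "- {0}"]) (intro cinf, use x in auto)
  have I: "(\<lambda>x::real^'n. inverse (x \<bullet> x)) differentiable (at x)"
    by (rule Cinf_differentiable[of "- {0}"]) (intro cinf, use x in auto)
  have dI: "dd v (\<lambda>x::real^'n. inverse (x \<bullet> x)) x = - (2 * (x \<bullet> v) / (?s * ?s))" for v
    by (rule dd_eqI[where f' = "\<lambda>v. - (2 * (x \<bullet> v) / (?s * ?s))"])
      (use s in \<open>auto intro!: derivative_eq_intros simp: inner_commute field_simps\<close>)
  have lin: "(\<lambda>x. x \<bullet> v) differentiable (at x)" "dd w (\<lambda>x. x \<bullet> v) x = w \<bullet> v" for v w :: "real^'n"
    using bounded_linear_imp_differentiable[OF bounded_linear_inner_left[of v]]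
      dd_eqI[OF bounded_linear_imp_has_derivative[OF bounded_linear_inner_left[of v]]] by auto
  have "dd v (dd v ?R) x = real e * ?R x * ((real e - 2) * (x \<bullet> v)\<^sup>2 / ?s\<^sup>2 + (v \<bullet> v) / ?s)" for v
  proof -
    have "dd v (dd v ?R) x = dd v (\<lambda>x. real e * (?R x * inverse (x \<bullet> x) * (x \<bullet> v))) x"
      by (rule dd_cong[of "- {0}"]) (use x dd_norm_power in auto)
    also have "\<dots> = real e * (?R x * inverse ?s * (v \<bullet> v) + (?R x * (- (2 * (x \<bullet> v) / (?s * ?s)))
        + real e * (?R x * inverse ?s * (x \<bullet> v)) * inverse ?s) * (x \<bullet> v))"
      by (simp add: dd_cmult dd_mult N I lin differentiable_mult dI dd_norm_power[OF x])
    also have "\<dots> = real e * ?R x * ((real e - 2) * (x \<bullet> v)\<^sup>2 / ?s\<^sup>2 + (v \<bullet> v) / ?s)"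
      using s by (simp add: field_simps power2_eq_square)
    finally show ?thesis .
  qed
  then have "lapl ?R x = (\<Sum>i\<in>UNIV. real e * ?R x * ((real e - 2) / ?s\<^sup>2 * (x $ i * x $ i) + 1 / ?s))"
    by (simp add: lapl_def inner_axis inner_axis_axis power2_eq_square)
  also have "\<dots> = real e * ?R x * ((real e - 2) / ?s\<^sup>2 * ?s + real CARD('n) / ?s)"
    by (simp only: sum_distrib_left[symmetric] sum.distrib inner_sum_sq) simp
  also have "\<dots> = real e * (real e + real CARD('n) - 2) * norm x ^ e / ?s"
    using s by (simp add: field_simps power2_eq_square)
  finally show ?thesis .
qed

text \<open>The eigenvalue of minus the Laplacian of the unit sphere in dimension \<open>n\<close>
  on harmonics of degree \<open>e\<close>.\<close>

definition sph_eig :: "nat \<Rightarrow> nat \<Rightarrow> real" where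
  "sph_eig n e = real e * (real e + real n - 2)"

text \<open>Off the origin \<open>p\<close> is \<open>norm x ^ e * rad p x\<close>. In the product
  rule for \<open>lapl p = 0\<close> the mixed term is a radial derivative of \<open>rad p\<close>,
  hence zero, and the Laplacian of \<open>norm x ^ e\<close> contributes the eigenvalue.\<close>

lemma lapl_rad:
  fixes p :: "real^'n \<Rightarrow> real"
  assumes p: "p \<in> Harm e" and x: "x \<noteq> 0"
  shows "(x \<bullet> x) * lapl (rad p) x = - sph_eig CARD('n) e * rad p x"
proof -
  have pP: "p \<in> Pol e" and l0: "lapl p x = 0" using p by (auto simp: Harm_def)
  have rC: "Cinf (- {0}) (rad p)" by (rule Cinf_rad[OF Pol_Cinf[OF pP]])
  have nC: "Cinf (- {0}) (\<lambda>x::real^'n. norm x ^ e)" by (intro cinf) auto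
  have s: "x \<bullet> x \<noteq> 0" using x by simp
  have eq: "p y = norm y ^ e * rad p y" if "y \<noteq> 0" for y
    using Pol_hom[OF pP, of "norm y" "y /\<^sub>R norm y"] that by (simp add: rad_def)
  have "lapl p x = lapl (\<lambda>y. norm y ^ e * rad p y) x"
  proof -
    have "dd v (dd v p) x = dd v (dd v (\<lambda>y. norm y ^ e * rad p y)) x" for v
      by (rule dd_cong[of "- {0}"], simp, simp add: x, rule dd_cong[of "- {0}"]) (use eq in auto)
    then show ?thesis by (simp add: lapl_def)
  qed
  also have "\<dots> = norm x ^ e * lapl (rad p) x + 2 * (\<Sum>i\<in>UNIV. dd (axis i 1) (\<lambda>x. norm x ^ e) x * dd (axis i 1) (rad p) x)
      + lapl (\<lambda>x. norm x ^ e) x * rad p x"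
    by (rule lapl_mult[OF open_punctured nC rC]) (simp add: x)
  also have "(\<Sum>i\<in>UNIV. dd (axis i 1) (\<lambda>x. norm x ^ e) x * dd (axis i 1) (rad p) x)
    = real e * norm x ^ e * inverse (x \<bullet> x) * (\<Sum>i\<in>UNIV. x $ i * dd (axis i 1) (rad p) x)"
    by (simp add: dd_norm_power[OF x] inner_axis sum_distrib_left mult_ac)
  also have "(\<Sum>i\<in>UNIV. x $ i * dd (axis i 1) (rad p) x) = 0"
    using dd_sum_axis[of "rad p" x x] hom0_euler[OF _ hom0_rad x, of p] Cinf_differentiable[OF rC] x by simp
  finally have "norm x ^ e * lapl (rad p) x + real e * (real e + real CARD('n) - 2) * norm x ^ e / (x \<bullet> x) * rad p x = 0"
    using l0 lapl_norm_power[OF x] by simp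
  then have "norm x ^ e * ((x \<bullet> x) * lapl (rad p) x + sph_eig CARD('n) e * rad p x) = 0"
    using s by (simp add: sph_eig_def field_simps)
  then show ?thesis using x by simp
qed

section \<open>Density of spherical harmonics\<close>

definition SH :: "(real^'n \<Rightarrow> real) set" where "SH = fun_space.span (\<Union>e. Harm e)"

lemma subspace_SH: "fun_space.subspace SH" by (simp add: SH_def)

lemma SH_base: "p \<in> Harm e \<Longrightarrow> p \<in> SH" unfolding SH_def by (rule fun_space.span_base) blast
lemma SH_add: "p \<in> SH \<Longrightarrow> q \<in> SH \<Longrightarrow> (\<lambda>x. p x + q x) \<in> SH"
  using fun_space.subspace_add[OF subspace_SH, of p q] by (simp add: plus_fun_def)
lemma SH_cmult: "p \<in> SH \<Longrightarrow> (\<lambda>x. c * p x) \<in> SH"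
  using fun_space.subspace_scale[OF subspace_SH] by blast
lemma SH_zero: "(\<lambda>x. 0) \<in> SH"
  using fun_space.subspace_0[OF subspace_SH] by (simp add: zero_fun_def)

lemma SH_induct [consumes 1, case_names base zero add scale]:
  assumes "p \<in> SH" "\<And>e m. m \<in> Harm e \<Longrightarrow> P m" "P (\<lambda>x. 0)"
    "\<And>p q. P p \<Longrightarrow> P q \<Longrightarrow> P (\<lambda>x. p x + q x)" "\<And>c p. P p \<Longrightarrow> P (\<lambda>x. c * p x)"
  shows "P p"
proof -
  have "fun_space.subspace {p. P p}"
    using assms(3-5) by (auto simp: fun_space.subspace_def zero_fun_def plus_fun_def)
  then show ?thesis using fun_space.span_induct[of p "\<Union>e. Harm e" P] assms(1,2) by (auto simp: SH_def)
qed

lemma SH_Cinf: "p \<in> SH \<Longrightarrow> Cinf UNIV p"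
  by (induction rule: SH_induct) (auto intro!: cinf simp: Harm_def Pol_Cinf)

text \<open>The functions that multiply \<open>SH\<close> into itself after restriction to the
  sphere. They form an algebra, which reduces the case of polynomials to the coordinate
  functions.\<close>

definition SH_mult :: "(real^'n \<Rightarrow> real) \<Rightarrow> bool" where
  "SH_mult g \<longleftrightarrow> (\<forall>w\<in>SH. \<exists>w'\<in>SH. \<forall>x\<in>sphere 0 1. g x * w x = w' x)"

text \<open>By definition of \<open>raise\<close>, \<open>x $ i * m x\<close> is a harmonic
  polynomial plus a multiple of \<open>(x \<bullet> x) * dd (axis i 1) m x\<close>. On the unit
  sphere \<open>x \<bullet> x\<close> is 1, and the derivative is harmonic again.\<close>

lemma SH_mult_coord:
  assumes n: "CARD('n) \<ge> 3" shows "SH_mult (\<lambda>x::real^'n. x $ i)"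
  unfolding SH_mult_def
proof
  fix w :: "real^'n \<Rightarrow> real" assume "w \<in> SH"
  then show "\<exists>w'\<in>SH. \<forall>x\<in>sphere 0 1. x $ i * w x = w' x"
  proof (induction rule: SH_induct)
    case (base e m)
    define c where "c = 1 / (real CARD('n) + 2 * real e - 2)"
    have "(\<lambda>x. raise e i m x + c * dd (axis i 1) m x) \<in> SH"
      by (intro SH_add SH_cmult SH_base[OF raise_Harm[OF n base]] SH_base[OF Harm_dd[OF base]])
    moreover have "x $ i * m x = raise e i m x + c * dd (axis i 1) m x" if "x \<in> sphere 0 1" for x
      using that by (simp add: raise_def c_def dot_square_norm)
    ultimately show ?case by (intro bexI) auto
  next
    case zero then show ?case by (intro bexI[OF _ SH_zero]) simp
  next
    case (add p q)
    then obtain p' q' where "p' \<in> SH" "q' \<in> SH" "\<And>x. x \<in> sphere 0 1 \<Longrightarrow> x $ i * p x = p' x"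
      "\<And>x. x \<in> sphere 0 1 \<Longrightarrow> x $ i * q x = q' x" by metis
    then show ?case by (intro bexI[OF _ SH_add[of p' q']]) (auto simp: distrib_left)
  next
    case (scale c p)
    then obtain p' where "p' \<in> SH" "\<And>x. x \<in> sphere 0 1 \<Longrightarrow> x $ i * p x = p' x" by metis
    then show ?case by (intro bexI[OF _ SH_cmult[of p' c]]) (auto simp: mult.left_commute)
  qed
qed

lemma SH_mult_const: "SH_mult (\<lambda>x. c)"
  unfolding SH_mult_def using SH_cmult by fast

lemma SH_mult_add: assumes "SH_mult f" "SH_mult g" shows "SH_mult (\<lambda>x. f x + g x)"
  unfolding SH_mult_def
proof
  fix w :: "real^'a \<Rightarrow> real" assume "w \<in> SH"
  then obtain u v where "u \<in> SH" "v \<in> SH" "\<And>x. x \<in> sphere 0 1 \<Longrightarrow> f x * w x = u x" "\<And>x. x \<in> sphere 0 1 \<Longrightarrow> g x * w x = v x"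
    using assms unfolding SH_mult_def by metis
  then show "\<exists>w'\<in>SH. \<forall>x\<in>sphere 0 1. (f x + g x) * w x = w' x"
    by (intro bexI[OF _ SH_add[of u v]]) (auto simp: distrib_right)
qed

lemma SH_mult_mult: assumes "SH_mult f" "SH_mult g" shows "SH_mult (\<lambda>x. f x * g x)"
  unfolding SH_mult_def
proof
  fix w :: "real^'a \<Rightarrow> real" assume "w \<in> SH"
  then obtain v where v: "v \<in> SH" "\<And>x. x \<in> sphere 0 1 \<Longrightarrow> g x * w x = v x"
    using assms unfolding SH_mult_def by metis
  then obtain u where "u \<in> SH" "\<And>x. x \<in> sphere 0 1 \<Longrightarrow> f x * v x = u x"
    using assms unfolding SH_mult_def by metis
  with v show "\<exists>w'\<in>SH. \<forall>x\<in>sphere 0 1. f x * g x * w x = w' x"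
    by (intro bexI[of _ u]) (auto simp: mult.assoc)
qed

lemma SH_mult_sum: "(\<And>i. i \<in> I \<Longrightarrow> SH_mult (f i)) \<Longrightarrow> SH_mult (\<lambda>x. \<Sum>i\<in>I. f i x)"
  by (induction I rule: infinite_finite_induct) (auto intro: SH_mult_const SH_mult_add)

lemma SH_mult_polynomial:
  fixes g :: "real^'n \<Rightarrow> real"
  assumes n: "CARD('n) \<ge> 3" and g: "real_polynomial_function g" shows "SH_mult g"
  using g
proof (induction rule: real_polynomial_function.induct)
  case (linear f)
  interpret bounded_linear f by (rule linear)
  have "f x = (\<Sum>i\<in>UNIV. f (axis i 1) * x $ i)" for x
  proof -
    have "(\<Sum>i\<in>UNIV. x $ i *\<^sub>R axis i 1) = x"
      using basis_expansion[of x] by (simp add: scalar_mult_eq_scaleR)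
    then have "f x = f (\<Sum>i\<in>UNIV. x $ i *\<^sub>R axis i 1)" by simp
    then show ?thesis by (simp add: sum scale mult.commute)
  qed
  then have "f = (\<lambda>x. \<Sum>i\<in>UNIV. f (axis i 1) * x $ i)" by (rule ext)
  moreover have "SH_mult (\<lambda>x. \<Sum>i\<in>UNIV. f (axis i 1) * x $ i)"
    by (intro SH_mult_sum SH_mult_mult[OF SH_mult_const] SH_mult_coord n)
  ultimately show ?case by (simp only:)
qed (auto intro: SH_mult_const SH_mult_add SH_mult_mult)

text \<open>Stone-Weierstrass gives a polynomial, and polynomials multiply the constant harmonic 1
  into \<open>SH\<close>.\<close>

lemma SH_dense:
  fixes g :: "real^'n \<Rightarrow> real"
  assumes n: "CARD('n) \<ge> 3" and g: "continuous_on (sphere 0 1) g" and "\<delta> > 0"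
  shows "\<exists>w\<in>SH. \<forall>x\<in>sphere 0 1. \<bar>g x - w x\<bar> < \<delta>"
proof -
  obtain h where h: "real_polynomial_function h" "\<And>x. x \<in> sphere 0 1 \<Longrightarrow> \<bar>g x - h x\<bar> < \<delta>"
    using Stone_Weierstrass_real_polynomial_function[OF compact_sphere g \<open>\<delta> > 0\<close>] by metis
  have "(\<lambda>x::real^'n. 1) \<in> Harm 0" by (auto simp: Harm_def Pol_def fun_space.span_base lapl_def dd_zero zero_fun_def)
  then obtain w where "w \<in> SH" "\<And>x. x \<in> sphere 0 1 \<Longrightarrow> h x * 1 = w x"
    using SH_mult_polynomial[OF n h(1)] SH_base unfolding SH_mult_def by metis
  then show ?thesis using h(2) by (intro bexI[of _ w]) auto
qed

lemma Isph_mono: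
  assumes "continuous_on (- {0}) f" "continuous_on (- {0}) g" "\<And>x. x \<noteq> 0 \<Longrightarrow> f x \<le> g x"
  shows "Isph f \<le> Isph g"
  unfolding Isph_def
proof (rule integral_le)
  show "bump (x \<bullet> x) * f x \<le> bump (x \<bullet> x) * g x" for x
    using assms(3) by (cases "x = 0") (auto simp: bump_zero intro!: mult_left_mono bump_nonneg)
qed (intro Isph_integrable assms)+

lemma Isph_nonneg: "continuous_on (- {0}) f \<Longrightarrow> (\<And>x. x \<noteq> 0 \<Longrightarrow> f x \<ge> 0) \<Longrightarrow> Isph f \<ge> 0"
  using Isph_mono[of "\<lambda>x. 0" f] by (simp add: Isph_def)

text \<open>If \<open>w\<close> in \<open>SH\<close> is within \<open>\<delta>\<close> of
  \<open>g\<close> on the sphere, orthogonality turns the integral of \<open>g^2\<close> into that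
  of \<open>g (g - w)\<close>, which is at most \<open>\<delta>\<close> times the integral of
  \<open>|g|\<close>.\<close>

lemma Isph_complete:
  fixes g :: "real^'n \<Rightarrow> real"
  assumes n: "CARD('n) \<ge> 3" and g: "continuous_on (- {0}) g" "hom0 g"
    and z: "\<And>e p. p \<in> Harm e \<Longrightarrow> Isph (\<lambda>x. g x * rad p x) = 0" and x: "x \<noteq> 0"
  shows "g x = 0"
proof (rule Isph_definite[OF g _ x])
  have rc: "continuous_on (- {0}) (rad w)" if "w \<in> SH" for w :: "real^'n \<Rightarrow> real"
    using Cinf_continuous_on[OF Cinf_rad[OF SH_Cinf[OF that]]] .
  have z': "w \<in> SH \<Longrightarrow> Isph (\<lambda>x. g x * rad w x) = 0" for w
  proof -
    assume "w \<in> SH"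
    then have "w \<in> SH \<and> Isph (\<lambda>x. g x * rad w x) = 0"
    proof (induction rule: SH_induct)
      case (add p q)
      then have "Isph (\<lambda>x. g x * rad p x + g x * rad q x) = 0"
        by (subst Isph_add) (auto intro!: continuous_intros g rc)
      then show ?case using add by (simp add: rad_def distrib_left SH_add)
    next
      case (scale c p)
      then have "Isph (\<lambda>x. c * (g x * rad p x)) = 0" by (simp add: Isph_cmult)
      then show ?case using scale by (simp add: rad_def mult.left_commute SH_cmult)
    qed (simp_all add: z SH_base SH_zero, simp add: rad_def Isph_def)
    then show ?thesis by simp
  qed
  define K where "K = Isph (\<lambda>x. \<bar>g x\<bar>)"
  have gg: "continuous_on (- {0}) (\<lambda>x. g x * g x)" by (intro continuous_intros g)
  have K0: "K \<ge> 0" unfolding K_def by (rule Isph_nonneg) (auto intro!: continuous_intros g)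
  have le: "Isph (\<lambda>x. g x * g x) \<le> \<delta> * K" if \<delta>: "\<delta> > 0" for \<delta>
  proof -
    have "continuous_on (sphere 0 1) g" by (rule continuous_on_subset[OF g(1)]) auto
    then obtain w where w: "w \<in> SH" "\<And>x. x \<in> sphere 0 1 \<Longrightarrow> \<bar>g x - w x\<bar> < \<delta>" using SH_dense[OF n _ \<delta>] by metis
    have gw: "continuous_on (- {0}) (\<lambda>x. g x * rad w x)" by (intro continuous_intros g rc w)
    have "Isph (\<lambda>x. g x * g x) = Isph (\<lambda>x. g x * g x - g x * rad w x)"
      by (simp add: Isph_diff[OF gg gw] z'[OF w(1)])
    also have "\<dots> \<le> Isph (\<lambda>x. \<delta> * \<bar>g x\<bar>)"
    proof (rule Isph_mono)
      fix x :: "real^'n" assume x: "x \<noteq> 0"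
      have "g (x /\<^sub>R norm x) = g x" using g(2) x unfolding hom0_def by simp
      then have "\<bar>g x - rad w x\<bar> \<le> \<delta>" using w(2)[of "x /\<^sub>R norm x"] x by (simp add: rad_def)
      then have "g x * (g x - rad w x) \<le> \<bar>g x\<bar> * \<delta>"
        by (metis abs_ge_self abs_ge_zero abs_mult mult_left_mono order_trans)
      then show "g x * g x - g x * rad w x \<le> \<delta> * \<bar>g x\<bar>" by (simp add: algebra_simps)
    qed (intro continuous_intros g gg gw)+
    finally show ?thesis by (simp add: Isph_cmult K_def)
  qed
  have "Isph (\<lambda>x. g x * g x) \<le> 0"
  proof (rule field_le_epsilon)
    fix \<delta> :: real assume "\<delta> > 0"
    \<comment> \<open>Dividing by \<open>K + 1\<close> covers the case \<open>K = 0\<close>.\<close>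
    then have "Isph (\<lambda>x. g x * g x) \<le> (\<delta> / (K + 1)) * K" using K0 by (intro le) auto
    also have "\<dots> \<le> \<delta>" using K0 \<open>\<delta> > 0\<close> by (simp add: field_simps)
    finally show "Isph (\<lambda>x. g x * g x) \<le> 0 + \<delta>" by simp
  qed
  moreover have "Isph (\<lambda>x. g x * g x) \<ge> 0" by (rule Isph_nonneg[OF gg]) simp
  ultimately show "Isph (\<lambda>x. g x * g x) = 0" by simp
qed

section \<open>Orthonormal bases of spherical harmonics\<close>

definition sph_ip :: "(real^'n \<Rightarrow> real) \<Rightarrow> (real^'n \<Rightarrow> real) \<Rightarrow> real" where
  "sph_ip u v = Isph (\<lambda>x. rad u x * rad v x)"

definition sph_onb :: "(real^'n \<Rightarrow> real) set \<Rightarrow> bool" where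
  "sph_onb B \<longleftrightarrow> finite B \<and> (\<forall>u\<in>B. \<forall>v\<in>B. sph_ip u v = (if u = v then 1 else 0))"

lemma rad_continuous: "p \<in> Harm e \<Longrightarrow> continuous_on (- {0}) (rad p)"
  using Cinf_continuous_on[OF Cinf_rad[OF Pol_Cinf]] by (auto simp: Harm_def)

lemma sph_ip_commute: "sph_ip u v = sph_ip v u" by (simp add: sph_ip_def mult.commute)

lemma subspace_Harm: "fun_space.subspace (Harm e)"
proof -
  have "lapl (\<lambda>x. p x + q x) x = 0" if "p \<in> Harm e" "q \<in> Harm e" for p q and x :: "real^'a"
    using that by (subst lapl_add[of UNIV]) (auto simp: Harm_def Pol_Cinf)
  moreover have "lapl (\<lambda>x. c * p x) x = 0" if "p \<in> Harm e" for p c and x :: "real^'a"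
    using that by (subst lapl_cmult[of UNIV]) (auto simp: Harm_def Pol_Cinf)
  moreover have "lapl (\<lambda>x. 0) x = 0" for x :: "real^'a" by (simp add: lapl_def dd_zero zero_fun_def)
  ultimately show ?thesis unfolding fun_space.subspace_def
    by (auto simp: zero_fun_def plus_fun_def Harm_def Pol_zero Pol_add Pol_cmult)
qed

lemma sph_ip_add: "u \<in> Harm e \<Longrightarrow> v \<in> Harm e \<Longrightarrow> w \<in> Harm e \<Longrightarrow> sph_ip (u + v) w = sph_ip u w + sph_ip v w"
  unfolding sph_ip_def
  by (subst Isph_add[symmetric], (intro continuous_intros rad_continuous; assumption)+) (simp add: rad_def distrib_right)
lemma sph_ip_cmult: "sph_ip (\<lambda>x. c * u x) w = c * sph_ip u w"
  unfolding sph_ip_def by (subst Isph_cmult[symmetric]) (simp add: rad_def mult.assoc)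

lemma sph_ip_eq_0:
  assumes p: "p \<in> Harm e" and z: "sph_ip p p = 0" shows "p = 0"
proof
  have pP: "p \<in> Pol e" using p by (simp add: Harm_def)
  have r: "rad p x = 0" if "x \<noteq> 0" for x
    by (rule Isph_definite[OF rad_continuous[OF p] hom0_rad _ that]) (use z in \<open>simp add: sph_ip_def\<close>)
  have nz: "p x = 0" if "x \<noteq> 0" for x
    using Pol_hom[OF pP, of "norm x" "x /\<^sub>R norm x"] r[OF that] that by (simp add: rad_def)
  \<comment> \<open>Homogeneity with factor 0 reaches the origin: \<open>p 0\<close> is
    \<open>0 ^ e\<close> times a value already known to vanish.\<close>
  have "axis undefined 1 \<noteq> (0::real^'a)" by (simp add: axis_eq_0_iff)
  then have "p 0 = 0" using Pol_hom[OF pP, of 0 "axis undefined 1"] nz by simp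
  then show "p x = 0 x" for x using nz by (cases "x = 0") auto
qed

lemma sph_ip_nonneg: "p \<in> Harm e \<Longrightarrow> sph_ip p p \<ge> 0"
  unfolding sph_ip_def by (rule Isph_nonneg) (auto intro!: continuous_intros rad_continuous)

lemma sph_ip_sum: "finite B \<Longrightarrow> (\<And>b. b \<in> B \<Longrightarrow> f b \<in> Harm e) \<Longrightarrow> w \<in> Harm e \<Longrightarrow>
  sph_ip (\<Sum>b\<in>B. f b) w = (\<Sum>b\<in>B. sph_ip (f b) w)"
proof (induction B rule: finite_induct)
  case empty then show ?case by (simp add: sph_ip_def Isph_def rad_def)
next
  case (insert b B) then show ?case
    by (simp add: sph_ip_add[of _ e] fun_space.subspace_sum[OF subspace_Harm] del: plus_fun_apply sum.insert_if add: sum.insert)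
qed

text \<open>The new vector is replaced by its residual after projection on the earlier ones, and
  dropped if the residual is zero. Normalisation is possible because \<open>sph_ip\<close> is
  definite on \<open>Harm e\<close>: a homogeneous polynomial is determined by its values on the
  sphere.\<close>

lemma gram_schmidt:
  assumes "finite B" "B \<subseteq> Harm e"
  shows "\<exists>Q. Q \<subseteq> Harm e \<and> sph_onb Q \<and> fun_space.span Q = fun_space.span B"
  using assms
proof (induction B rule: finite_induct)
  case empty then show ?case by (intro exI[of _ "{}"]) (auto simp: sph_onb_def)
next
  case (insert b B)
  then obtain Q where Q: "Q \<subseteq> Harm e" "sph_onb Q" "fun_space.span Q = fun_space.span B" by auto
  have fin: "finite Q" using Q(2) by (simp add: sph_onb_def)
  have b: "b \<in> Harm e" using insert by simp
  have sc: "(\<lambda>x. c * u x) \<in> Harm e" if "u \<in> Harm e" for c u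
    using fun_space.subspace_scale[OF subspace_Harm that] .
  define s where "s = (\<Sum>q\<in>Q. (\<lambda>x. sph_ip b q * q x))"
  have sH: "s \<in> Harm e" unfolding s_def using Q(1) sc by (intro fun_space.subspace_sum[OF subspace_Harm]) auto
  have sS: "s \<in> fun_space.span Q" unfolding s_def by (intro fun_space.span_sum fun_space.span_scale fun_space.span_base)
  define d where "d = b - s"
  have dH: "d \<in> Harm e" unfolding d_def by (rule fun_space.subspace_diff[OF subspace_Harm b sH])
  have bd: "b = d + s" by (simp add: d_def)
  show ?case
  proof (cases "d = 0")
    case True
    then have "b \<in> fun_space.span B" using bd sS Q(3) by simp
    then show ?thesis using Q fun_space.span_redundant[of b B] by (intro exI[of _ Q]) auto
  next
    case False
    define k where "k = 1 / sqrt (sph_ip d d)"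
    have pos: "sph_ip d d > 0" using sph_ip_nonneg[OF dH] sph_ip_eq_0[OF dH] False by force
    then have k: "k \<noteq> 0" "k * k * sph_ip d d = 1" by (auto simp: k_def field_simps)
    define q0 where "q0 = (\<lambda>x. k * d x)"
    have q0H: "q0 \<in> Harm e" unfolding q0_def by (rule sc[OF dH])
    have q00: "sph_ip q0 q0 = 1"
      unfolding q0_def by (simp only: sph_ip_cmult sph_ip_commute[of d "\<lambda>x. k * d x"]) (use k in \<open>simp add: mult.assoc\<close>)
    have dq: "sph_ip d q = 0" if q: "q \<in> Q" for q
    proof -
      have "sph_ip s q = (\<Sum>q'\<in>Q. sph_ip (\<lambda>x. sph_ip b q' * q' x) q)" unfolding s_def
        by (rule sph_ip_sum[OF fin]) (use Q(1) sc q in auto)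
      also have "\<dots> = (\<Sum>q'\<in>Q. if q' = q then sph_ip b q' else 0)"
        using Q(2) q by (intro sum.cong) (auto simp: sph_ip_cmult sph_onb_def)
      also have "\<dots> = sph_ip b q" using fin q by simp
      finally have "sph_ip s q = sph_ip b q" .
      moreover have "sph_ip b q = sph_ip d q + sph_ip s q"
        unfolding bd by (rule sph_ip_add[OF dH sH]) (use q Q in auto)
      ultimately show ?thesis by simp
    qed
    then have q0q: "sph_ip q0 q = 0" "sph_ip q q0 = 0" if "q \<in> Q" for q
      using that sph_ip_commute[of q] by (simp_all add: q0_def sph_ip_cmult)
    have "sph_onb (insert q0 Q)" using Q(2) q00 q0q by (auto simp: sph_onb_def)
    moreover have "fun_space.span (insert q0 Q) = fun_space.span (insert b B)"
    proof -
      have dS: "d \<in> fun_space.span (insert q0 Q)"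
      proof -
        have "(\<lambda>x. (1 / k) * q0 x) \<in> fun_space.span (insert q0 Q)"
          by (intro fun_space.span_scale fun_space.span_base) simp
        then show ?thesis using k by (simp add: q0_def)
      qed
      have mono: "fun_space.span Q \<subseteq> fun_space.span (insert q0 Q)" "fun_space.span B \<subseteq> fun_space.span (insert b B)"
        by (auto intro!: fun_space.span_mono)
      have "b \<in> fun_space.span (insert q0 Q)" unfolding bd using dS sS mono by (intro fun_space.span_add) auto
      then have 1: "insert b B \<subseteq> fun_space.span (insert q0 Q)"
        using mono Q(3) fun_space.span_superset[of B] by auto
      have "d \<in> fun_space.span (insert b B)" unfolding d_def
        using sS mono Q(3) by (intro fun_space.span_diff[OF fun_space.span_base]) auto
      then have "q0 \<in> fun_space.span (insert b B)" unfolding q0_def by (rule fun_space.span_scale)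
      then have 2: "insert q0 Q \<subseteq> fun_space.span (insert b B)"
        using mono Q(3) fun_space.span_superset[of Q] by auto
      show ?thesis
        by (intro subset_antisym fun_space.span_minimal[OF 2] fun_space.span_minimal[OF 1] fun_space.subspace_span)
    qed
    ultimately show ?thesis using Q(1) q0H by (intro exI[of _ "insert q0 Q"]) auto
  qed
qed

text \<open>One basis per degree is fixed once, so that the modes of all profiles and of the tent
  share the same index set.\<close>

definition onb :: "nat \<Rightarrow> (real^'n \<Rightarrow> real) set" where
  "onb e = (SOME Q. Q \<subseteq> Harm e \<and> sph_onb Q \<and> fun_space.span Q = Harm e)"

lemma onb:
  shows onb_Harm: "onb e \<subseteq> (Harm e :: (real^'n \<Rightarrow> real) set)" and sph_onb_onb: "sph_onb (onb e :: (real^'n \<Rightarrow> real) set)"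
    and span_onb: "fun_space.span (onb e :: (real^'n \<Rightarrow> real) set) = Harm e"
proof -
  obtain B :: "(real^'n \<Rightarrow> real) set" where B: "B \<subseteq> Harm e" "fun_space.independent B" "Harm e \<subseteq> fun_space.span B"
    using fun_space.basis_exists[of "Harm e"] by metis
  have "B \<subseteq> fun_space.span (Mon e)" using B(1) by (auto simp: Harm_def Pol_def)
  then have "finite B" using fun_space.independent_span_bound[OF finite_Mon B(2)] by simp
  moreover have "fun_space.span B = Harm e" using B fun_space.span_minimal[OF B(1) subspace_Harm] by blast
  ultimately have "\<exists>Q :: (real^'n \<Rightarrow> real) set. Q \<subseteq> Harm e \<and> sph_onb Q \<and> fun_space.span Q = Harm e"
    using gram_schmidt[of B e] B(1) by metis
  from someI_ex[OF this] show "onb e \<subseteq> (Harm e :: (real^'n \<Rightarrow> real) set)" "sph_onb (onb e :: (real^'n \<Rightarrow> real) set)"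
    "fun_space.span (onb e :: (real^'n \<Rightarrow> real) set) = Harm e" unfolding onb_def by blast+
qed

lemma finite_onb [simp]: "finite (onb e)" using sph_onb_onb by (auto simp: sph_onb_def)

lemma onb_nonempty: assumes "CARD('n) \<ge> 3" shows "onb e \<noteq> ({} :: (real^'n \<Rightarrow> real) set)"
proof
  assume "onb e = ({} :: (real^'n \<Rightarrow> real) set)"
  then have "Harm e = {0 :: real^'n \<Rightarrow> real}" using span_onb[of e] fun_space.span_empty by metis
  then show False using Harm_nonzero[OF assms, of e] by auto
qed

lemma sph_eig_strict_mono: "n \<ge> 3 \<Longrightarrow> strict_mono (sph_eig n)"
  unfolding sph_eig_def by (rule strict_monoI) (auto intro!: mult_strict_mono)

text \<open>Green's identity makes the spherical Laplacian symmetric, and different degrees have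
  different eigenvalues.\<close>

lemma sph_ip_Harm_orthogonal:
  fixes u v :: "real^'n \<Rightarrow> real"
  assumes n: "CARD('n) \<ge> 3" and u: "u \<in> Harm e" and v: "v \<in> Harm d" and ne: "e \<noteq> d"
  shows "sph_ip u v = 0"
proof -
  have C: "Cinf (- {0}) (rad u)" "Cinf (- {0}) (rad v)" using u v Cinf_rad[OF Pol_Cinf] by (auto simp: Harm_def)
  have "- sph_eig CARD('n) e * sph_ip u v = Isph (\<lambda>x. - sph_eig CARD('n) e * (rad u x * rad v x))"
    by (simp only: sph_ip_def Isph_cmult)
  also have "\<dots> = Isph (\<lambda>x. (x \<bullet> x) * lapl (rad u) x * rad v x)"
    by (rule Isph_cong) (simp add: lapl_rad[OF u])
  also have "\<dots> = Isph (\<lambda>x. rad u x * ((x \<bullet> x) * lapl (rad v) x))"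
    by (rule Isph_green[OF C(1) hom0_rad C(2) hom0_rad])
  also have "\<dots> = Isph (\<lambda>x. - sph_eig CARD('n) d * (rad u x * rad v x))"
    by (rule Isph_cong) (simp add: lapl_rad[OF v])
  also have "\<dots> = - sph_eig CARD('n) d * sph_ip u v" by (simp only: sph_ip_def Isph_cmult)
  finally have "(sph_eig CARD('n) e - sph_eig CARD('n) d) * sph_ip u v = 0" by (simp add: algebra_simps)
  moreover have "sph_eig CARD('n) e \<noteq> sph_eig CARD('n) d"
    using strict_mono_eq[OF sph_eig_strict_mono[OF n]] ne by simp
  ultimately show ?thesis by simp
qed

lemma sph_ip_onb:
  fixes u v :: "real^'n \<Rightarrow> real"
  assumes "CARD('n) \<ge> 3" "u \<in> onb e" "v \<in> onb d"
  shows "sph_ip u v = (if e = d \<and> u = v then 1 else 0)"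
  using assms sph_ip_Harm_orthogonal[of u e v d] sph_onb_onb[of e] onb_Harm[of e] onb_Harm[of d]
  by (auto simp: sph_onb_def split: if_splits)

section \<open>The radial equation\<close>

text \<open>Terms of the iterated-integral series for \<open>a' = A p\<close>,
  \<open>p' = B a\<close> with \<open>a l = u\<close>, \<open>p l = v\<close>. Integrations against
  \<open>A\<close> and \<open>B\<close> alternate; exchanging \<open>A\<close> with \<open>B\<close>
  and \<open>u\<close> with \<open>v\<close> turns the series of \<open>a\<close> into that of
  \<open>p\<close>.\<close>

primrec picard :: "nat \<Rightarrow> (real \<Rightarrow> real) \<Rightarrow> (real \<Rightarrow> real) \<Rightarrow> real \<Rightarrow> real \<Rightarrow> real \<Rightarrow> real \<Rightarrow> real" where
  "picard 0 A B l u v = (\<lambda>t. u)"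
| "picard (Suc k) A B l u v = (\<lambda>t. integral {l..t} (\<lambda>s. A s * picard k B A l v u s))"

text \<open>The weight \<open>exp (2 K (t - l))\<close> gains a factor 1/2 with each integration
  against a coefficient bounded by \<open>K\<close>. The series is therefore geometric on the whole
  interval, whatever its length. The recursion exchanges the coefficients, hence the generalisation
  over \<open>A B u v\<close>.\<close>

lemma picard_bound:
  assumes "continuous_on {l..m} A" "continuous_on {l..m} B" "K > 0"
    "\<And>t. t \<in> {l..m} \<Longrightarrow> \<bar>A t\<bar> \<le> K" "\<And>t. t \<in> {l..m} \<Longrightarrow> \<bar>B t\<bar> \<le> K" "\<bar>u\<bar> \<le> c" "\<bar>v\<bar> \<le> c"
  shows "continuous_on {l..m} (picard k A B l u v) \<and>
    (\<forall>t\<in>{l..m}. \<bar>picard k A B l u v t\<bar> \<le> c * (1/2) ^ k * exp (2 * K * (t - l)))"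
  using assms
proof (induction k arbitrary: A B u v)
  case 0
  have "\<bar>u\<bar> \<le> c * exp (2 * K * (t - l))" if "t \<in> {l..m}" for t
  proof -
    have "c * 1 \<le> c * exp (2 * K * (t - l))" using 0 that by (intro mult_left_mono) auto
    then show ?thesis using 0(6) by simp
  qed
  then show ?case by simp
next
  case (Suc k)
  let ?f = "\<lambda>s. A s * picard k B A l v u s"
  have IH: "continuous_on {l..m} (picard k B A l v u)"
    "\<And>t. t \<in> {l..m} \<Longrightarrow> \<bar>picard k B A l v u t\<bar> \<le> c * (1/2) ^ k * exp (2 * K * (t - l))"
    using Suc.IH[of B A v u] Suc.prems by auto
  have cf: "continuous_on {l..m} ?f" by (intro continuous_intros Suc IH)
  have "\<bar>integral {l..t} ?f\<bar> \<le> c * (1/2) ^ Suc k * exp (2 * K * (t - l))" if t: "t \<in> {l..m}" for t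
  proof -
    let ?g = "\<lambda>s. K * (c * (1/2) ^ k * exp (2 * K * (s - l)))" and ?G = "\<lambda>s. c * (1/2) ^ Suc k * exp (2 * K * (s - l))"
    have G: "(?g has_integral (?G t - ?G l)) {l..t}"
    proof (rule fundamental_theorem_of_calculus)
      fix s assume "s \<in> {l..t}"
      show "(?G has_vector_derivative ?g s) (at s within {l..t})"
        unfolding has_real_derivative_iff_has_vector_derivative[symmetric]
        by (auto intro!: derivative_eq_intros)
    qed (use t in auto)
    have "norm (integral {l..t} ?f) \<le> integral {l..t} ?g"
    proof (rule integral_norm_bound_integral)
      show "?f integrable_on {l..t}"
        by (rule integrable_continuous_real) (rule continuous_on_subset[OF cf], use t in auto)
      show "?g integrable_on {l..t}" using G by blast
      show "norm (?f s) \<le> ?g s" if "s \<in> {l..t}" for s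
        using that t Suc.prems IH(2)[of s] by (auto simp: abs_mult intro!: mult_mono)
    qed
    moreover have "?G l \<ge> 0" using Suc.prems by auto
    ultimately show ?thesis using integral_unique[OF G] by simp
  qed
  moreover have "continuous_on {l..m} (\<lambda>t. integral {l..t} ?f)"
    by (rule indefinite_integral_continuous_1) (rule integrable_continuous_real[OF cf])
  ultimately show ?case by simp
qed

text \<open>The geometric bound permits termwise differentiation, and the derivative of term
  \<open>k + 1\<close> is \<open>A\<close> times term \<open>k\<close> of the exchanged
  series.\<close>

lemma picard_sum_deriv:
  assumes "continuous_on {l..m} A" "continuous_on {l..m} B" "l \<le> m"
  shows "t \<in> {l..m} \<Longrightarrow> ((\<lambda>t. \<Sum>k. picard k A B l u v t) has_real_derivative A t * (\<Sum>k. picard k B A l v u t)) (at t within {l..m})"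
    and "(\<Sum>k. picard k A B l u v l) = u"
proof -
  have bd: "bounded (A ` {l..m})" "bounded (B ` {l..m})"
    using assms by (auto intro!: compact_imp_bounded compact_continuous_image)
  obtain K1 where K1: "\<And>t. t \<in> {l..m} \<Longrightarrow> \<bar>A t\<bar> \<le> K1" using bd(1) unfolding bounded_iff by fastforce
  obtain K2 where K2: "\<And>t. t \<in> {l..m} \<Longrightarrow> \<bar>B t\<bar> \<le> K2" using bd(2) unfolding bounded_iff by fastforce
  define K where "K = \<bar>K1\<bar> + \<bar>K2\<bar> + 1"
  have K: "K > 0" "\<And>t. t \<in> {l..m} \<Longrightarrow> \<bar>A t\<bar> \<le> K" "\<And>t. t \<in> {l..m} \<Longrightarrow> \<bar>B t\<bar> \<le> K"
    unfolding K_def using K1 K2 by force+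
  define c where "c = \<bar>u\<bar> + \<bar>v\<bar>"
  define C where "C = c * exp (2 * K * (m - l))"
  have bnd: "\<bar>picard k A' B' l u' v' t\<bar> \<le> C * (1/2) ^ k" "continuous_on {l..m} (picard k A' B' l u' v')"
    if "t \<in> {l..m}" "(A', B', u', v') \<in> {(A, B, u, v), (B, A, v, u)}" for k t A' B' u' v'
  proof -
    have p: "continuous_on {l..m} (picard k A' B' l u' v') \<and>
      (\<forall>t\<in>{l..m}. \<bar>picard k A' B' l u' v' t\<bar> \<le> c * (1/2) ^ k * exp (2 * K * (t - l)))"
      by (rule picard_bound) (use that K assms in \<open>auto simp: c_def\<close>)
    have "\<bar>picard k A' B' l u' v' t\<bar> \<le> c * (1/2) ^ k * exp (2 * K * (t - l))" using p that by blast
    also have "\<dots> \<le> c * (1/2) ^ k * exp (2 * K * (m - l))"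
      using that K by (intro mult_left_mono) (auto simp: c_def)
    finally show "\<bar>picard k A' B' l u' v' t\<bar> \<le> C * (1/2) ^ k" by (simp add: C_def mult_ac)
    show "continuous_on {l..m} (picard k A' B' l u' v')" using p by blast
  qed
  define f' where "f' k t = (case k of 0 \<Rightarrow> 0 | Suc j \<Rightarrow> A t * picard j B A l v u t)" for k t
  have deriv: "(picard k A B l u v has_real_derivative f' k t) (at t within {l..m})" if t: "t \<in> {l..m}" for k t
  proof (cases k)
    case 0 then show ?thesis by (simp add: f'_def)
  next
    case (Suc j)
    have "continuous_on {l..m} (\<lambda>s. A s * picard j B A l v u s)" by (intro continuous_intros assms bnd[OF t]) simp
    from integral_has_real_derivative[OF this t] show ?thesis by (simp add: Suc f'_def)
  qed
  have sm: "summable (\<lambda>k. picard k A' B' l u' v' t)"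
    if "t \<in> {l..m}" "(A', B', u', v') \<in> {(A, B, u, v), (B, A, v, u)}" for t A' B' u' v'
    by (rule summable_comparison_test'[of "\<lambda>k. C * (1/2) ^ k" 0]) (use bnd[OF that] in \<open>auto intro!: summable_mult summable_geometric\<close>)
  have f's: "(\<Sum>k. f' k t) = A t * (\<Sum>k. picard k B A l v u t)" if "t \<in> {l..m}" for t
  proof -
    have "(\<lambda>k. f' (Suc k) t) sums (A t * (\<Sum>k. picard k B A l v u t))"
      unfolding f'_def by (auto intro!: sums_mult summable_sums sm that)
    then have "(\<lambda>k. f' k t) sums (A t * (\<Sum>k. picard k B A l v u t) + f' 0 t)" by (rule sums_Suc)
    then show ?thesis by (simp add: sums_iff f'_def)
  qed
  have "uniform_limit {l..m} (\<lambda>n x. \<Sum>i<n. f' i x) (\<lambda>x. \<Sum>i. f' i x) sequentially"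
  proof (rule Weierstrass_m_test)
    show "summable (\<lambda>k. 2 * K * C * (1/2) ^ k)" by (auto intro!: summable_mult summable_geometric)
    have C0: "C \<ge> 0" by (simp add: C_def c_def)
    fix k t assume t: "t \<in> {l..m}"
    show "norm (f' k t) \<le> 2 * K * C * (1/2) ^ k"
    proof (cases k)
      case (Suc j)
      have "\<bar>A t\<bar> * \<bar>picard j B A l v u t\<bar> \<le> K * (C * (1/2) ^ j)" using K t bnd(1)[OF t] by (intro mult_mono) auto
      then show ?thesis by (simp add: Suc f'_def abs_mult)
    qed (use K C0 in \<open>simp add: f'_def\<close>)
  qed
  note unif = this
  have lm: "l \<in> {l..m}" using assms(3) by simp
  have sl: "summable (\<lambda>k. picard k A B l u v l)" by (rule sm[OF lm]) simp
  obtain g where g: "\<And>x. x \<in> {l..m} \<Longrightarrow> (\<lambda>k. picard k A B l u v x) sums g x"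
    "\<And>x. x \<in> {l..m} \<Longrightarrow> (g has_real_derivative (\<Sum>i. f' i x)) (at x within {l..m})"
    using has_field_derivative_series[OF convex_real_interval(5) deriv unif lm sl] by blast
  show "((\<lambda>t. \<Sum>k. picard k A B l u v t) has_real_derivative A t * (\<Sum>k. picard k B A l v u t)) (at t within {l..m})"
    if t: "t \<in> {l..m}"
    unfolding f's[OF t, symmetric]
    by (rule has_field_derivative_transform_within[OF g(2)[OF t] zero_less_one t]) (use g(1) in \<open>auto simp: sums_iff\<close>)
  have "picard k A B l u v l = (if k = 0 then u else 0)" for k by (cases k) auto
  then show "(\<Sum>k. picard k A B l u v l) = u" using sums_unique[OF sums_single[of 0 "\<lambda>_. u"]] by simp
qed

text \<open>The system \<open>a' = A p\<close>, \<open>p' = B a\<close>. For \<open>A = h\<^sup>-\<^sup>\<nu>\<close> and \<open>B = \<lambda> h\<^sup>\<nu>\<^sup>-\<^sup>2\<close> it is the radial equation of a spherical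
  mode, and \<open>p = h\<^sup>\<nu> a'\<close>.\<close>

definition ode :: "(real \<Rightarrow> real) \<Rightarrow> (real \<Rightarrow> real) \<Rightarrow> real \<Rightarrow> real \<Rightarrow> (real \<Rightarrow> real) \<Rightarrow> (real \<Rightarrow> real) \<Rightarrow> bool" where
  "ode A B l m a p \<longleftrightarrow> continuous_on {l..m} a \<and> continuous_on {l..m} p \<and>
     (\<forall>r\<in>{l<..<m}. (a has_real_derivative A r * p r) (at r) \<and> (p has_real_derivative B r * a r) (at r))"

lemma odeD:
  assumes "ode A B l m a p"
  shows "continuous_on {l..m} a" "continuous_on {l..m} p"
    "l < r \<Longrightarrow> r < m \<Longrightarrow> (a has_real_derivative A r * p r) (at r)" "l < r \<Longrightarrow> r < m \<Longrightarrow> (p has_real_derivative B r * a r) (at r)"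
  using assms unfolding ode_def by (blast, blast, metis greaterThanLessThan_iff, metis greaterThanLessThan_iff)

lemma ode_exists_left:
  assumes "continuous_on {l..m} A" "continuous_on {l..m} B" "l \<le> m"
  shows "\<exists>a p. ode A B l m a p \<and> a l = u \<and> p l = v"
proof -
  define a where "a t = (\<Sum>k. picard k A B l u v t)" for t
  define p where "p t = (\<Sum>k. picard k B A l v u t)" for t
  have d: "(a has_real_derivative A t * p t) (at t within {l..m})" "(p has_real_derivative B t * a t) (at t within {l..m})"
    if "t \<in> {l..m}" for t
    using picard_sum_deriv(1)[OF assms that] picard_sum_deriv(1)[OF assms(2,1,3) that] unfolding a_def[abs_def] p_def[abs_def] by blast+
  have "(a has_real_derivative A t * p t) (at t)" "(p has_real_derivative B t * a t) (at t)" if "t \<in> {l<..<m}" for t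
    using d[of t] at_within_interior[of t "{l..m}"] that by auto
  moreover have "continuous_on {l..m} a" "continuous_on {l..m} p"
    by (rule DERIV_continuous_on, erule d)+
  moreover have "a l = u" "p l = v" using picard_sum_deriv(2) assms by (auto simp: a_def p_def)
  ultimately show ?thesis unfolding ode_def by blast
qed

lemma ode_combine:
  assumes 1: "ode A B l m a1 p1" and 2: "ode A B l m a2 p2"
  shows "ode A B l m (\<lambda>r. c * a1 r + d * a2 r) (\<lambda>r. c * p1 r + d * p2 r)"
  unfolding ode_def
proof (intro conjI ballI)
  fix r assume "r \<in> {l<..<m}"
  then have r: "l < r" "r < m" by auto
  note D = odeD(3,4)[OF 1 r] odeD(3,4)[OF 2 r]
  show "((\<lambda>r. c * a1 r + d * a2 r) has_real_derivative A r * (c * p1 r + d * p2 r)) (at r)"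
    by (rule DERIV_cong[OF DERIV_add[OF DERIV_cmult[OF D(1)] DERIV_cmult[OF D(3)]]]) (simp add: algebra_simps)
  show "((\<lambda>r. c * p1 r + d * p2 r) has_real_derivative B r * (c * a1 r + d * a2 r)) (at r)"
    by (rule DERIV_cong[OF DERIV_add[OF DERIV_cmult[OF D(2)] DERIV_cmult[OF D(4)]]]) (simp add: algebra_simps)
qed (intro continuous_intros odeD(1,2)[OF 1] odeD(1,2)[OF 2])+

lemma ode_subset:
  assumes "ode A B l m a p" "l \<le> l'" "m' \<le> m" shows "ode A B l' m' a p"
proof -
  have "{l'..m'} \<subseteq> {l..m}" "{l'<..<m'} \<subseteq> {l<..<m}" using assms by auto
  then show ?thesis using assms(1) unfolding ode_def by (meson continuous_on_subset subsetD)
qed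

lemma ode_cong:
  assumes "ode A B l m a p" "\<And>r. l < r \<Longrightarrow> r < m \<Longrightarrow> A r = A' r" "\<And>r. l < r \<Longrightarrow> r < m \<Longrightarrow> B r = B' r"
  shows "ode A' B' l m a p"
  using assms unfolding ode_def by (metis greaterThanLessThan_iff)

text \<open>\<open>p\<close> is a weighted derivative of \<open>a\<close>, so it changes sign under
  reflection.\<close>

lemma ode_reflect:
  assumes "ode A B l m a p"
  shows "ode (\<lambda>r. A (c - r)) (\<lambda>r. B (c - r)) (c - m) (c - l) (\<lambda>r. a (c - r)) (\<lambda>r. - p (c - r))"
proof -
  have "((\<lambda>r. f (c - r)) has_real_derivative - D) (at r)" if "(f has_real_derivative D) (at (c - r))" for f :: "real \<Rightarrow> real" and D r
  proof -
    have "((\<lambda>r. c - r) has_real_derivative - 1) (at r)" by (auto intro!: derivative_eq_intros)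
    from DERIV_chain2[where f = f and g = "\<lambda>r. c - r", OF that this] show ?thesis by simp
  qed
  note d = this
  have c: "continuous_on {c - m..c - l} (\<lambda>r. f (c - r))" if "continuous_on {l..m} f" for f :: "real \<Rightarrow> real"
    by (rule continuous_on_compose2[OF that]) (auto intro!: continuous_intros)
  show ?thesis unfolding ode_def
  proof (intro conjI ballI)
    fix r assume "r \<in> {c - m<..<c - l}"
    then have "c - r \<in> {l<..<m}" by auto
    then have "(a has_real_derivative A (c - r) * p (c - r)) (at (c - r))" "(p has_real_derivative B (c - r) * a (c - r)) (at (c - r))"
      using assms unfolding ode_def by blast+
    from d[OF this(1)] DERIV_minus[OF d[OF this(2)]]
    show "((\<lambda>r. a (c - r)) has_real_derivative A (c - r) * - p (c - r)) (at r)"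
      "((\<lambda>r. - p (c - r)) has_real_derivative B (c - r) * a (c - r)) (at r)" by simp_all
  qed (use assms c in \<open>auto simp: ode_def intro!: continuous_on_minus\<close>)
qed

text \<open>The derivative of the Wronskian is zero. It later yields both the solvability for data
  at any point and the symmetry of the Dirichlet-to-Neumann matrix.\<close>

lemma ode_wronskian:
  assumes "ode A B l m a1 p1" "ode A B l m a2 p2" "r \<in> {l..m}" "s \<in> {l..m}"
  shows "a1 r * p2 r - a2 r * p1 r = a1 s * p2 s - a2 s * p1 s"
proof -
  let ?w = "\<lambda>r. a1 r * p2 r - a2 r * p1 r"
  have "?w r = ?w l" if "r \<in> {l..m}" for r
  proof (cases "l < r")
    case True
    show ?thesis
    proof (rule DERIV_isconst_end[OF True])
      show "continuous_on {l..r} ?w" using that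
        by (intro continuous_intros continuous_on_subset[OF odeD(1)[OF assms(1)]] continuous_on_subset[OF odeD(2)[OF assms(1)]]
          continuous_on_subset[OF odeD(1)[OF assms(2)]] continuous_on_subset[OF odeD(2)[OF assms(2)]]) auto
      show "(?w has_real_derivative 0) (at x)" if "l < x" "x < r" for x
      proof -
        have x: "l < x" "x < m" using that \<open>r \<in> {l..m}\<close> by auto
        note D = odeD(3,4)[OF assms(1) x] odeD(3,4)[OF assms(2) x]
        show ?thesis
          by (rule DERIV_cong[OF DERIV_diff[OF DERIV_mult[OF D(1,4)] DERIV_mult[OF D(3,2)]]]) (simp add: algebra_simps)
      qed
    qed
  qed (use that in simp)
  from this[OF assms(3)] this[OF assms(4)] show ?thesis by simp
qed

text \<open>Two solutions issued from the left end have Wronskian 1 at \<open>t\<close>, so Cramer's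
  rule meets any data prescribed there.\<close>

lemma ode_exists:
  assumes "continuous_on {l..m} A" "continuous_on {l..m} B" "t \<in> {l..m}"
  shows "\<exists>a p. ode A B l m a p \<and> a t = u \<and> p t = v"
proof -
  have lm: "l \<le> m" using assms by simp
  obtain a1 p1 where 1: "ode A B l m a1 p1" "a1 l = 1" "p1 l = 0" using ode_exists_left[OF assms(1,2) lm] by metis
  obtain a2 p2 where 2: "ode A B l m a2 p2" "a2 l = 0" "p2 l = 1" using ode_exists_left[OF assms(1,2) lm] by metis
  have w: "a1 t * p2 t - a2 t * p1 t = 1" using ode_wronskian[OF 1(1) 2(1) assms(3), of l] 1 2 lm by simp
  define c where "c = u * p2 t - v * a2 t"
  define d where "d = v * a1 t - u * p1 t"
  have e: "c * a1 t + d * a2 t = u * (a1 t * p2 t - a2 t * p1 t)" "c * p1 t + d * p2 t = v * (a1 t * p2 t - a2 t * p1 t)"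
    by (simp_all add: c_def d_def algebra_simps)
  show ?thesis
  proof (intro exI conjI)
    show "ode A B l m (\<lambda>r. c * a1 r + d * a2 r) (\<lambda>r. c * p1 r + d * p2 r)" by (rule ode_combine[OF 1(1) 2(1)])
    show "c * a1 t + d * a2 t = u" "c * p1 t + d * p2 t = v" unfolding e w by simp_all
  qed
qed

text \<open>Completing the square: the derivative of \<open>a\<^sub>2 p\<^sub>2 - 2 a\<^sub>2 p\<^sub>1 + a\<^sub>1 p\<^sub>1\<close> is at least
  \<open>A\<^sub>2 (p\<^sub>2 - p\<^sub>1)\<^sup>2 + B\<^sub>1 (a\<^sub>2 - a\<^sub>1)\<^sup>2\<close>. This is Dirichlet's principle with comparison of the weights.\<close>

lemma ode_energy:
  assumes 1: "ode A1 B1 l m a1 p1" and 2: "ode A2 B2 l m a2 p2" and lm: "l \<le> m"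
    and A: "\<And>r. l < r \<Longrightarrow> r < m \<Longrightarrow> 0 \<le> A2 r \<and> A2 r \<le> A1 r" and B: "\<And>r. l < r \<Longrightarrow> r < m \<Longrightarrow> 0 \<le> B1 r \<and> B1 r \<le> B2 r"
  shows "a2 l * p2 l - 2 * a2 l * p1 l + a1 l * p1 l \<le> a2 m * p2 m - 2 * a2 m * p1 m + a1 m * p1 m"
proof (rule DERIV_nonneg_imp_increasing_open[OF lm, where f = "\<lambda>r. a2 r * p2 r - 2 * a2 r * p1 r + a1 r * p1 r"])
  fix r assume r: "l < r" "r < m"
  have D: "(a1 has_real_derivative A1 r * p1 r) (at r)" "(p1 has_real_derivative B1 r * a1 r) (at r)"
    "(a2 has_real_derivative A2 r * p2 r) (at r)" "(p2 has_real_derivative B2 r * a2 r) (at r)"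
    by (rule odeD[OF 1] odeD[OF 2], rule r, rule r)+
  have d: "((\<lambda>r. a2 r * p2 r - 2 * a2 r * p1 r + a1 r * p1 r) has_real_derivative
    (A2 r * p2 r * p2 r + a2 r * (B2 r * a2 r)) - 2 * (A2 r * p2 r * p1 r + a2 r * (B1 r * a1 r))
      + (A1 r * p1 r * p1 r + a1 r * (B1 r * a1 r))) (at r)"
    by (rule DERIV_cong[OF DERIV_add[OF DERIV_diff[OF DERIV_mult[OF D(3,4)] DERIV_mult[OF DERIV_cmult[OF D(3)] D(2)]] DERIV_mult[OF D(1,2)]]])
      (simp add: algebra_simps)
  have "A2 r * (p2 r - p1 r)\<^sup>2 + (A1 r - A2 r) * (p1 r)\<^sup>2 + B1 r * (a2 r - a1 r)\<^sup>2 + (B2 r - B1 r) * (a2 r)\<^sup>2 \<ge> 0"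
    using A[OF r] B[OF r] by simp
  then have "0 \<le> (A2 r * p2 r * p2 r + a2 r * (B2 r * a2 r)) - 2 * (A2 r * p2 r * p1 r + a2 r * (B1 r * a1 r))
      + (A1 r * p1 r * p1 r + a1 r * (B1 r * a1 r))" by (simp add: power2_eq_square algebra_simps)
  with d show "\<exists>y. ((\<lambda>r. a2 r * p2 r - 2 * a2 r * p1 r + a1 r * p1 r) has_real_derivative y) (at r) \<and> 0 \<le> y"
    by blast
next
  show "continuous_on {l..m} (\<lambda>r. a2 r * p2 r - 2 * a2 r * p1 r + a1 r * p1 r)"
    by (intro continuous_intros odeD(1,2)[OF 1] odeD(1,2)[OF 2])
qed

lemma ode_zero: "ode A B l m (\<lambda>r. 0) (\<lambda>r. 0)" by (simp add: ode_def)

text \<open>Comparison with the zero solution in \<open>ode_energy\<close> shows that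
  \<open>a p\<close> increases. It is 0 at both ends, hence throughout, and its derivative
  \<open>A p^2 + B a^2\<close> then forces \<open>p = 0\<close>, so that \<open>a\<close> is
  constant.\<close>

lemma ode_dirichlet_unique:
  assumes o: "ode A B l m a p" and lm: "l < m"
    and A: "\<And>r. l < r \<Longrightarrow> r < m \<Longrightarrow> 0 < A r" and B: "\<And>r. l < r \<Longrightarrow> r < m \<Longrightarrow> 0 \<le> B r"
    and bd: "a l = 0" "a m = 0" and r: "r \<in> {l..m}"
  shows "a r = 0" "p r = 0"
proof -
  have mono: "a s * p s \<le> a t * p t" if "l \<le> s" "s \<le> t" "t \<le> m" for s t
  proof -
    have "0 * 0 - 2 * 0 * p t + a t * p t \<ge> 0 * 0 - 2 * 0 * p s + a s * p s"
      by (rule ode_energy[OF ode_subset[OF o that(1,3)] ode_zero that(2), where ?A2.0 = A and ?B2.0 = B])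
        (use A B that in \<open>simp_all add: less_imp_le\<close>)
    then show ?thesis by simp
  qed
  have z: "a s * p s = 0" if "s \<in> {l..m}" for s
    using mono[of l s] mono[of s m] that bd by auto
  have p0: "p s = 0" if s: "s \<in> {l<..<m}" for s
  proof -
    have "(a has_real_derivative A s * p s) (at s)" "(p has_real_derivative B s * a s) (at s)"
      using odeD(3,4)[OF o] s by simp_all
    from DERIV_mult[OF this]
    have d: "((\<lambda>r. a r * p r) has_real_derivative A s * p s * p s + B s * a s * a s) (at s)"
      by (simp add: algebra_simps)
    have "((\<lambda>r. 0) has_real_derivative A s * p s * p s + B s * a s * a s) (at s)"
      by (rule has_field_derivative_transform_within_open[OF d, of "{l<..<m}"]) (use s z in auto)
    then have e: "A s * p s * p s + B s * a s * a s = 0" using DERIV_unique DERIV_const by metis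
    have "A s * (p s * p s) \<ge> 0" "B s * (a s * a s) \<ge> 0" using A[of s] B[of s] s by (auto intro!: mult_nonneg_nonneg)
    moreover have "A s * (p s * p s) + B s * (a s * a s) = 0" using e by (simp only: mult.assoc)
    ultimately have "A s * (p s * p s) = 0" by linarith
    then show ?thesis using A[of s] s by simp
  qed
  have ca: "continuous_on {l..m} a" "continuous_on {l..m} p" by (rule odeD[OF o])+
  show "a r = 0"
  proof (cases "l < r")
    case True
    have "a r = a l"
    proof (rule DERIV_isconst_end[OF True])
      show "continuous_on {l..r} a" by (rule continuous_on_subset[OF ca(1)]) (use r in auto)
      show "(a has_real_derivative 0) (at x)" if "l < x" "x < r" for x
        using odeD(3)[OF o, of x] p0[of x] that r by simp
    qed
    then show ?thesis using bd by simp
  qed (use r bd in auto)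
  show "p r = 0"
    using continuous_constant_on_closure[of "{l<..<m}" p 0 r] ca p0 r lm by (simp add: closure_greaterThanLessThan)
qed

text \<open>Shooting: a solution with value 0 and \<open>p = 1\<close> at \<open>l\<close> cannot
  vanish at \<open>m\<close>, by uniqueness. Boundary values are imposed at \<open>l\<close> and
  \<open>m\<close>, but the solution lives on \<open>{l'..m'}\<close>, so that eigenfunctions can be
  continued past the boundary of the cylinder.\<close>

lemma ode_bvp:
  assumes A: "\<And>r. r \<in> {l..m} \<Longrightarrow> 0 < A r" and B: "\<And>r. r \<in> {l..m} \<Longrightarrow> 0 \<le> B r"
    and c: "continuous_on {l'..m'} A" "continuous_on {l'..m'} B" and lm: "l' \<le> l" "l < m" "m \<le> m'"
  shows "\<exists>a p. ode A B l' m' a p \<and> a l = u \<and> a m = v"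
proof -
  have t: "l \<in> {l'..m'}" using lm by simp
  obtain a1 p1 where 1: "ode A B l' m' a1 p1" "a1 l = 1" "p1 l = 0" using ode_exists[OF c t] by metis
  obtain a2 p2 where 2: "ode A B l' m' a2 p2" "a2 l = 0" "p2 l = 1" using ode_exists[OF c t] by metis
  have nz: "a2 m \<noteq> 0"
  proof
    assume z: "a2 m = 0"
    have "p2 l = 0"
      by (rule ode_dirichlet_unique(2)[OF ode_subset[OF 2(1) lm(1,3)] lm(2)])
        (simp_all add: A B z 2 lm less_imp_le)
    then show False using 2 by simp
  qed
  show ?thesis using ode_combine[OF 1(1) 2(1), of u "(v - u * a1 m) / a2 m"] 1 2 nz
    by (intro exI[of _ "\<lambda>r. u * a1 r + (v - u * a1 m) / a2 m * a2 r"]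
      exI[of _ "\<lambda>r. u * p1 r + (v - u * a1 m) / a2 m * p2 r"]) simp
qed

text \<open>\<open>(c, s)\<close> is a unit eigenvector for the larger eigenvalue
  \<open>(m11 + m22) / 2 + R\<close>, and \<open>(- s, c)\<close> one for the smaller. After
  subtracting half the trace, \<open>(m12, R - d)\<close> is an eigenvector for \<open>R\<close>;
  diagonal matrices are separate because there this vector may be zero.\<close>

lemma symmetric_2x2_diagonalization:
  fixes m11 m12 m22 :: real
  shows "\<exists>c s. c\<^sup>2 + s\<^sup>2 = 1 \<and> (m22 - m11) * c * s + m12 * (c\<^sup>2 - s\<^sup>2) = 0
    \<and> m11 * s\<^sup>2 - 2 * m12 * c * s + m22 * c\<^sup>2 \<le> m11 * c\<^sup>2 + 2 * m12 * c * s + m22 * s\<^sup>2"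
proof (cases "m12 = 0")
  case True
  show ?thesis
  proof (cases "m22 \<le> m11")
    case le: True
    show ?thesis by (rule exI[of _ 1], rule exI[of _ 0]) (simp only: True le power_one mult_zero_right mult_zero_left, simp add: le)
  next
    case False
    show ?thesis by (rule exI[of _ 0], rule exI[of _ 1]) (use False in \<open>simp add: True\<close>)
  qed
next
  case False
  define d where "d = (m11 - m22) / 2"
  define R where "R = sqrt (d\<^sup>2 + m12\<^sup>2)"
  have R: "R \<ge> 0" "R\<^sup>2 = d\<^sup>2 + m12\<^sup>2" by (auto simp: R_def)
  define k where "k = m12\<^sup>2 + (R - d)\<^sup>2"
  have k: "k > 0" using False unfolding k_def by (simp add: add_pos_nonneg)
  define c where "c = m12 / sqrt k"
  define s where "s = (R - d) / sqrt k"
  have cs: "k * c\<^sup>2 = m12\<^sup>2" "k * s\<^sup>2 = (R - d)\<^sup>2" "k * (c * s) = m12 * (R - d)"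
    using k by (simp_all add: c_def s_def power_divide)
  have "k * (c\<^sup>2 + s\<^sup>2) = k * 1" by (simp only: distrib_left cs k_def[symmetric] mult_1_right)
  then have "c\<^sup>2 + s\<^sup>2 = 1" using k by simp
  moreover have "- 2 * d * (c * s) + m12 * (c\<^sup>2 - s\<^sup>2) = 0"
  proof -
    have "k * (- 2 * d * (c * s) + m12 * (c\<^sup>2 - s\<^sup>2)) = - 2 * d * (k * (c * s)) + m12 * (k * c\<^sup>2 - k * s\<^sup>2)"
      by (simp add: algebra_simps)
    also have "\<dots> = m12 * (d\<^sup>2 + m12\<^sup>2 - R\<^sup>2)" unfolding cs by (simp add: power2_eq_square algebra_simps)
    finally show ?thesis using k by (simp add: R(2))
  qed
  moreover have "d * (c\<^sup>2 - s\<^sup>2) + 2 * m12 * (c * s) \<ge> 0"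
  proof -
    have "k * (d * (c\<^sup>2 - s\<^sup>2) + 2 * m12 * (c * s)) = d * (k * c\<^sup>2 - k * s\<^sup>2) + 2 * m12 * (k * (c * s))"
      by (simp add: algebra_simps)
    also have "\<dots> = R * k + (R - d) * (m12\<^sup>2 + d\<^sup>2 - R\<^sup>2)"
      unfolding cs by (simp add: k_def power2_eq_square algebra_simps)
    also have "\<dots> = k * R" using R(2) by simp
    finally have "d * (c\<^sup>2 - s\<^sup>2) + 2 * m12 * (c * s) = R" by (rule mult_left_cancel[THEN iffD1, rotated]) (use k in simp)
    then show ?thesis using R by simp
  qed
  ultimately have "c\<^sup>2 + s\<^sup>2 = 1" "(m22 - m11) * c * s + m12 * (c\<^sup>2 - s\<^sup>2) = 0"
    "m11 * s\<^sup>2 - 2 * m12 * c * s + m22 * c\<^sup>2 \<le> m11 * c\<^sup>2 + 2 * m12 * c * s + m22 * s\<^sup>2"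
    unfolding d_def by (simp_all only: left_diff_distrib right_diff_distrib mult.assoc) (simp_all add: field_simps)
  then show ?thesis by blast
qed

section \<open>The tent profile\<close>

definition mode_A :: "nat \<Rightarrow> (real \<Rightarrow> real) \<Rightarrow> real \<Rightarrow> real" where
  "mode_A n h r = 1 / h r ^ (n - 1)"

definition mode_B :: "nat \<Rightarrow> nat \<Rightarrow> (real \<Rightarrow> real) \<Rightarrow> real \<Rightarrow> real" where
  "mode_B n e h r = sph_eig n e * h r ^ (n - 3)"

lemma sph_eig_nonneg: "n \<ge> 3 \<Longrightarrow> sph_eig n e \<ge> 0"
  by (simp add: sph_eig_def)

text \<open>The profile \<open>tent L\<close> is the largest 1-Lipschitz one, but it is not smooth.\<close>

definition tent :: "real \<Rightarrow> real \<Rightarrow> real" where "tent L r = 1 + min r (L - r)"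

text \<open>The quotient at \<open>r = L / 2\<close> of the two power solutions
  \<open>(1 + r) ^ e\<close> and \<open>1 / (1 + r) ^ (e + n - 2)\<close>, both equal to 1 at the
  boundary. The tent eigenvalues are fractional linear in it.\<close>

definition growth :: "nat \<Rightarrow> nat \<Rightarrow> real \<Rightarrow> real" where
  "growth n e L = (1 + L / 2) ^ (2 * e + n - 2)"

text \<open>The Dirichlet-to-Neumann eigenvalues of \<open>tent L\<close> in degree \<open>e\<close>: \<open>tent_N\<close> belongs to the even radial function (Neumann
  condition at \<open>L / 2\<close>), \<open>tent_D\<close> to the odd one.\<close>

definition tent_N :: "nat \<Rightarrow> nat \<Rightarrow> real \<Rightarrow> real" where
  "tent_N n e L = real e * (real e + real n - 2) * (growth n e L - 1) / (real e + real n - 2 + real e * growth n e L)"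

definition tent_D :: "nat \<Rightarrow> nat \<Rightarrow> real \<Rightarrow> real" where
  "tent_D n e L = (real e + (real e + real n - 2) * growth n e L) / (growth n e L - 1)"

lemma growth_gt_1: "n \<ge> 3 \<Longrightarrow> L > 0 \<Longrightarrow> growth n e L > 1"
  unfolding growth_def by (rule one_less_power) auto

text \<open>With profile \<open>1 + r\<close> the metric is Euclidean, in polar coordinates of
  radius \<open>1 + r\<close>. So the radial parts of the solid harmonics solve the system: the
  growing power here, the decaying one in \<open>cone_inverse_power_ode\<close>.\<close>

lemma cone_power_ode:
  fixes n e :: nat
  assumes n: "n \<ge> 3" and m: "m \<ge> 0"
  shows "ode (mode_A n (\<lambda>r. 1 + r)) (mode_B n e (\<lambda>r. 1 + r)) 0 m (\<lambda>r. (1 + r) ^ e) (\<lambda>r. real e * (1 + r) ^ (e + n - 2))"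
  unfolding ode_def
proof (intro conjI ballI)
  fix r :: real assume "r \<in> {0<..<m}"
  then have r: "1 + r > 0" by simp
  have P: "((\<lambda>r. (1 + r) ^ k) has_real_derivative real k * (1 + r) ^ (k - 1)) (at r)" for k
    by (rule DERIV_cong[OF DERIV_power[OF DERIV_add[OF DERIV_const DERIV_ident]]]) simp
  obtain d where d: "n = d + 3" using n by (metis add.commute le_iff_add)
  show "((\<lambda>r. (1 + r) ^ e) has_real_derivative mode_A n (\<lambda>r. 1 + r) r * (real e * (1 + r) ^ (e + n - 2))) (at r)"
  proof (rule DERIV_cong[OF P])
    have "(1 + r) ^ (e + n - 2) = (1 + r) ^ (e - 1) * (1 + r) ^ (n - 1)" if "e > 0"
      using that by (cases e) (simp_all add: d power_add)
    then show "real e * (1 + r) ^ (e - 1) = mode_A n (\<lambda>r. 1 + r) r * (real e * (1 + r) ^ (e + n - 2))"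
      using r by (cases "e = 0") (simp_all add: mode_A_def)
  qed
  show "((\<lambda>r. real e * (1 + r) ^ (e + n - 2)) has_real_derivative mode_B n e (\<lambda>r. 1 + r) r * (1 + r) ^ e) (at r)"
    by (rule DERIV_cong[OF DERIV_cmult[OF P]]) (simp add: mode_B_def sph_eig_def d power_add)
qed (intro continuous_intros)+

lemma cone_inverse_power_ode:
  fixes n e :: nat
  assumes n: "n \<ge> 3" and m: "m \<ge> 0"
  shows "ode (mode_A n (\<lambda>r. 1 + r)) (mode_B n e (\<lambda>r. 1 + r)) 0 m (\<lambda>r. 1 / (1 + r) ^ (e + n - 2)) (\<lambda>r. - (real e + real n - 2) * (1 / (1 + r) ^ e))"
  unfolding ode_def
proof (intro conjI ballI)
  fix r :: real assume "r \<in> {0<..<m}"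
  then have r: "1 + r > 0" by simp
  have P: "((\<lambda>r. 1 / (1 + r) ^ k) has_real_derivative - real k / (1 + r) ^ (k + 1)) (at r)" for k
  proof -
    have "((\<lambda>r. (1 + r) ^ k) has_real_derivative real k * (1 + r) ^ (k - 1)) (at r)"
      by (rule DERIV_cong[OF DERIV_power[OF DERIV_add[OF DERIV_const DERIV_ident]]]) simp
    from DERIV_inverse'[OF this] r
    have "((\<lambda>r. inverse ((1 + r) ^ k)) has_real_derivative
      - (inverse ((1 + r) ^ k) * (real k * (1 + r) ^ (k - 1)) * inverse ((1 + r) ^ k))) (at r)" by simp
    moreover have "- (inverse ((1 + r) ^ k) * (real k * (1 + r) ^ (k - 1)) * inverse ((1 + r) ^ k)) = - real k / (1 + r) ^ (k + 1)"
    proof -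
      have "- (inverse (s ^ k) * (real k * s ^ (k - 1)) * inverse (s ^ k)) = - real k / s ^ (k + 1)" if "s > 0" for s :: real
        using that by (cases k) (simp_all add: field_simps)
      from this[OF r] show ?thesis .
    qed
    ultimately show ?thesis by (simp only: inverse_eq_divide)
  qed
  obtain d where d: "n = d + 3" using n by (metis add.commute le_iff_add)
  show "((\<lambda>r. 1 / (1 + r) ^ (e + n - 2)) has_real_derivative mode_A n (\<lambda>r. 1 + r) r * (- (real e + real n - 2) * (1 / (1 + r) ^ e))) (at r)"
    by (rule DERIV_cong[OF P]) (use r in \<open>simp add: mode_A_def d power_add field_simps\<close>)
  show "((\<lambda>r. - (real e + real n - 2) * (1 / (1 + r) ^ e)) has_real_derivative mode_B n e (\<lambda>r. 1 + r) r * (1 / (1 + r) ^ (e + n - 2))) (at r)"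
  proof (rule DERIV_cong[OF DERIV_cmult[OF P]])
    have "- b * (- a / s ^ (e + 1)) = a * b * s ^ d * (1 / s ^ (e + (d + 3) - 2))" if "s > 0" for a b s :: real
      using that by (simp add: power_add field_simps)
    from this[OF r, of "real e + real n - 2" "real e"]
    show "- (real e + real n - 2) * (- real e / (1 + r) ^ (e + 1)) = mode_B n e (\<lambda>r. 1 + r) r * (1 / (1 + r) ^ (e + n - 2))"
      by (simp add: mode_B_def sph_eig_def d)
  qed
qed (intro continuous_intros; simp add: m)+

lemma cone_even:
  assumes n: "n \<ge> 3" and L: "L > 0"
  shows "\<exists>a p. ode (mode_A n (\<lambda>r. 1 + r)) (mode_B n e (\<lambda>r. 1 + r)) 0 (L / 2) a p \<and> a 0 = 1 \<and> p 0 = - tent_N n e L \<and> p (L / 2) = 0"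
proof -
  define b where "b = real e + real n - 2"
  define T where "T = growth n e L"
  define S where "S = 1 + L / 2"
  have "2 * e + n - 2 = e + (e + n - 2)" using n by simp
  then have "T = S ^ e * S ^ (e + n - 2)" by (simp only: T_def S_def growth_def power_add)
  moreover have "T > 1" unfolding T_def by (rule growth_gt_1[OF n L])
  ultimately have T: "T > 1" "T = S ^ e * S ^ (e + n - 2)" by blast+
  have b: "b > 0" using n by (simp add: b_def)
  define K where "K = b + real e * T"
  have K: "K > 0" using b T by (simp add: K_def add_pos_nonneg)
  have S: "S > 0" using L by (simp add: S_def)
  have L2: "L / 2 \<ge> 0" using L by simp
  \<comment> \<open>The condition \<open>p (L / 2) = 0\<close> makes the two weights proportional to
    \<open>b\<close> and \<open>e T\<close>; dividing by \<open>K\<close> gives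
    \<open>a 0 = 1\<close>.\<close>
  let ?a = "\<lambda>r. b / K * (1 + r) ^ e + real e * T / K * (1 / (1 + r) ^ (e + n - 2))"
  let ?p = "\<lambda>r. b / K * (real e * (1 + r) ^ (e + n - 2)) + real e * T / K * (- b * (1 / (1 + r) ^ e))"
  have "ode (mode_A n (\<lambda>r. 1 + r)) (mode_B n e (\<lambda>r. 1 + r)) 0 (L / 2) ?a ?p"
    unfolding b_def by (rule ode_combine[OF cone_power_ode[OF n L2] cone_inverse_power_ode[OF n L2]])
  moreover have "?a 0 = 1" using K by (simp add: add_divide_distrib[symmetric] K_def)
  moreover have "?p 0 = - tent_N n e L"
    unfolding tent_N_def b_def[symmetric] T_def[symmetric] K_def[symmetric] using K by (simp add: field_simps)
  moreover have "?p (L / 2) = 0"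
  proof -
    have "T * (1 / S ^ e) = S ^ (e + n - 2)" using S by (simp add: T(2))
    moreover have "?p (L / 2) = b * real e / K * (S ^ (e + n - 2) - T * (1 / S ^ e))"
    proof -
      have "b / K * (real e * x) + real e * T / K * (- b * y) = b * real e / K * (x - T * y)" for x y
        using K by (simp add: field_simps)
      then show ?thesis unfolding S_def .
    qed
    ultimately show ?thesis by simp
  qed
  ultimately show ?thesis by blast
qed

lemma cone_odd:
  assumes n: "n \<ge> 3" and L: "L > 0"
  shows "\<exists>a p. ode (mode_A n (\<lambda>r. 1 + r)) (mode_B n e (\<lambda>r. 1 + r)) 0 (L / 2) a p \<and> a 0 = 1 \<and> p 0 = - tent_D n e L \<and> a (L / 2) = 0"
proof -
  define b where "b = real e + real n - 2"
  define T where "T = growth n e L"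
  define S where "S = 1 + L / 2"
  have "2 * e + n - 2 = e + (e + n - 2)" using n by simp
  then have "T = S ^ e * S ^ (e + n - 2)" by (simp only: T_def S_def growth_def power_add)
  moreover have "T > 1" unfolding T_def by (rule growth_gt_1[OF n L])
  ultimately have T: "T > 1" "T = S ^ e * S ^ (e + n - 2)" by blast+
  have S: "S > 0" using L by (simp add: S_def)
  have L2: "L / 2 \<ge> 0" using L by simp
  \<comment> \<open>Vanishing at \<open>L / 2\<close> makes the two weights proportional to
    \<open>-1\<close> and \<open>T\<close>; \<open>k\<close> normalises \<open>a 0\<close> to
    1.\<close>
  define k where "k = 1 / (T - 1)"
  have k: "k * T - k = 1" using T(1) by (simp add: k_def diff_divide_distrib[symmetric])
  let ?a = "\<lambda>r. - k * (1 + r) ^ e + k * T * (1 / (1 + r) ^ (e + n - 2))"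
  let ?p = "\<lambda>r. - k * (real e * (1 + r) ^ (e + n - 2)) + k * T * (- b * (1 / (1 + r) ^ e))"
  have "ode (mode_A n (\<lambda>r. 1 + r)) (mode_B n e (\<lambda>r. 1 + r)) 0 (L / 2) ?a ?p"
    unfolding b_def by (rule ode_combine[OF cone_power_ode[OF n L2] cone_inverse_power_ode[OF n L2]])
  moreover have "?a 0 = 1" using k by simp
  moreover have "?p 0 = - tent_D n e L"
  proof -
    have "tent_D n e L = (real e + b * T) * k"
      unfolding tent_D_def b_def[symmetric] T_def[symmetric] k_def by simp
    then show ?thesis by (simp add: algebra_simps)
  qed
  moreover have "?a (L / 2) = 0"
  proof -
    have "T * (1 / S ^ (e + n - 2)) = S ^ e" using S by (simp add: T(2))
    then show ?thesis unfolding S_def[symmetric] by (simp only: mult.assoc)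
  qed
  ultimately show ?thesis by blast
qed

text \<open>The Dirichlet energy of the solution on the tent with boundary values \<open>u\<close>
  and \<open>v\<close>: its even part has boundary value \<open>(u + v) / 2\<close>, its odd part
  \<open>(u - v) / 2\<close>, and the two do not interact.\<close>

definition tent_form :: "nat \<Rightarrow> nat \<Rightarrow> real \<Rightarrow> real \<Rightarrow> real \<Rightarrow> real" where
  "tent_form n e L u v = (tent_N n e L * (u + v)\<^sup>2 + tent_D n e L * (u - v)\<^sup>2) / 2"

text \<open>The right half is the reflection of the left one with the odd part negated. At the
  corner \<open>a\<close> and \<open>p\<close> must match and nothing else, since the system does
  not involve the derivative of the profile.\<close>

lemma tent_solution:
  assumes n: "n \<ge> 3" and L: "L > 0"
  obtains a p a' p' where "ode (mode_A n (tent L)) (mode_B n e (tent L)) 0 (L / 2) a p"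
    "ode (mode_A n (tent L)) (mode_B n e (tent L)) (L / 2) L a' p'"
    "a (L / 2) = a' (L / 2)" "p (L / 2) = p' (L / 2)" "a 0 = u" "a' L = v" "v * p' L - u * p 0 = tent_form n e L u v"
proof -
  obtain a1 p1 where 1: "ode (mode_A n (\<lambda>r. 1 + r)) (mode_B n e (\<lambda>r. 1 + r)) 0 (L / 2) a1 p1" "a1 0 = 1" "p1 0 = - tent_N n e L" "p1 (L / 2) = 0"
    using cone_even[OF n L] by metis
  obtain a2 p2 where 2: "ode (mode_A n (\<lambda>r. 1 + r)) (mode_B n e (\<lambda>r. 1 + r)) 0 (L / 2) a2 p2" "a2 0 = 1" "p2 0 = - tent_D n e L" "a2 (L / 2) = 0"
    using cone_odd[OF n L] by metis
  define s where "s = (u + v) / 2"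
  define d where "d = (u - v) / 2"
  have left: "ode (mode_A n (tent L)) (mode_B n e (tent L)) 0 (L / 2) (\<lambda>r. s * a1 r + d * a2 r) (\<lambda>r. s * p1 r + d * p2 r)"
    by (rule ode_cong[OF ode_combine[OF 1(1) 2(1)]]) (simp_all add: mode_A_def mode_B_def tent_def min_def)
  have right: "ode (mode_A n (tent L)) (mode_B n e (tent L)) (L / 2) L
      (\<lambda>r. s * a1 (L - r) + - d * a2 (L - r)) (\<lambda>r. - (s * p1 (L - r) + - d * p2 (L - r)))"
    using ode_cong[OF ode_reflect[OF ode_combine[OF 1(1) 2(1), of s "- d"], of L], of "mode_A n (tent L)" "mode_B n e (tent L)"]
    by (simp add: mode_A_def mode_B_def tent_def min_def)
  have half: "L - L / 2 = L / 2" by simp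
  show ?thesis
  proof (rule that[OF left right])
    show "s * a1 0 + d * a2 0 = u" "s * a1 (L - L) + - d * a2 (L - L) = v"
      unfolding 1 2 diff_self s_def d_def by (simp_all add: field_simps)
    have "v * (- (s * - tent_N n e L + - d * - tent_D n e L)) - u * (s * - tent_N n e L + d * - tent_D n e L) = tent_form n e L u v"
      unfolding tent_form_def s_def d_def by (simp add: field_simps power2_eq_square)
    then show "v * (- (s * p1 (L - L) + - d * p2 (L - L))) - u * (s * p1 0 + d * p2 0) = tent_form n e L u v"
      unfolding 1 2 diff_self .
  qed (unfold half 1 2, simp_all)
qed

text \<open>Two energy inequalities are added, and the terms at \<open>m\<close> agree because
  \<open>a\<close> and \<open>p\<close> match there. At \<open>0\<close> and \<open>L\<close> the
  boundary values of the two solutions coincide, so the expression of \<open>ode_energy\<close>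
  becomes \<open>a2 p2 - a1 p1\<close>.\<close>

lemma ode_energy_piecewise:
  assumes 1: "ode A1 B1 0 m a1 p1" "ode A1 B1 m L a1' p1'" "a1 m = a1' m" "p1 m = p1' m"
    and 2: "ode A2 B2 0 m a2 p2" "ode A2 B2 m L a2' p2'" "a2 m = a2' m" "p2 m = p2' m"
    and bd: "a1 0 = a2 0" "a1' L = a2' L" and m: "0 \<le> m" "m \<le> L"
    and A: "\<And>r. 0 < r \<Longrightarrow> r < L \<Longrightarrow> 0 \<le> A2 r \<and> A2 r \<le> A1 r" and B: "\<And>r. 0 < r \<Longrightarrow> r < L \<Longrightarrow> 0 \<le> B1 r \<and> B1 r \<le> B2 r"
  shows "a1' L * p1' L - a1 0 * p1 0 \<le> a2' L * p2' L - a2 0 * p2 0"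
proof -
  have "a2 0 * p2 0 - 2 * a2 0 * p1 0 + a1 0 * p1 0 \<le> a2 m * p2 m - 2 * a2 m * p1 m + a1 m * p1 m"
    by (rule ode_energy[OF 1(1) 2(1) m(1)]) (use A B m in simp_all)
  moreover have "a2' m * p2' m - 2 * a2' m * p1' m + a1' m * p1' m \<le> a2' L * p2' L - 2 * a2' L * p1' L + a1' L * p1' L"
    by (rule ode_energy[OF 1(2) 2(2) m(2)]) (use A B m in simp_all)
  ultimately show ?thesis using bd 1(3,4) 2(3,4) by simp
qed

text \<open>A larger profile lowers \<open>mode_A\<close>, which is \<open>1 / h^(n-1)\<close>, and
  raises \<open>mode_B\<close>, which contains \<open>h^(n-3)\<close> with \<open>n \<ge> 3\<close>;
  both changes increase the energy.\<close>

lemma mode_form_le_tent: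
  assumes n: "n \<ge> 3" and L: "L > 0" and h: "\<And>r. 0 < r \<Longrightarrow> r < L \<Longrightarrow> 0 < h r \<and> h r \<le> tent L r"
    and o: "ode (mode_A n h) (mode_B n e h) 0 L a p"
  shows "a L * p L - a 0 * p 0 \<le> tent_form n e L (a 0) (a L)"
proof -
  obtain a2 p2 a2' p2' where 2: "ode (mode_A n (tent L)) (mode_B n e (tent L)) 0 (L / 2) a2 p2"
    "ode (mode_A n (tent L)) (mode_B n e (tent L)) (L / 2) L a2' p2'"
    "a2 (L / 2) = a2' (L / 2)" "p2 (L / 2) = p2' (L / 2)" "a2 0 = a 0" "a2' L = a L"
    "a L * p2' L - a 0 * p2 0 = tent_form n e L (a 0) (a L)" by (rule tent_solution[OF n L])
  have m: "0 \<le> L / 2" "L / 2 \<le> L" using L by auto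
  have "a L * p L - a 0 * p 0 \<le> a2' L * p2' L - a2 0 * p2 0"
  proof (rule ode_energy_piecewise[OF ode_subset[OF o order_refl m(2)] ode_subset[OF o m(1) order_refl] refl refl 2(1-4) 2(5,6)[symmetric] m])
    fix r assume "0 < r" "r < L"
    note hr = h[OF this]
    show "0 \<le> mode_A n (tent L) r \<and> mode_A n (tent L) r \<le> mode_A n h r"
      unfolding mode_A_def using hr by (auto intro!: divide_left_mono power_mono mult_pos_pos)
    show "0 \<le> mode_B n e h r \<and> mode_B n e h r \<le> mode_B n e (tent L) r"
      unfolding mode_B_def using hr sph_eig_nonneg[OF n] by (auto intro!: mult_left_mono power_mono)
  qed
  then show ?thesis using 2(5-7) by simp
qed

text \<open>Multiplying \<open>p\<close> by \<open>k = c ^ (n - 1)\<close> turns the tent system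
  into one with coefficients \<open>mode_A / k\<close> and \<open>k mode_B\<close>, and scales the
  energy by \<open>k\<close>. Both coefficients compare with those of \<open>h\<close>; for the
  second, \<open>c \<le> 1\<close> gives \<open>k \<le> c ^ (n - 3)\<close>.\<close>

lemma tent_le_mode_form:
  assumes n: "n \<ge> 3" and L: "L > 0" and c: "0 < c" "c \<le> 1" and h: "\<And>r. 0 < r \<Longrightarrow> r < L \<Longrightarrow> c * tent L r \<le> h r"
    and o: "ode (mode_A n h) (mode_B n e h) 0 L a p"
  shows "c ^ (n - 1) * tent_form n e L (a 0) (a L) \<le> a L * p L - a 0 * p 0"
proof -
  define k where "k = c ^ (n - 1)"
  have k: "k > 0" using c by (simp add: k_def)
  obtain a1 p1 a1' p1' where 1: "ode (mode_A n (tent L)) (mode_B n e (tent L)) 0 (L / 2) a1 p1"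
    "ode (mode_A n (tent L)) (mode_B n e (tent L)) (L / 2) L a1' p1'"
    "a1 (L / 2) = a1' (L / 2)" "p1 (L / 2) = p1' (L / 2)" "a1 0 = a 0" "a1' L = a L"
    "a L * p1' L - a 0 * p1 0 = tent_form n e L (a 0) (a L)" by (rule tent_solution[OF n L])
  have sc: "ode (\<lambda>r. mode_A n (tent L) r / k) (\<lambda>r. k * mode_B n e (tent L) r) l m a p"
    if o: "ode (mode_A n (tent L)) (mode_B n e (tent L)) l m a (\<lambda>r. p r / k)" for l m a p
    unfolding ode_def
  proof (intro conjI ballI)
    show "continuous_on {l..m} a" by (rule odeD[OF o])
    have "continuous_on {l..m} (\<lambda>r. k * (p r / k))" by (intro continuous_intros odeD[OF o])
    then show "continuous_on {l..m} p" using k by simp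
    fix r assume "r \<in> {l<..<m}"
    then have r: "l < r" "r < m" by auto
    show "(a has_real_derivative mode_A n (tent L) r / k * p r) (at r)" using odeD(3)[OF o r] by simp
    show "(p has_real_derivative k * mode_B n e (tent L) r * a r) (at r)"
      using DERIV_cmult[OF odeD(4)[OF o r], of k] k by (simp add: mult.assoc)
  qed
  have scaled: "ode (\<lambda>r. mode_A n (tent L) r / k) (\<lambda>r. k * mode_B n e (tent L) r) 0 (L / 2) a1 (\<lambda>r. k * p1 r)"
    "ode (\<lambda>r. mode_A n (tent L) r / k) (\<lambda>r. k * mode_B n e (tent L) r) (L / 2) L a1' (\<lambda>r. k * p1' r)"
    by (rule sc, use k 1(1,2) in simp)+
  have m: "0 \<le> L / 2" "L / 2 \<le> L" using L by auto
  have "a1' L * (k * p1' L) - a1 0 * (k * p1 0) \<le> a L * p L - a 0 * p 0"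
  proof (rule ode_energy_piecewise[OF scaled(1,2) 1(3) _ ode_subset[OF o order_refl m(2)] ode_subset[OF o m(1) order_refl] refl refl 1(5,6) m])
    show "k * p1 (L / 2) = k * p1' (L / 2)" using 1(4) by simp
    fix r assume r: "0 < r" "r < L"
    have t: "tent L r > 0" using r by (simp add: tent_def)
    then have ct: "0 < c * tent L r" using c by simp
    then have hr: "0 < h r" "c * tent L r \<le> h r" using h[OF r] by auto
    have "(c * tent L r) ^ (n - 1) \<le> h r ^ (n - 1)" by (rule power_mono[OF hr(2)]) (use ct in simp)
    then have le1: "k * tent L r ^ (n - 1) \<le> h r ^ (n - 1)" by (simp add: k_def power_mult_distrib)
    then have "1 / h r ^ (n - 1) \<le> 1 / (k * tent L r ^ (n - 1))"
      using hr t k by (intro divide_left_mono mult_pos_pos) auto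
    then show "0 \<le> mode_A n h r \<and> mode_A n h r \<le> mode_A n (tent L) r / k"
      unfolding mode_A_def using hr by (simp add: mult.commute)
    have "k \<le> c ^ (n - 3)" unfolding k_def using c by (intro power_decreasing) auto
    then have "k * tent L r ^ (n - 3) \<le> c ^ (n - 3) * tent L r ^ (n - 3)" using t by (intro mult_right_mono) auto
    also have "\<dots> \<le> h r ^ (n - 3)"
      unfolding power_mult_distrib[symmetric] by (rule power_mono[OF hr(2)]) (use ct in simp)
    finally have "k * tent L r ^ (n - 3) \<le> h r ^ (n - 3)" .
    then have "sph_eig n e * (k * tent L r ^ (n - 3)) \<le> sph_eig n e * h r ^ (n - 3)"
      using sph_eig_nonneg[OF n] by (intro mult_left_mono)
    then show "0 \<le> k * mode_B n e (tent L) r \<and> k * mode_B n e (tent L) r \<le> mode_B n e h r"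
      unfolding mode_B_def using sph_eig_nonneg[OF n, of e] k t by (simp add: mult_ac)
  qed
  moreover have "a1' L * (k * p1' L) - a1 0 * (k * p1 0) = k * tent_form n e L (a 0) (a L)"
    unfolding 1(7)[symmetric] 1(5,6) by (simp add: algebra_simps)
  ultimately show ?thesis by (simp add: k_def)
qed

text \<open>Raising the degree changes the system only through the larger factor
  \<open>sph_eig\<close> in \<open>mode_B\<close>.\<close>

lemma tent_form_mono:
  assumes n: "n \<ge> 3" and L: "L > 0" and e: "e \<le> d"
  shows "tent_form n e L u v \<le> tent_form n d L u v"
proof -
  obtain a1 p1 a1' p1' where 1: "ode (mode_A n (tent L)) (mode_B n e (tent L)) 0 (L / 2) a1 p1"
    "ode (mode_A n (tent L)) (mode_B n e (tent L)) (L / 2) L a1' p1'"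
    "a1 (L / 2) = a1' (L / 2)" "p1 (L / 2) = p1' (L / 2)" "a1 0 = u" "a1' L = v"
    "v * p1' L - u * p1 0 = tent_form n e L u v" by (rule tent_solution[OF n L])
  obtain a2 p2 a2' p2' where 2: "ode (mode_A n (tent L)) (mode_B n d (tent L)) 0 (L / 2) a2 p2"
    "ode (mode_A n (tent L)) (mode_B n d (tent L)) (L / 2) L a2' p2'"
    "a2 (L / 2) = a2' (L / 2)" "p2 (L / 2) = p2' (L / 2)" "a2 0 = u" "a2' L = v"
    "v * p2' L - u * p2 0 = tent_form n d L u v" by (rule tent_solution[OF n L])
  have le: "sph_eig n e \<le> sph_eig n d" using strict_mono_less_eq[OF sph_eig_strict_mono[OF n]] e by simp
  have "a1' L * p1' L - a1 0 * p1 0 \<le> a2' L * p2' L - a2 0 * p2 0"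
  proof (rule ode_energy_piecewise[OF 1(1-4) 2(1-4)])
    fix r assume "0 < r" "r < L"
    then have t: "tent L r > 0" by (simp add: tent_def)
    then show "0 \<le> mode_A n (tent L) r \<and> mode_A n (tent L) r \<le> mode_A n (tent L) r" by (simp add: mode_A_def)
    show "0 \<le> mode_B n e (tent L) r \<and> mode_B n e (tent L) r \<le> mode_B n d (tent L) r"
      using t le sph_eig_nonneg[OF n, of e] by (simp add: mode_B_def mult_right_mono)
  qed (use 1(5,6) 2(5,6) L in simp_all)
  then show ?thesis using 1(5-7) 2(5-7) by simp
qed

text \<open>Boundary values \<open>(1, 1)\<close> isolate \<open>tent_N\<close> in
  \<open>tent_form\<close>; in the next lemma \<open>(1, -1)\<close> isolate
  \<open>tent_D\<close>.\<close>

lemma tent_N_mono: "n \<ge> 3 \<Longrightarrow> L > 0 \<Longrightarrow> e \<le> d \<Longrightarrow> tent_N n e L \<le> tent_N n d L"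
  using tent_form_mono[of n L e d 1 1] by (simp add: tent_form_def)

lemma tent_D_mono: "n \<ge> 3 \<Longrightarrow> L > 0 \<Longrightarrow> e \<le> d \<Longrightarrow> tent_D n e L \<le> tent_D n d L"
  using tent_form_mono[of n L e d 1 "-1"] by (simp add: tent_form_def)

section \<open>Dirichlet-to-Neumann eigenvalues\<close>

lemma tent_N_less: assumes n: "n \<ge> 3" and L: "L > 0" shows "tent_N n e L < real e + real n - 2"
proof -
  have T: "growth n e L > 1" by (rule growth_gt_1[OF n L])
  have b: "real e + real n - 2 > 0" using n by simp
  have "real e * growth n e L \<ge> 0" using T by simp
  then have K: "real e + real n - 2 + real e * growth n e L > 0" using b by linarith
  have "(real e + real n - 2) * (real e * (growth n e L - 1)) < (real e + real n - 2) * (real e + real n - 2 + real e * growth n e L)"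
  proof (rule mult_strict_left_mono[OF _ b])
    show "real e * (growth n e L - 1) < real e + real n - 2 + real e * growth n e L"
      using b by (simp add: right_diff_distrib)
  qed
  then show ?thesis unfolding tent_N_def pos_divide_less_eq[OF K] by (simp add: mult_ac)
qed

lemma tent_D_greater: assumes n: "n \<ge> 3" and L: "L > 0" shows "real e + real n - 2 < tent_D n e L"
proof -
  have T: "growth n e L - 1 > 0" using growth_gt_1[OF n L, of e] by simp
  show ?thesis unfolding tent_D_def pos_less_divide_eq[OF T] using n by (simp add: algebra_simps)
qed

lemma tent_N_le_D: "n \<ge> 3 \<Longrightarrow> L > 0 \<Longrightarrow> tent_N n e L \<le> tent_D n e L"
  using tent_N_less[of n L e] tent_D_greater[of n L e] by simp

definition coord :: "(bool \<Rightarrow> real \<times> real) \<Rightarrow> bool \<Rightarrow> real \<Rightarrow> real \<Rightarrow> real" where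
  "coord w t u v = u * fst (w t) + v * snd (w t)"

text \<open>The matrix mapping the boundary values of a solution to its outward normal derivatives has the
  eigenvalues \<open>\<mu> False \<le> \<mu> True\<close> and the orthonormal eigenvectors \<open>w\<close>.\<close>

definition dn_data :: "(real \<Rightarrow> real) \<Rightarrow> (real \<Rightarrow> real) \<Rightarrow> real \<Rightarrow> (bool \<Rightarrow> real) \<Rightarrow> (bool \<Rightarrow> real \<times> real) \<Rightarrow> bool" where
  "dn_data A B L \<mu> w \<longleftrightarrow> \<mu> False \<le> \<mu> True \<and> (fst (w True))\<^sup>2 + (snd (w True))\<^sup>2 = 1
     \<and> w False = (- snd (w True), fst (w True))
     \<and> (\<forall>a p. ode A B 0 L a p \<longrightarrow> (\<forall>t. coord w t (- p 0) (p L) = \<mu> t * coord w t (a 0) (a L)))"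

lemma dn_dataD:
  assumes "dn_data A B L \<mu> w"
  shows "\<mu> False \<le> \<mu> True" "(fst (w True))\<^sup>2 + (snd (w True))\<^sup>2 = 1" "w False = (- snd (w True), fst (w True))"
    "ode A B 0 L a p \<Longrightarrow> coord w t (- p 0) (p L) = \<mu> t * coord w t (a 0) (a L)"
  using assms unfolding dn_data_def by blast+

lemma coord_w:
  assumes "dn_data A B L \<mu> w" shows "coord w s (fst (w t)) (snd (w t)) = (if s = t then 1 else 0)"
  using dn_dataD(2,3)[OF assms] by (cases s; cases t) (auto simp: coord_def power2_eq_square)

lemma coord_inner:
  assumes "dn_data A B L \<mu> w"
  shows "coord w True u v * coord w True x y + coord w False u v * coord w False x y = u * x + v * y"
proof -
  obtain c s where w: "w True = (c, s)" by (cases "w True")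
  have "(u * c + v * s) * (x * c + y * s) + (v * c - u * s) * (y * c - x * s) = (c\<^sup>2 + s\<^sup>2) * (u * x + v * y)"
    by (simp add: power2_eq_square algebra_simps)
  then show ?thesis using dn_dataD(2,3)[OF assms] w by (simp add: coord_def)
qed

lemma coord_inject:
  assumes "dn_data A B L \<mu> w" "\<And>t. coord w t u v = coord w t x y" shows "u = x" "v = y"
proof -
  have z: "coord w t (u - x) (v - y) = 0" for t using assms(2)[of t] by (simp add: coord_def algebra_simps)
  have "(u - x) * (u - x) + (v - y) * (v - y) = 0"
    using coord_inner[OF assms(1), of "u - x" "v - y" "u - x" "v - y"] by (simp add: z)
  then show "u = x" "v = y" by (simp_all add: sum_squares_eq_zero_iff)
qed

lemma dn_data_form:
  assumes "dn_data A B L \<mu> w" "ode A B 0 L a p"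
  shows "a L * p L - a 0 * p 0 = \<mu> True * (coord w True (a 0) (a L))\<^sup>2 + \<mu> False * (coord w False (a 0) (a L))\<^sup>2"
  using coord_inner[OF assms(1), of "a 0" "a L" "- p 0" "p L"] unfolding dn_dataD(4)[OF assms]
  by (simp add: power2_eq_square mult_ac)

text \<open>In terms of the solutions with boundary values \<open>(1, 0)\<close> and
  \<open>(0, 1)\<close>, the map from boundary values to outward derivatives is a matrix, symmetric
  by the Wronskian. Dirichlet uniqueness extends it to all solutions, and its diagonalization gives
  \<open>w\<close> and \<open>\<mu>\<close>.\<close>

lemma dn_data_exists:
  assumes L: "L > 0" and A: "\<And>r. r \<in> {0..L} \<Longrightarrow> 0 < A r" "continuous_on {0..L} A"
    and B: "\<And>r. r \<in> {0..L} \<Longrightarrow> 0 \<le> B r" "continuous_on {0..L} B"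
  shows "\<exists>\<mu> w. dn_data A B L \<mu> w"
proof -
  obtain a1 p1 where 1: "ode A B 0 L a1 p1" "a1 0 = 1" "a1 L = 0"
    using ode_bvp[OF A(1) B(1) A(2) B(2) order_refl L order_refl, of 1 0] by metis
  obtain a2 p2 where 2: "ode A B 0 L a2 p2" "a2 0 = 0" "a2 L = 1"
    using ode_bvp[OF A(1) B(1) A(2) B(2) order_refl L order_refl, of 0 1] by metis
  have sym: "p1 L = - p2 0" using ode_wronskian[OF 1(1) 2(1), of 0 L] L by (simp add: 1(2,3) 2(2,3))
  define m11 m12 m22 where "m11 = - p1 0" and "m12 = - p2 0" and "m22 = p2 L"
  have DN: "- p 0 = a 0 * m11 + a L * m12 \<and> p L = a 0 * m12 + a L * m22" if o: "ode A B 0 L a p" for a p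
  proof -
    note d = ode_combine[OF o ode_combine[OF 1(1) 2(1), of "a 0" "a L"], of 1 "-1"]
    have "1 * p r + - 1 * (a 0 * p1 r + a L * p2 r) = 0" if "r \<in> {0..L}" for r
      by (rule ode_dirichlet_unique(2)[OF d L _ _ _ _ that]) (simp_all add: A B 1(2,3) 2(2,3))
    from this[of 0] this[of L] show ?thesis using L sym by (simp add: m11_def m12_def m22_def algebra_simps)
  qed
  obtain c s where cs: "c\<^sup>2 + s\<^sup>2 = 1" "(m22 - m11) * c * s + m12 * (c\<^sup>2 - s\<^sup>2) = 0"
    "m11 * s\<^sup>2 - 2 * m12 * c * s + m22 * c\<^sup>2 \<le> m11 * c\<^sup>2 + 2 * m12 * c * s + m22 * s\<^sup>2"
    using symmetric_2x2_diagonalization by metis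
  define w where "w t = (if t then (c, s) else (- s, c))" for t :: bool
  define \<mu> where "\<mu> t = (if t then m11 * c\<^sup>2 + 2 * m12 * c * s + m22 * s\<^sup>2 else m11 * s\<^sup>2 - 2 * m12 * c * s + m22 * c\<^sup>2)" for t :: bool
  have T: "m11 * c + m12 * s = (m11 * c\<^sup>2 + 2 * m12 * c * s + m22 * s\<^sup>2) * c"
    "m12 * c + m22 * s = (m11 * c\<^sup>2 + 2 * m12 * c * s + m22 * s\<^sup>2) * s"
    "m12 * c - m11 * s = - ((m11 * s\<^sup>2 - 2 * m12 * c * s + m22 * c\<^sup>2) * s)"
    "m22 * c - m12 * s = (m11 * s\<^sup>2 - 2 * m12 * c * s + m22 * c\<^sup>2) * c"
    using cs(1,2) by algebra+
  have "coord w t (- p 0) (p L) = \<mu> t * coord w t (a 0) (a L)" if o: "ode A B 0 L a p" for a p t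
  proof -
    note d = DN[OF o]
    have "coord w True (- p 0) (p L) = a 0 * (m11 * c + m12 * s) + a L * (m12 * c + m22 * s)"
      using d by (simp add: coord_def w_def algebra_simps)
    also have "\<dots> = \<mu> True * coord w True (a 0) (a L)" unfolding T by (simp add: coord_def w_def \<mu>_def algebra_simps)
    finally have 1: "coord w True (- p 0) (p L) = \<mu> True * coord w True (a 0) (a L)" .
    have "coord w False (- p 0) (p L) = a 0 * (m12 * c - m11 * s) + a L * (m22 * c - m12 * s)"
      using d by (simp add: coord_def w_def algebra_simps)
    also have "\<dots> = \<mu> False * coord w False (a 0) (a L)" unfolding T by (simp add: coord_def w_def \<mu>_def algebra_simps)
    finally show ?thesis using 1 by (cases t) auto
  qed
  then have "dn_data A B L \<mu> w" using cs(1,3) by (simp add: dn_data_def w_def \<mu>_def)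
  then show ?thesis by blast
qed

definition pos_profile :: "real \<Rightarrow> (real \<Rightarrow> real) \<Rightarrow> bool" where
  "pos_profile L h \<longleftrightarrow> L > 0 \<and> continuous_on {0..L} h \<and> (\<forall>r\<in>{0..L}. h r > 0)"

text \<open>Eigenvalues and eigenvectors come from a single choice, so they belong together even
  where the eigenvectors are not determined.\<close>

definition dn_pair :: "nat \<Rightarrow> (real \<Rightarrow> real) \<Rightarrow> real \<Rightarrow> nat \<Rightarrow> (bool \<Rightarrow> real) \<times> (bool \<Rightarrow> real \<times> real)" where
  "dn_pair n h L e = (SOME x. dn_data (mode_A n h) (mode_B n e h) L (fst x) (snd x))"

definition dn_eig :: "nat \<Rightarrow> (real \<Rightarrow> real) \<Rightarrow> real \<Rightarrow> nat \<Rightarrow> bool \<Rightarrow> real" where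
  "dn_eig n h L e = fst (dn_pair n h L e)"

definition dn_vec :: "nat \<Rightarrow> (real \<Rightarrow> real) \<Rightarrow> real \<Rightarrow> nat \<Rightarrow> bool \<Rightarrow> real \<times> real" where
  "dn_vec n h L e = snd (dn_pair n h L e)"

lemma mode_coeffs:
  assumes n: "n \<ge> 3" and h: "\<And>r. r \<in> S \<Longrightarrow> h r > 0" "continuous_on S h"
  shows "\<And>r. r \<in> S \<Longrightarrow> 0 < mode_A n h r" "continuous_on S (mode_A n h)"
    "\<And>r. r \<in> S \<Longrightarrow> 0 \<le> mode_B n e h r" "continuous_on S (mode_B n e h)"
proof -
  show "0 < mode_A n h r" "0 \<le> mode_B n e h r" if "r \<in> S" for r
    using h(1)[OF that] sph_eig_nonneg[OF n] by (simp_all add: mode_A_def mode_B_def)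
  show "continuous_on S (mode_A n h)" unfolding mode_A_def[abs_def]
    by (intro continuous_intros h(2)) (metis h(1) less_irrefl power_not_zero)
  show "continuous_on S (mode_B n e h)" unfolding mode_B_def[abs_def] by (intro continuous_intros h(2))
qed

lemma pos_profile_coeffs:
  assumes n: "n \<ge> 3" and h: "pos_profile L h"
  shows "\<And>r. r \<in> {0..L} \<Longrightarrow> 0 < mode_A n h r" "continuous_on {0..L} (mode_A n h)"
    "\<And>r. r \<in> {0..L} \<Longrightarrow> 0 \<le> mode_B n e h r" "continuous_on {0..L} (mode_B n e h)"
proof -
  have "\<And>r. r \<in> {0..L} \<Longrightarrow> h r > 0" "continuous_on {0..L} h" using h by (auto simp: pos_profile_def)
  from mode_coeffs[OF n this] show "\<And>r. r \<in> {0..L} \<Longrightarrow> 0 < mode_A n h r" "continuous_on {0..L} (mode_A n h)"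
    "\<And>r. r \<in> {0..L} \<Longrightarrow> 0 \<le> mode_B n e h r" "continuous_on {0..L} (mode_B n e h)" by blast+
qed

lemma dn_data_eig:
  assumes n: "n \<ge> 3" and h: "pos_profile L h"
  shows "dn_data (mode_A n h) (mode_B n e h) L (dn_eig n h L e) (dn_vec n h L e)"
proof -
  have L: "L > 0" using h by (simp add: pos_profile_def)
  obtain \<mu> w where "dn_data (mode_A n h) (mode_B n e h) L \<mu> w"
    using dn_data_exists[OF L pos_profile_coeffs[OF n h]] by metis
  then have "dn_data (mode_A n h) (mode_B n e h) L (fst (\<mu>, w)) (snd (\<mu>, w))" by simp
  then show ?thesis unfolding dn_eig_def dn_vec_def dn_pair_def by (rule someI)
qed

definition tent_eig :: "nat \<Rightarrow> real \<Rightarrow> nat \<Rightarrow> bool \<Rightarrow> real" where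
  "tent_eig n L e t = (if t then tent_D n e L else tent_N n e L)"

lemma mode_bvp:
  assumes n: "n \<ge> 3" and h: "pos_profile L h"
  obtains a p where "ode (mode_A n h) (mode_B n e h) 0 L a p" "a 0 = u" "a L = v"
proof -
  have L: "L > 0" using h by (simp add: pos_profile_def)
  show ?thesis
    using ode_bvp[OF pos_profile_coeffs(1)[OF n h] pos_profile_coeffs(3)[OF n h] pos_profile_coeffs(2,4)[OF n h] order_refl L order_refl] that
    by metis
qed

text \<open>Comparison of the two quadratic forms on test vectors. The vector \<open>(1, 1)\<close>,
  which belongs to \<open>tent_N\<close>, tests the smaller eigenvalue; for the larger one its own
  eigenvector \<open>w True\<close> is inserted and the tent form is bounded by
  \<open>tent_D\<close>.\<close>

lemma dn_eig_le_tent: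
  assumes n: "n \<ge> 3" and h: "pos_profile L h" and le: "\<And>r. r \<in> {0..L} \<Longrightarrow> h r \<le> tent L r"
  shows "dn_eig n h L e t \<le> tent_eig n L e t"
proof -
  have L: "L > 0" using h by (simp add: pos_profile_def)
  note d = dn_data_eig[OF n h, of e]
  define \<mu> where "\<mu> = dn_eig n h L e"
  define w where "w = dn_vec n h L e"
  note d = d[folded \<mu>_def w_def]
  have form: "\<mu> True * (coord w True u v)\<^sup>2 + \<mu> False * (coord w False u v)\<^sup>2 \<le> tent_form n e L u v" for u v
  proof -
    obtain a p where o: "ode (mode_A n h) (mode_B n e h) 0 L a p" "a 0 = u" "a L = v" using mode_bvp[OF n h] by metis
    have "a L * p L - a 0 * p 0 \<le> tent_form n e L (a 0) (a L)"
      by (rule mode_form_le_tent[OF n L _ o(1)]) (use h le in \<open>simp add: pos_profile_def\<close>)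
    then show ?thesis using dn_data_form[OF d o(1)] o(2,3) by simp
  qed
  have "(\<mu> True - \<mu> False) * (coord w True 1 1)\<^sup>2 \<ge> 0" using dn_dataD(1)[OF d] by simp
  moreover have "(coord w True 1 1)\<^sup>2 + (coord w False 1 1)\<^sup>2 = 2"
    using coord_inner[OF d, of 1 1 1 1] by (simp add: power2_eq_square)
  then have "\<mu> False * (coord w True 1 1)\<^sup>2 + \<mu> False * (coord w False 1 1)\<^sup>2 = 2 * \<mu> False"
    by (metis distrib_left mult.commute)
  ultimately have N: "\<mu> False \<le> tent_N n e L"
    using form[of 1 1] by (simp add: tent_form_def left_diff_distrib)
  obtain x y where w: "w True = (x, y)" by (cases "w True")
  have xy: "x\<^sup>2 + y\<^sup>2 = 1" using dn_dataD(2)[OF d] w by simp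
  have "\<mu> True \<le> tent_form n e L x y"
    using form[of x y] coord_w[OF d, of True True] coord_w[OF d, of False True] by (simp add: w)
  also have "\<dots> \<le> (tent_D n e L * (x + y)\<^sup>2 + tent_D n e L * (x - y)\<^sup>2) / 2"
    unfolding tent_form_def using tent_N_le_D[OF n L, of e] by (intro divide_right_mono add_right_mono mult_right_mono) auto
  also have "\<dots> = tent_D n e L * (x\<^sup>2 + y\<^sup>2)" by (simp add: power2_eq_square algebra_simps)
  finally have "\<mu> True \<le> tent_D n e L" using xy by simp
  with N show ?thesis by (simp add: tent_eig_def \<mu>_def)
qed

text \<open>The dual choice of test vectors: \<open>(1, -1)\<close>, which belongs to
  \<open>tent_D\<close>, for the larger eigenvalue, and \<open>w False\<close> for the
  smaller.\<close>

lemma tent_le_dn_eig: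
  assumes n: "n \<ge> 3" and h: "pos_profile L h" and c: "0 < c" "c \<le> 1" and le: "\<And>r. r \<in> {0..L} \<Longrightarrow> c * tent L r \<le> h r"
  shows "c ^ (n - 1) * tent_eig n L e t \<le> dn_eig n h L e t"
proof -
  have L: "L > 0" using h by (simp add: pos_profile_def)
  note d = dn_data_eig[OF n h, of e]
  define \<mu> where "\<mu> = dn_eig n h L e"
  define w where "w = dn_vec n h L e"
  define k where "k = c ^ (n - 1)"
  have k: "k > 0" using c by (simp add: k_def)
  note d = d[folded \<mu>_def w_def]
  have form: "k * tent_form n e L u v \<le> \<mu> True * (coord w True u v)\<^sup>2 + \<mu> False * (coord w False u v)\<^sup>2" for u v
  proof -
    obtain a p where o: "ode (mode_A n h) (mode_B n e h) 0 L a p" "a 0 = u" "a L = v" using mode_bvp[OF n h] by metis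
    have "k * tent_form n e L (a 0) (a L) \<le> a L * p L - a 0 * p 0"
      unfolding k_def by (rule tent_le_mode_form[OF n L c _ o(1)]) (use le in simp)
    then show ?thesis using dn_data_form[OF d o(1)] o(2,3) by simp
  qed
  have "(\<mu> True - \<mu> False) * (coord w False 1 (-1))\<^sup>2 \<ge> 0" using dn_dataD(1)[OF d] by simp
  moreover have "(coord w True 1 (-1))\<^sup>2 + (coord w False 1 (-1))\<^sup>2 = 2"
    using coord_inner[OF d, of 1 "-1" 1 "-1"] by (simp add: power2_eq_square)
  then have "\<mu> True * (coord w True 1 (-1))\<^sup>2 + \<mu> True * (coord w False 1 (-1))\<^sup>2 = 2 * \<mu> True"
    by (metis distrib_left mult.commute)
  ultimately have D: "k * tent_D n e L \<le> \<mu> True"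
    using form[of 1 "-1"] by (simp add: tent_form_def left_diff_distrib)
  obtain x y where w: "w False = (x, y)" by (cases "w False")
  have xy: "x\<^sup>2 + y\<^sup>2 = 1" using dn_dataD(2,3)[OF d] w by auto
  have "tent_N n e L = tent_N n e L * (x\<^sup>2 + y\<^sup>2)" using xy by simp
  also have "\<dots> = (tent_N n e L * (x + y)\<^sup>2 + tent_N n e L * (x - y)\<^sup>2) / 2" by (simp add: power2_eq_square algebra_simps)
  also have "\<dots> \<le> tent_form n e L x y"
    unfolding tent_form_def using tent_N_le_D[OF n L, of e] by (intro divide_right_mono add_left_mono mult_right_mono) auto
  finally have "k * tent_N n e L \<le> k * tent_form n e L x y" using k by simp
  also have "\<dots> \<le> \<mu> False"
    using form[of x y] coord_w[OF d, of True False] coord_w[OF d, of False False] by (simp add: w)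
  finally show ?thesis using D by (simp add: tent_eig_def \<mu>_def k_def)
qed

section \<open>The Steklov spectrum of a metric of revolution\<close>

lemma dd_real: "(f has_real_derivative D) (at r) \<Longrightarrow> dd v f r = D * v"
  by (rule dd_eqI) (simp add: has_field_derivative_def)

lemma has_real_derivative_dd:
  fixes F :: "real \<Rightarrow> real"
  assumes "F differentiable (at x)" shows "(F has_real_derivative dd 1 F x) (at x)"
proof -
  have "dd v F x = dd 1 F x * v" for v using linear_scale[OF dd_linear[OF assms], of v 1] by (simp add: mult.commute)
  then have "(\<lambda>v. dd v F x) = (*) (dd 1 F x)" by (rule ext)
  then show ?thesis using has_derivative_dd[OF assms] unfolding has_field_derivative_def by simp
qed

lemma vector_derivative_within_interval:
  fixes F :: "real \<Rightarrow> real"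
  assumes L: "L > 0" and x: "x \<in> {0..L}" and F: "(F has_real_derivative D) (at x)" and eq: "\<And>r. r \<in> {0..L} \<Longrightarrow> F r = f r"
  shows "(f has_real_derivative D) (at x within {0..L})" "vector_derivative f (at x within {0..L}) = D"
proof -
  show d: "(f has_real_derivative D) (at x within {0..L})"
    by (rule has_field_derivative_transform_within[OF has_field_derivative_at_within[OF F] zero_less_one x]) (rule eq)
  show "vector_derivative f (at x within {0..L}) = D"
    by (rule vector_derivative_within_closed_interval[OF L x]) (use d in \<open>simp add: has_real_derivative_iff_has_vector_derivative\<close>)
qed

lemma smooth_on_Cinf: "smooth_on A f \<longleftrightarrow> (\<exists>U F. open U \<and> A \<subseteq> U \<and> Cinf U F \<and> (\<forall>x\<in>A. F x = f x))"
  by (simp add: smooth_on_def Cinf_def)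

lemma smooth_on_continuous: assumes "smooth_on A f" shows "continuous_on A f"
proof -
  obtain U F where U: "A \<subseteq> U" "Cinf U F" "\<And>x. x \<in> A \<Longrightarrow> F x = f x" using assms unfolding smooth_on_Cinf by metis
  have "continuous_on A F" by (rule continuous_on_subset[OF Cinf_continuous_on[OF U(2)] U(1)])
  then show ?thesis by (rule continuous_on_eq) (rule U(3))
qed

lemma revolution_profile_pos: "revolution_profile L h \<Longrightarrow> L > 0 \<Longrightarrow> pos_profile L h"
  by (simp add: revolution_profile_def pos_profile_def smooth_on_continuous)

text \<open>The slope bound makes \<open>h\<close> 1-Lipschitz, and \<open>h\<close> is 1 at both
  ends.\<close>

lemma revolution_profile_le_tent:
  assumes h: "revolution_profile L h" and L: "L > 0" and r: "r \<in> {0..L}"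
  shows "h r \<le> tent L r"
proof -
  obtain U F where U: "{0..L} \<subseteq> U" "Cinf U F" "\<And>x. x \<in> {0..L} \<Longrightarrow> F x = h x"
    using h unfolding revolution_profile_def smooth_on_Cinf by metis
  have d: "(h has_real_derivative dd 1 F x) (at x within {0..L})" "vector_derivative h (at x within {0..L}) = dd 1 F x"
    if x: "x \<in> {0..L}" for x
  proof -
    have "F differentiable (at x)" by (rule Cinf_differentiable[OF U(2)]) (use U(1) x in blast)
    note v = vector_derivative_within_interval[OF L x has_real_derivative_dd[OF this] U(3)]
    show "(h has_real_derivative dd 1 F x) (at x within {0..L})" "vector_derivative h (at x within {0..L}) = dd 1 F x"
      by (rule v, assumption)+
  qed
  have "norm (h x - h y) \<le> 1 * norm (x - y)" if "x \<in> {0..L}" "y \<in> {0..L}" for x y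
  proof (rule field_differentiable_bound[OF convex_real_interval(5) d(1) _ that])
    show "norm (dd 1 F z) \<le> 1" if z: "z \<in> {0..L}" for z
    proof -
      have "\<bar>vector_derivative h (at z within {0..L})\<bar> \<le> 1" using h z unfolding revolution_profile_def by blast
      then show ?thesis unfolding d(2)[OF z] by simp
    qed
  qed
  from this[OF r, of 0] this[OF r, of L] have "\<bar>h r - h 0\<bar> \<le> \<bar>r\<bar>" "\<bar>h r - h L\<bar> \<le> \<bar>r - L\<bar>" using L by auto
  moreover have "h 0 = 1" "h L = 1" using h by (auto simp: revolution_profile_def)
  ultimately show ?thesis using r by (auto simp: tent_def min_def)
qed

text \<open>Positivity persists near the compact interval. The radial equation can thus be solved
  slightly beyond both ends, which provides the extension demanded by
  \<open>smooth_on\<close>.\<close>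

lemma revolution_profile_extension:
  assumes h: "revolution_profile L h" and L: "L > 0"
  obtains \<delta> H where "\<delta> > 0" "Cinf {- \<delta><..<L + \<delta>} H" "\<And>r. r \<in> {- \<delta><..<L + \<delta>} \<Longrightarrow> H r > 0" "\<And>r. r \<in> {0..L} \<Longrightarrow> H r = h r"
proof -
  obtain U H where U: "open U" "{0..L} \<subseteq> U" "Cinf U H" "\<And>x. x \<in> {0..L} \<Longrightarrow> H x = h x"
    using h unfolding revolution_profile_def smooth_on_Cinf by metis
  have "open (U \<inter> H -` {0<..})"
    by (rule continuous_open_preimage[OF Cinf_continuous_on[OF U(3)] U(1)]) simp
  moreover have "{0..L} \<subseteq> U \<inter> H -` {0<..}" using U(2,4) h by (auto simp: revolution_profile_def)
  ultimately obtain \<delta> where \<delta>: "\<delta> > 0" "(\<Union>x\<in>{0..L}. ball x \<delta>) \<subseteq> U \<inter> H -` {0<..}"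
    using compact_subset_open_imp_ball_epsilon_subset[OF compact_Icc] by metis
  have sub: "{- \<delta><..<L + \<delta>} \<subseteq> (\<Union>x\<in>{0..L}. ball x \<delta>)"
  proof
    fix r assume r: "r \<in> {- \<delta><..<L + \<delta>}"
    then have "max 0 (min L r) \<in> {0..L}" "r \<in> ball (max 0 (min L r)) \<delta>"
      using L \<delta>(1) by (auto simp: dist_real_def)
    then show "r \<in> (\<Union>x\<in>{0..L}. ball x \<delta>)" by blast
  qed
  show ?thesis
  proof (rule that[OF \<delta>(1) _ _ U(4)])
    show "Cinf {- \<delta><..<L + \<delta>} H" by (rule Cinf_subset[OF U(3)]) (use sub \<delta>(2) in blast)
    show "H r > 0" if "r \<in> {- \<delta><..<L + \<delta>}" for r using sub \<delta>(2) that by blast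
  qed
qed

text \<open>Bootstrapping: the derivatives are \<open>A p\<close> and \<open>B a\<close>, so
  \<open>a\<close> and \<open>p\<close> gain orders of smoothness together.\<close>

lemma ode_Cinf:
  assumes o: "ode A B l m a p" and A: "Cinf {l<..<m} A" and B: "Cinf {l<..<m} B"
  shows "Cinf {l<..<m} a" "Cinf {l<..<m} p"
proof -
  let ?I = "{l<..<m}"
  have der: "(a has_real_derivative A x * p x) (at x)" "(p has_real_derivative B x * a x) (at x)" if "x \<in> ?I" for x
    using odeD(3,4)[OF o] that by simp_all
  have "Ck_on k ?I a \<and> Ck_on k ?I p" for k
  proof (induction k)
    case 0
    have "?I \<subseteq> {l..m}" by auto
    then show ?case using continuous_on_subset odeD(1,2)[OF o] by (metis Ck_on.simps(1))
  next
    case (Suc k)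
    have "Ck_on k ?I (\<lambda>x. A x * p x)" "Ck_on k ?I (\<lambda>x. B x * a x)"
      using A B Suc unfolding Cinf_def by (blast intro: Ck_on_mult[OF open_greaterThanLessThan])+
    note this[THEN Ck_on_cong[OF open_greaterThanLessThan, rotated]]
    then have "Ck_on k ?I (dd 1 a)" "Ck_on k ?I (dd 1 p)"
      using dd_real[OF der(1), of _ 1] dd_real[OF der(2), of _ 1] by simp_all
    moreover have "a differentiable (at x)" "p differentiable (at x)" if "x \<in> ?I" for x
      using der[OF that] real_differentiable_def by blast+
    ultimately show ?case unfolding Ck_on_Suc by simp
  qed
  then show "Cinf ?I a" "Cinf ?I p" by (auto simp: Cinf_def)
qed

lemma Cinf_mode_coeffs:
  assumes I: "open I" and H: "Cinf I H" "\<And>r. r \<in> I \<Longrightarrow> H r > 0"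
  shows "Cinf I (mode_A n H)" "Cinf I (mode_B n e H)"
proof -
  show "Cinf I (mode_A n H)" unfolding mode_A_def[abs_def] by (intro cinf I H(1)) (metis H(2) less_irrefl power_not_zero)
  show "Cinf I (mode_B n e H)" unfolding mode_B_def[abs_def] by (intro cinf I H(1))
qed

lemma Cinf_fst_fun:
  assumes "Cinf I a" "open I" "open S" "\<And>z. z \<in> S \<Longrightarrow> fst z \<in> I"
  shows "Cinf S (\<lambda>z::real \<times> 'b::euclidean_space. a (fst z))"
  by (rule Cinf_compose_real[OF assms(1,3,2)]) (auto intro: cinf assms)

lemma Cinf_snd_fun:
  fixes Y :: "'b::euclidean_space \<Rightarrow> real"
  assumes "Cinf V Y" "open V" "open S" "\<And>z. z \<in> S \<Longrightarrow> snd z \<in> V"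
  shows "Cinf S (\<lambda>z::'a::euclidean_space \<times> 'b. Y (snd z))"
  by (rule Cinf_compose[OF assms(1,3,2)]) (auto intro: cinf assms)

lemma slice_derivative:
  assumes "q differentiable (at (r, x))" shows "((\<lambda>s. q (s, x)) has_real_derivative dd (1, 0) q (r, x)) (at r)"
proof -
  have "((\<lambda>s::real. (s, x)) has_derivative (\<lambda>v. (v, 0))) (at r)"
    by (rule has_derivative_Pair[OF has_derivative_ident has_derivative_const])
  from has_derivative_compose[OF this has_derivative_dd[OF assms]]
  have "((\<lambda>s. q (s, x)) has_derivative (\<lambda>v. dd (v, 0) q (r, x))) (at r)" .
  moreover have "dd (v, 0) q (r, x) = dd (1, 0) q (r, x) * v" for v
    using linear_scale[OF dd_linear[OF assms], of v "(1, 0)"] by (simp add: mult.commute)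
  then have "(\<lambda>v. dd (v, 0) q (r, x)) = (*) (dd (1, 0) q (r, x))" by (rule ext)
  ultimately show ?thesis unfolding has_field_derivative_def by metis
qed

lemma power_shift_2: "n \<ge> 3 \<Longrightarrow> (c::real) ^ (n - 1) = c ^ (n - 3) * c\<^sup>2"
proof -
  assume "n \<ge> 3"
  then have "n - 1 = (n - 3) + 2" by simp
  then show ?thesis by (metis power_add)
qed

text \<open>The function is \<open>a r * Y x\<close>, where \<open>a\<close> solves the mode
  equation and takes the two components of the eigenvector as boundary values. Its outward
  derivatives are then the eigenvalue times its boundary values.\<close>

lemma mode_function:
  fixes Y :: "real^'n \<Rightarrow> real"
  assumes n: "CARD('n) \<ge> 3" and h: "revolution_profile L h" and L: "L > 0" and Y: "Y \<in> Harm e"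
  shows "\<exists>f \<in> steklov_space h L (dn_eig CARD('n) h L e t).
    (\<forall>x\<in>sphere 0 1. f (0, x) = fst (dn_vec CARD('n) h L e t) * Y x \<and> f (L, x) = snd (dn_vec CARD('n) h L e t) * Y x)"
proof -
  define N where "N = CARD('n)"
  have N: "N \<ge> 3" using n by (simp add: N_def)
  define u v where "u = fst (dn_vec N h L e t)" and "v = snd (dn_vec N h L e t)"
  define \<mu> where "\<mu> = dn_eig N h L e t"
  note hpos = revolution_profile_pos[OF h L]
  have h0: "h 0 = 1" "h L = 1" using h by (auto simp: revolution_profile_def)
  have hp: "h r > 0" if "r \<in> {0..L}" for r using hpos that by (auto simp: pos_profile_def)
  obtain \<delta> H where H: "\<delta> > 0" "Cinf {- \<delta><..<L + \<delta>} H" "\<And>r. r \<in> {- \<delta><..<L + \<delta>} \<Longrightarrow> H r > 0" "\<And>r. r \<in> {0..L} \<Longrightarrow> H r = h r"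
    using revolution_profile_extension[OF h L] by metis
  define l' m' where "l' = - \<delta> / 2" and "m' = L + \<delta> / 2"
  have lm: "l' < 0" "L < m'" "l' \<le> 0" "L \<le> m'" "{l'..m'} \<subseteq> {- \<delta><..<L + \<delta>}" "{0..L} \<subseteq> {l'..m'}"
    using H(1) by (auto simp: l'_def m'_def)
  let ?J = "{l'<..<m'}"
  have Hl: "r \<in> {l'..m'} \<Longrightarrow> H r > 0" for r using H(3) lm(5) by blast
  have "continuous_on {l'..m'} H" by (rule continuous_on_subset[OF Cinf_continuous_on[OF H(2)] lm(5)])
  note mc = mode_coeffs[OF N Hl this]
  obtain a p where ap: "ode (mode_A N H) (mode_B N e H) l' m' a p" "a 0 = u" "a L = v"
    using ode_bvp[of 0 L "mode_A N H" "mode_B N e H" l' m' u v, OF _ _ mc(2,4) lm(3) L lm(4)] mc(1,3) lm(6) by blast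
  have o: "ode (mode_A N h) (mode_B N e h) 0 L a p"
    by (rule ode_cong[OF ode_subset[OF ap(1) lm(3,4)]]) (simp_all add: mode_A_def mode_B_def H(4))
  note d = dn_data_eig[OF N hpos, of e]
  \<comment> \<open>The outward derivatives and \<open>\<mu>\<close> times the boundary values have
    the same coordinates in the eigenbasis, hence coincide.\<close>
  have "coord (dn_vec N h L e) s (- p 0) (p L) = coord (dn_vec N h L e) s (\<mu> * u) (\<mu> * v)" for s
  proof -
    have "coord (dn_vec N h L e) s (- p 0) (p L) = dn_eig N h L e s * (if s = t then 1 else 0)"
      using dn_dataD(4)[OF d o, of s] coord_w[OF d, of s t] by (simp add: ap(2,3) u_def v_def)
    also have "\<dots> = \<mu> * coord (dn_vec N h L e) s u v"
      using coord_w[OF d, of s t] by (simp add: \<mu>_def u_def v_def)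
    also have "\<dots> = coord (dn_vec N h L e) s (\<mu> * u) (\<mu> * v)" by (simp add: coord_def algebra_simps)
    finally show ?thesis .
  qed
  note bd = coord_inject[OF d this]
  have Jsub: "?J \<subseteq> {- \<delta><..<L + \<delta>}" "?J \<subseteq> {l'..m'}" using H(1) by (auto simp: l'_def m'_def)
  have HJ: "r \<in> ?J \<Longrightarrow> H r > 0" for r using Hl Jsub(2) by blast
  have JI: "Cinf ?J (mode_A N H)" "Cinf ?J (mode_B N e H)"
    by (rule Cinf_mode_coeffs[OF open_greaterThanLessThan Cinf_subset[OF H(2) Jsub(1)]], erule HJ)+
  note aC = ode_Cinf(1)[OF ap(1) JI]
  have YC: "Cinf UNIV Y" using Y Pol_Cinf by (auto simp: Harm_def)
  have RC: "Cinf (- {0}) (rad Y)" by (rule Cinf_rad[OF YC])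
  define f where "f q = (if q \<in> cyl L then a (fst q) * Y (snd q) else 0)" for q
  have f_eq: "f (r, x) = a r * Y x" if "r \<in> {0..L}" "x \<in> sphere 0 1" for r x using that by (simp add: f_def cyl_def)
  have smooth: "smooth_on (cyl L) f" unfolding smooth_on_Cinf
  proof (intro exI conjI ballI)
    show opJ: "open (?J \<times> (UNIV :: (real^'n) set))" by (intro open_Times) auto
    show "cyl L \<subseteq> ?J \<times> UNIV" using lm by (auto simp: cyl_def)
    show "Cinf (?J \<times> UNIV) (\<lambda>q. a (fst q) * Y (snd q))"
      by (intro Cinf_mult opJ Cinf_fst_fun[OF aC _ opJ] Cinf_snd_fun[OF YC _ opJ]) auto
    show "a (fst x) * Y (snd x) = f x" if "x \<in> cyl L" for x using that by (simp add: f_def)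
  qed
  have harm: "laplace_beltrami (metric_coeffs h) (f \<circ> polar_param) x = 0" if x: "0 < norm x" "norm x < L" for x :: "real^'n"
  proof -
    let ?O = "{0<..<L} \<times> - {0::real^'n}" and ?r = "norm x"
    define q where "q z = a (fst z) * rad Y (snd z)" for z :: "real \<times> (real^'n)"
    have opO: "open ?O" by (intro open_Times) auto
    have qC: "Cinf ?O q" unfolding q_def
      by (intro Cinf_mult opO Cinf_fst_fun[OF aC _ opO] Cinf_snd_fun[OF RC _ opO]) (use lm in auto)
    have hC: "Cinf {0<..<L} h"
      by (rule Cinf_cong[OF Cinf_subset[OF H(2)]]) (use H(1,4) in auto)
    have q1: "dd (1, 0) q (r, y) = mode_A N h r * p r * rad Y y" if "(r, y) \<in> ?O" for r y
    proof -
      have "dd (1, 0) q (r, y) = dd 1 (\<lambda>s. a s * rad Y y) r"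
        using dd_slice_fst[OF Cinf_differentiable[OF qC that], of 1] by (simp add: q_def)
      then show ?thesis using dd_real[OF DERIV_cmult_right[OF odeD(3)[OF o, of r], of "rad Y y"], of 1] that by simp
    qed
    have Z: "h (fst z) ^ (N - 1) * dd (1, 0) q z = p (fst z) * rad Y (snd z)" if z: "z \<in> ?O" for z
    proof -
      obtain r y where zz: "z = (r, y)" by (cases z)
      have "h r > 0" using z zz by (intro hp) auto
      then show ?thesis using q1[of r y] z unfolding zz by (simp add: mode_A_def)
    qed
    have zO: "(?r, x) \<in> ?O" using x by auto
    have pC: "Cinf ?O (\<lambda>z. p (fst z) * rad Y (snd z))"
      by (intro Cinf_mult opO Cinf_fst_fun[OF ode_Cinf(2)[OF ap(1) JI] _ opO] Cinf_snd_fun[OF RC _ opO]) (use lm in auto)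
    have "dd (1, 0) (\<lambda>z. h (fst z) ^ (N - 1) * dd (1, 0) q z) (?r, x) = dd (1, 0) (\<lambda>z. p (fst z) * rad Y (snd z)) (?r, x)"
      by (rule dd_cong[OF opO zO Z])
    also have "\<dots> = dd 1 (\<lambda>s. p s * rad Y x) ?r"
      using dd_slice_fst[OF Cinf_differentiable[OF pC zO], of 1] by simp
    also have "\<dots> = mode_B N e h ?r * a ?r * rad Y x"
      using dd_real[OF DERIV_cmult_right[OF odeD(4)[OF o x], of "rad Y x"], of 1] by simp
    finally have Z1: "dd (1, 0) (\<lambda>z. h (fst z) ^ (N - 1) * dd (1, 0) q z) (?r, x) = mode_B N e h ?r * a ?r * rad Y x" .
    have "lapl (\<lambda>y. q (?r, y)) x = a ?r * lapl (rad Y) x"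
      using lapl_cmult[OF open_punctured RC, of x "a ?r"] x by (simp add: q_def)
    also have "lapl (rad Y) x = - sph_eig N e * rad Y x / ?r\<^sup>2"
      using lapl_rad[OF Y, of x] x by (simp add: N_def dot_square_norm field_simps)
    finally have l: "lapl (\<lambda>y. q (?r, y)) x = a ?r * (- sph_eig N e * rad Y x / ?r\<^sup>2)" .
    have "laplace_beltrami (metric_coeffs h) (f \<circ> polar_param) x =
      dd (1, 0) (\<lambda>z. h (fst z) ^ (CARD('n) - 1) * dd (1, 0) q z) (?r, x) / h ?r ^ (CARD('n) - 1)
      + lapl (\<lambda>y. q (?r, y)) x * (?r / h ?r)\<^sup>2"
    proof (rule laplace_beltrami_polar[OF _ hC _ qC _ _ x])
      show "hom0 (\<lambda>x. q (r, x))" for r using hom0_rad[of Y] by (simp add: hom0_def q_def)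
      show "(f \<circ> polar_param) x = q (norm x, x)" if "0 < norm x" "norm x < L" for x
        using that by (simp add: polar_param_def f_eq q_def rad_def)
    qed (use n hp in auto)
    also have "\<dots> = mode_B N e h ?r * a ?r * rad Y x / h ?r ^ (N - 1) + a ?r * (- sph_eig N e * rad Y x / ?r\<^sup>2) * (?r / h ?r)\<^sup>2"
      unfolding N_def[symmetric] Z1 l ..
    also have "\<dots> = 0"
    proof -
      \<comment> \<open>The radial term carries \<open>h^(n-3) / h^(n-1) = 1 / h^2\<close>, the
        factor of the spherical term, and the two cancel.\<close>
      have alg: "s * g * k * y / (g * c\<^sup>2) + k * (- s * y / r\<^sup>2) * (r / c)\<^sup>2 = 0" if "g > 0" "c > 0" "r > 0" for s g k y c r :: real
        using that by (simp add: field_simps)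
      have "h ?r > 0" using x by (intro hp) auto
      then show ?thesis unfolding mode_B_def power_shift_2[OF N] using x by (intro alg) auto
    qed
    finally show ?thesis .
  qed
  \<comment> \<open>The profile is 1 at both ends, so there \<open>p\<close> is the derivative of
    \<open>a\<close> itself.\<close>
  have A0: "mode_A N H 0 = 1" "mode_A N H L = 1" using H(4)[of 0] H(4)[of L] h0 L by (simp_all add: mode_A_def)
  have vd: "vector_derivative (\<lambda>r. f (r, x)) (at r within {0..L}) = mode_A N H r * p r * Y x"
    if r: "r \<in> {0..L}" and x: "x \<in> sphere 0 1" for r x
  proof (rule vector_derivative_within_interval(2)[OF L r, where F = "\<lambda>r. a r * Y x"])
    show "((\<lambda>r. a r * Y x) has_real_derivative mode_A N H r * p r * Y x) (at r)"
      by (rule DERIV_cmult_right[OF odeD(3)[OF ap(1)]]) (use r lm in auto)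
  qed (rule f_eq[OF _ x, symmetric])
  have "steklov_condition L \<mu> f" unfolding steklov_condition_def
  proof (intro ballI conjI)
    fix x :: "real^'n" assume x: "x \<in> sphere 0 1"
    have "0 \<in> {0..L}" "L \<in> {0..L}" using L by auto
    note * = vd[OF this(1) x] vd[OF this(2) x] f_eq[OF this(1) x] f_eq[OF this(2) x]
    show "- vector_derivative (\<lambda>r. f (r, x)) (at 0 within {0..L}) = \<mu> * f (0, x)"
      unfolding * A0 ap(2) mult.assoc[symmetric] bd(1)[symmetric] by simp
    show "vector_derivative (\<lambda>r. f (r, x)) (at L within {0..L}) = \<mu> * f (L, x)"
      unfolding * A0 ap(3) using bd(2) by simp
  qed
  then have "f \<in> steklov_space h L \<mu>"
    using smooth harm by (simp add: steklov_space_def harmonic_on_cyl_def f_def)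
  moreover have "f (0, x) = u * Y x" "f (L, x) = v * Y x" if "x \<in> sphere 0 1" for x
    using f_eq[OF _ that] ap(2,3) L by simp_all
  ultimately show ?thesis unfolding \<mu>_def u_def v_def N_def by blast
qed

section \<open>Spherical coefficients of harmonic functions\<close>

definition sph_coeff :: "(real \<times> (real^'n) \<Rightarrow> real) \<Rightarrow> (real^'n \<Rightarrow> real) \<Rightarrow> real \<Rightarrow> real" where
  "sph_coeff f Y r = Isph (\<lambda>x. f (r, x /\<^sub>R norm x) * rad Y x)"

lemma slice_derivative_homogeneous:
  fixes w :: "real \<times> 'a::euclidean_space \<Rightarrow> real"
  assumes "open I" "s \<in> I" "w differentiable (at (s, x))" "w differentiable (at (s, y))" "\<And>r. r \<in> I \<Longrightarrow> w (r, x) = w (r, y)"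
  shows "dd (1, 0) w (s, x) = dd (1, 0) w (s, y)"
proof -
  have "((\<lambda>r. w (r, x)) has_real_derivative dd (1, 0) w (s, y)) (at s)"
    by (rule has_field_derivative_transform_within_open[OF slice_derivative[OF assms(4)] assms(1,2)]) (simp add: assms(5))
  then show ?thesis using slice_derivative[OF assms(3)] DERIV_unique by blast
qed

text \<open>The Laplace equation on the cylinder becomes the mode equation for every spherical coefficient, by Green's identity on
  the sphere.\<close>

lemma modal_ode:
  fixes f :: "real \<times> (real^'n) \<Rightarrow> real"
  assumes n: "CARD('n) \<ge> 3" and h: "revolution_profile L h" and L: "L > 0" and Y: "Y \<in> Harm e"
    and f: "harmonic_on_cyl h L f"
  shows "\<exists>p. ode (mode_A CARD('n) h) (mode_B CARD('n) e h) 0 L (sph_coeff f Y) p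
    \<and> (\<forall>\<sigma>. steklov_condition L \<sigma> f \<longrightarrow> - p 0 = \<sigma> * sph_coeff f Y 0 \<and> p L = \<sigma> * sph_coeff f Y L)"
proof -
  define N where "N = CARD('n)"
  have N: "N \<ge> 3" using n by (simp add: N_def)
  have h0: "h 0 = 1" "h L = 1" using h by (auto simp: revolution_profile_def)
  have hp: "h r > 0" if "r \<in> {0..L}" for r using h that by (auto simp: revolution_profile_def)
  obtain \<delta> H where H: "\<delta> > 0" "Cinf {- \<delta><..<L + \<delta>} H" "\<And>r. r \<in> {- \<delta><..<L + \<delta>} \<Longrightarrow> H r > 0" "\<And>r. r \<in> {0..L} \<Longrightarrow> H r = h r"
    using revolution_profile_extension[OF h L] by metis
  obtain U F where U: "open U" "cyl L \<subseteq> U" "Cinf U F" "\<And>z. z \<in> cyl L \<Longrightarrow> F z = f z"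
    using f unfolding harmonic_on_cyl_def smooth_on_Cinf by metis
  \<comment> \<open>Radial projection onto the cylinder. Composed with it, the smooth extension of
    \<open>f\<close> becomes constant along rays in \<open>x\<close> and is smooth on an open set
    containing \<open>{0..L} \<times> - {0}\<close>.\<close>
  define \<Phi> where "\<Phi> z = (fst z, snd z /\<^sub>R norm (snd z))" for z :: "real \<times> (real^'n)"
  let ?I = "{- \<delta><..<L + \<delta>}"
  define S where "S = ?I \<times> - {0::real^'n}"
  define O' where "O' = S \<inter> \<Phi> -` U"
  have opS: "open S" unfolding S_def by (intro open_Times) auto
  have "continuous_on S \<Phi>" unfolding \<Phi>_def by (intro continuous_intros) (auto simp: S_def)
  then have opO: "open O'" unfolding O'_def using opS U(1) by (rule continuous_open_preimage)
  have OS: "O' \<subseteq> S" by (simp add: O'_def)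
  have nz: "snd z \<noteq> 0" "fst z \<in> ?I" if "z \<in> O'" for z using OS that by (auto simp: S_def)
  define q where "q z = F (\<Phi> z)" for z
  have qC: "Cinf O' q" unfolding q_def \<Phi>_def
  proof (rule Cinf_compose_Pair[OF U(3) opO U(1)])
    show "(fst z, snd z /\<^sub>R norm (snd z)) \<in> U" if "z \<in> O'" for z using that by (simp add: O'_def \<Phi>_def)
    show "Cinf O' (\<lambda>z. fst z \<bullet> c)" for c :: real by (rule cinf)
    have n': "Cinf O' (\<lambda>z. norm (snd z))"
      by (rule Cinf_snd_fun[OF Cinf_norm[OF open_punctured] open_punctured opO]) (use nz in auto)
    show "Cinf O' (\<lambda>z. (snd z /\<^sub>R norm (snd z)) \<bullet> c)" for c
    proof -
      have "Cinf O' (\<lambda>z. inverse (norm (snd z)) * (snd z \<bullet> c))"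
        by (intro cinf opO n') (use nz in auto)
      then show ?thesis by simp
    qed
  qed
  define qr where "qr = dd (1, 0) q"
  define Z where "Z z = H (fst z) ^ (N - 1) * qr z" for z
  define Zr where "Zr = dd (1, 0) Z"
  have qrC: "Cinf O' qr" unfolding qr_def by (rule Cinf_dd[OF opO qC])
  have HC: "Cinf O' (\<lambda>z. H (fst z))" by (rule Cinf_fst_fun[OF H(2) _ opO]) (use nz in auto)
  have ZC: "Cinf O' Z" unfolding Z_def by (intro Cinf_mult Cinf_power opO HC qrC)
  have ZrC: "Cinf O' Zr" unfolding Zr_def by (rule Cinf_dd[OF opO ZC])
  have RC: "Cinf (- {0}) (rad Y)" using Y Cinf_rad[OF Pol_Cinf] by (auto simp: Harm_def)
  have cyl': "(r, x /\<^sub>R norm x) \<in> cyl L" if "r \<in> {0..L}" "x \<noteq> 0" for r and x :: "real^'n"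
    using that by (simp add: cyl_def)
  have mem: "(r, x) \<in> O'" if "r \<in> {0..L}" "x \<noteq> 0" for r x
    using that cyl'[OF that] U(2) H(1) by (auto simp: O'_def S_def \<Phi>_def)
  have sub: "{0..L} \<times> - {0} \<subseteq> O'" by (auto intro!: mem)
  have D: "w differentiable (at (r, x))" if "Cinf O' w" "r \<in> {0..L}" "x \<noteq> 0" for w r x
    using Cinf_differentiable[OF that(1) mem[OF that(2,3)]] .
  have qf: "q (r, x) = f (r, x /\<^sub>R norm x)" if "r \<in> {0..L}" "x \<noteq> 0" for r x
    using U(4)[OF cyl'[OF that]] by (simp add: q_def \<Phi>_def)
  have qhom: "q (r, t *\<^sub>R x) = q (r, x)" if "t > 0" for r t x
    using that by (simp add: q_def \<Phi>_def field_simps)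
  have qrhom: "qr (r, t *\<^sub>R x) = qr (r, x)" if "r \<in> {0..L}" "x \<noteq> 0" "t > 0" for r t x
    unfolding qr_def by (rule slice_derivative_homogeneous[OF open_UNIV UNIV_I]) (use D[OF qC] that qhom in auto)
  define a where "a r = Isph (\<lambda>x. q (r, x) * rad Y x)" for r
  define p where "p r = Isph (\<lambda>x. Z (r, x) * rad Y x)" for r
  have aeq: "sph_coeff f Y r = a r" if "r \<in> {0..L}" for r
    unfolding a_def sph_coeff_def by (rule Isph_cong) (simp add: qf[OF that])
  have leib: "((\<lambda>r. Isph (\<lambda>x. w (r, x) * rad Y x)) has_real_derivative Isph (\<lambda>x. dd (1, 0) w (r, x) * rad Y x)) (at r within {0..L})"
    if w: "Cinf O' w" and r: "r \<in> {0..L}" for w r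
  proof -
    have c: "continuous_on ({0..L} \<times> - {0}) (\<lambda>z. v z * rad Y (snd z))" if "Cinf O' v" for v
      by (intro continuous_intros continuous_on_subset[OF Cinf_continuous_on[OF that] sub]
        continuous_on_compose2[OF Cinf_continuous_on[OF RC]]) auto
    have "((\<lambda>r. Isph (\<lambda>x. (\<lambda>z. w z * rad Y (snd z)) (r, x))) has_real_derivative
        Isph (\<lambda>x. (\<lambda>z. dd (1, 0) w z * rad Y (snd z)) (r, x))) (at r within {0..L})"
    proof (rule Isph_leibniz[OF _ c[OF w] c[OF Cinf_dd[OF opO w]] r])
      fix r x assume "r \<in> {0..L}" "x \<noteq> (0::real^'n)"
      from has_field_derivative_at_within[OF DERIV_cmult_right[OF slice_derivative[OF D[OF w this]], of "rad Y x"]]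
      show "((\<lambda>r. w (r, x) * rad Y (snd (r, x))) has_real_derivative dd (1, 0) w (r, x) * rad Y (snd (r, x))) (at r within {0..L})"
        by simp
    qed
    then show ?thesis by simp
  qed
  have da: "(a has_real_derivative Isph (\<lambda>x. qr (r, x) * rad Y x)) (at r within {0..L})" if "r \<in> {0..L}" for r
    using leib[OF qC that] by (simp add: a_def[abs_def] qr_def)
  have dp: "(p has_real_derivative Isph (\<lambda>x. Zr (r, x) * rad Y x)) (at r within {0..L})" if "r \<in> {0..L}" for r
    using leib[OF ZC that] by (simp add: p_def[abs_def] Zr_def)
  have pr: "p r = h r ^ (N - 1) * Isph (\<lambda>x. qr (r, x) * rad Y x)" if "r \<in> {0..L}" for r
    unfolding p_def Isph_cmult[symmetric] by (simp add: Z_def H(4)[OF that] mult.assoc)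
  \<comment> \<open>The polar form of the Laplace equation speaks of points with
    \<open>norm x = r\<close> only. Any other \<open>y\<close> is rescaled to such a point, since
    \<open>Zr\<close> is constant along rays and the Laplacian of the slice has degree -2.\<close>
  have Zr_eq: "Zr (r, y) = - (h r ^ (N - 3)) * ((y \<bullet> y) * lapl (\<lambda>x. q (r, x)) y)" if r: "0 < r" "r < L" and y: "y \<noteq> 0" for r y
  proof -
    define t where "t = norm y / r"
    define x where "x = (r / norm y) *\<^sub>R y"
    have x: "norm x = r" "x \<noteq> 0" using r y by (auto simp: x_def)
    have t: "t > 0" "y = t *\<^sub>R x" using r y by (auto simp: t_def x_def)
    have rL: "r \<in> {0..L}" using r by simp
    have sub2: "{0<..<L} \<times> - {0} \<subseteq> O'" by (rule subset_trans[OF _ sub]) auto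
    have zO: "(r, x) \<in> {0<..<L} \<times> - {0}" using r x by auto
    have hC: "Cinf {0<..<L} h" by (rule Cinf_cong[OF Cinf_subset[OF H(2)]]) (use H(1,4) in auto)
    have g: "Cinf (- {0}) (\<lambda>x. q (r, x))"
      by (rule Cinf_compose_Pair[OF qC open_punctured opO]) (use mem[OF rL] in \<open>auto intro: cinf\<close>)
    have hg: "hom0 (\<lambda>x. q (s, x))" for s by (simp add: hom0_def qhom)
    have "0 = laplace_beltrami (metric_coeffs h) (f \<circ> polar_param) x"
      using f x r unfolding harmonic_on_cyl_def by simp
    also have "\<dots> = dd (1, 0) (\<lambda>z. h (fst z) ^ (CARD('n) - 1) * dd (1, 0) q z) (norm x, x) / h (norm x) ^ (CARD('n) - 1)
        + lapl (\<lambda>y. q (norm x, y)) x * (norm x / h (norm x))\<^sup>2"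
    proof (rule laplace_beltrami_polar[OF _ hC _ Cinf_subset[OF qC sub2] hg])
      show "(f \<circ> polar_param) x = q (norm x, x)" if "0 < norm x" "norm x < L" for x
        using qf[of "norm x" x] that by (simp add: polar_param_def)
    qed (use n hp x r in auto)
    also have "dd (1, 0) (\<lambda>z. h (fst z) ^ (CARD('n) - 1) * dd (1, 0) q z) (norm x, x) = Zr (r, x)"
      unfolding Zr_def x(1)
      by (rule dd_cong[OF _ zO]) (auto intro!: open_Times simp: Z_def qr_def H(4) N_def)
    finally have 0: "Zr (r, x) / h r ^ (N - 1) + lapl (\<lambda>y. q (r, y)) x * (r / h r)\<^sup>2 = 0" by (simp add: x(1) N_def)
    have "Zr (r, x) = - (h r ^ (N - 3) * (r\<^sup>2 * lapl (\<lambda>y. q (r, y)) x))"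
    proof -
      have "z = - (g * (r\<^sup>2 * l))" if "z / (g * c\<^sup>2) + l * (r / c)\<^sup>2 = 0" "g > 0" "c > 0" for z g l c :: real
        using that by (simp add: field_simps power_divide)
      from this[OF 0[unfolded power_shift_2[OF N]]] hp[OF rL] show ?thesis by simp
    qed
    moreover have "Zr (r, y) = Zr (r, x)" unfolding Zr_def t(2)
    proof (rule slice_derivative_homogeneous[OF _ _ D[OF ZC rL] D[OF ZC rL]])
      show "open {0<..<L}" "r \<in> {0<..<L}" "t *\<^sub>R x \<noteq> 0" "x \<noteq> 0" using r x t(1) by auto
      show "Z (s, t *\<^sub>R x) = Z (s, x)" if "s \<in> {0<..<L}" for s using that qrhom[of s x t] x(2) t(1) by (simp add: Z_def)
    qed
    moreover have "(y \<bullet> y) * lapl (\<lambda>x. q (r, x)) y = r\<^sup>2 * lapl (\<lambda>x. q (r, x)) x"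
    proof -
      have "y \<bullet> y = t\<^sup>2 * r\<^sup>2" unfolding t(2) using x(1) by (simp add: dot_square_norm power_mult_distrib)
      moreover have "lapl (\<lambda>x. q (r, x)) y = lapl (\<lambda>x. q (r, x)) x / t\<^sup>2"
        unfolding t(2) by (rule lapl_hom0[OF g hg t(1) x(2)])
      ultimately show ?thesis using t(1) by simp
    qed
    ultimately show ?thesis by simp
  qed
  have Zr_int: "Isph (\<lambda>x. Zr (r, x) * rad Y x) = mode_B N e h r * a r" if r: "0 < r" "r < L" for r
  proof -
    have rL: "r \<in> {0..L}" using r by simp
    have g: "Cinf (- {0}) (\<lambda>x. q (r, x))"
      by (rule Cinf_compose_Pair[OF qC open_punctured opO]) (use mem[OF rL] in \<open>auto intro: cinf\<close>)
    have hg: "hom0 (\<lambda>x. q (r, x))" by (simp add: hom0_def qhom)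
    have "Isph (\<lambda>x. Zr (r, x) * rad Y x) = Isph (\<lambda>x. - (h r ^ (N - 3)) * ((x \<bullet> x) * lapl (\<lambda>x. q (r, x)) x * rad Y x))"
      by (rule Isph_cong) (simp add: Zr_eq[OF r])
    also have "\<dots> = - (h r ^ (N - 3)) * Isph (\<lambda>x. q (r, x) * ((x \<bullet> x) * lapl (rad Y) x))"
      unfolding Isph_cmult Isph_green[OF g hg RC hom0_rad] ..
    also have "Isph (\<lambda>x. q (r, x) * ((x \<bullet> x) * lapl (rad Y) x)) = Isph (\<lambda>x. - sph_eig N e * (q (r, x) * rad Y x))"
      by (rule Isph_cong) (simp add: lapl_rad[OF Y] N_def)
    also have "\<dots> = - sph_eig N e * a r" unfolding Isph_cmult a_def ..
    finally show ?thesis by (simp add: mode_B_def)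
  qed
  have "ode (mode_A N h) (mode_B N e h) 0 L a p" unfolding ode_def
  proof (intro conjI ballI)
    show "continuous_on {0..L} a" by (rule DERIV_continuous_on[OF da])
    show "continuous_on {0..L} p" by (rule DERIV_continuous_on[OF dp])
    fix r assume "r \<in> {0<..<L}"
    then have r: "0 < r" "r < L" and rL: "r \<in> {0..L}" by auto
    have int: "at r within {0..L} = at r" by (rule at_within_interior) (use r in auto)
    have "mode_A N h r * p r = Isph (\<lambda>x. qr (r, x) * rad Y x)"
      using pr[OF rL] hp[OF rL] by (simp add: mode_A_def)
    then show "(a has_real_derivative mode_A N h r * p r) (at r)" using da[OF rL] int by simp
    show "(p has_real_derivative mode_B N e h r * a r) (at r)" using dp[OF rL] int Zr_int[OF r] by simp
  qed
  moreover have "continuous_on {0..L} (sph_coeff f Y)"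
  proof (rule continuous_on_eq)
    show "continuous_on {0..L} a" by (rule DERIV_continuous_on[OF da])
  qed (simp add: aeq)
  ultimately have "ode (mode_A N h) (mode_B N e h) 0 L (sph_coeff f Y) p"
    unfolding ode_def
  proof (elim conjE, intro conjI ballI)
    fix r assume "r \<in> {0<..<L}" and
      der: "\<forall>r\<in>{0<..<L}. (a has_real_derivative mode_A N h r * p r) (at r) \<and> (p has_real_derivative mode_B N e h r * a r) (at r)"
    then have r: "r \<in> {0<..<L}" "r \<in> {0..L}" by auto
    show "(sph_coeff f Y has_real_derivative mode_A N h r * p r) (at r)"
      by (rule has_field_derivative_transform_within_open[of a _ _ "{0<..<L}"]) (use der r aeq in auto)
    show "(p has_real_derivative mode_B N e h r * sph_coeff f Y r) (at r)" using der r aeq by simp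
  qed
  moreover have "- p 0 = \<sigma> * sph_coeff f Y 0 \<and> p L = \<sigma> * sph_coeff f Y L" if st: "steklov_condition L \<sigma> f" for \<sigma>
  proof -
    have 0: "0 \<in> {0..L}" "L \<in> {0..L}" using L by auto
    have vd: "vector_derivative (\<lambda>r. f (r, x /\<^sub>R norm x)) (at r within {0..L}) = qr (r, x)" if "r \<in> {0..L}" "x \<noteq> 0" for r x
      unfolding qr_def by (rule vector_derivative_within_interval(2)[OF L that(1) slice_derivative[OF D[OF qC that]]]) (rule qf[OF _ that(2)])
    have q0: "qr (0, x) = - \<sigma> * q (0, x)" "qr (L, x) = \<sigma> * q (L, x)" if x: "x \<noteq> 0" for x
    proof -
      have "x /\<^sub>R norm x \<in> sphere 0 1" using x by simp
      then have "- vector_derivative (\<lambda>r. f (r, x /\<^sub>R norm x)) (at 0 within {0..L}) = \<sigma> * f (0, x /\<^sub>R norm x)"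
        "vector_derivative (\<lambda>r. f (r, x /\<^sub>R norm x)) (at L within {0..L}) = \<sigma> * f (L, x /\<^sub>R norm x)"
        using st unfolding steklov_condition_def by blast+
      then show "qr (0, x) = - \<sigma> * q (0, x)" "qr (L, x) = \<sigma> * q (L, x)"
        unfolding vd[OF 0(1) x] vd[OF 0(2) x] qf[OF 0(1) x] qf[OF 0(2) x] by linarith+
    qed
    have "p 0 = Isph (\<lambda>x. - \<sigma> * (q (0, x) * rad Y x))" unfolding pr[OF 0(1)] h0 power_one mult_1
      by (rule Isph_cong) (simp add: q0)
    moreover have "p L = Isph (\<lambda>x. \<sigma> * (q (L, x) * rad Y x))" unfolding pr[OF 0(2)] h0 power_one mult_1
      by (rule Isph_cong) (simp add: q0)
    ultimately show ?thesis unfolding Isph_cmult aeq[OF 0(1)] aeq[OF 0(2)] a_def by simp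
  qed
  ultimately show ?thesis unfolding N_def by blast
qed

lemma sum_fun_eval: "(\<Sum>i\<in>I. f i) q = (\<Sum>i\<in>I. f i q :: real)"
  by (induction I rule: infinite_finite_induct) auto

lemma continuous_sph_slice:
  fixes f :: "real \<times> (real^'n) \<Rightarrow> real"
  assumes "continuous_on (cyl L) f" "r \<in> {0..L}" shows "continuous_on (- {0}) (\<lambda>x. f (r, x /\<^sub>R norm x))"
  by (rule continuous_on_compose2[OF assms(1)]) (use assms(2) in \<open>auto intro!: continuous_intros simp: cyl_def\<close>)

lemma sph_coeff_sum:
  fixes f :: "'i \<Rightarrow> real \<times> (real^'n) \<Rightarrow> real"
  assumes I: "finite I" and f: "\<And>i. i \<in> I \<Longrightarrow> continuous_on (cyl L) (f i)" and Y: "Y \<in> Harm e" and r: "r \<in> {0..L}"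
  shows "sph_coeff (\<lambda>q. \<Sum>i\<in>I. c i * f i q) Y r = (\<Sum>i\<in>I. c i * sph_coeff (f i) Y r)"
proof -
  have "sph_coeff (\<lambda>q. \<Sum>i\<in>I. c i * f i q) Y r = Isph (\<lambda>x. \<Sum>i\<in>I. c i * (f i (r, x /\<^sub>R norm x) * rad Y x))"
    by (simp add: sph_coeff_def sum_distrib_right mult.assoc)
  also have "\<dots> = (\<Sum>i\<in>I. Isph (\<lambda>x. c i * (f i (r, x /\<^sub>R norm x) * rad Y x)))"
    by (rule Isph_sum[OF I]) (intro continuous_intros continuous_sph_slice[OF f r] rad_continuous[OF Y])
  finally show ?thesis by (simp add: Isph_cmult sph_coeff_def)
qed

lemma sph_coeff_boundary:
  assumes "\<And>x. x \<in> sphere 0 1 \<Longrightarrow> f (r, x) = c * Y' x" shows "sph_coeff f Y r = c * sph_ip Y' Y"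
proof -
  have "sph_coeff f Y r = Isph (\<lambda>x. c * (rad Y' x * rad Y x))" unfolding sph_coeff_def
  proof (rule Isph_cong)
    fix x :: "real^'a" assume "x \<noteq> 0"
    then have "x /\<^sub>R norm x \<in> sphere 0 1" by simp
    from assms[OF this] show "f (r, x /\<^sub>R norm x) * rad Y x = c * (rad Y' x * rad Y x)" by (simp add: rad_def)
  qed
  then show ?thesis by (simp add: Isph_cmult sph_ip_def)
qed

text \<open>Vanishing against the basis \<open>onb e\<close> extends to its span, which is all of
  \<open>Harm e\<close>, and then \<open>Isph_complete\<close> applies to the slice.\<close>

lemma sph_coeff_complete:
  fixes f :: "real \<times> (real^'n) \<Rightarrow> real"
  assumes n: "CARD('n) \<ge> 3" and f: "continuous_on (cyl L) f" and r: "r \<in> {0..L}"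
    and z: "\<And>e Y. Y \<in> onb e \<Longrightarrow> sph_coeff f Y r = 0" and x: "x \<in> sphere 0 1"
  shows "f (r, x) = 0"
proof -
  define g where "g x = f (r, x /\<^sub>R norm x)" for x
  have gc: "continuous_on (- {0}) g" unfolding g_def by (rule continuous_sph_slice[OF f r])
  have x1: "norm x = 1" "x \<noteq> 0" using x by auto
  have "g x = 0"
  proof (rule Isph_complete[OF n gc _ _ x1(2)])
    show "hom0 g" by (auto simp: hom0_def g_def field_simps)
    fix e p assume "p \<in> (Harm e :: (real^'n \<Rightarrow> real) set)"
    then have "p \<in> fun_space.span (onb e)" by (simp add: span_onb)
    then have "p \<in> Harm e \<and> Isph (\<lambda>x. g x * rad p x) = 0"
    proof (induction rule: fun_space.span_induct_alt)
      case base
      show ?case using fun_space.subspace_0[OF subspace_Harm, of e] by (simp add: rad_def Isph_def zero_fun_def)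
    next
      case (step c Y p)
      have YH: "Y \<in> Harm e" using step(1) onb_Harm by blast
      have pH: "p \<in> Harm e" and p0: "Isph (\<lambda>x. g x * rad p x) = 0" using step(2) by auto
      have "Isph (\<lambda>x. c * (g x * rad Y x) + g x * rad p x) = Isph (\<lambda>x. c * (g x * rad Y x)) + Isph (\<lambda>x. g x * rad p x)"
        by (rule Isph_add) (intro continuous_intros gc rad_continuous[OF YH] rad_continuous[OF pH])+
      also have "\<dots> = 0"
      proof -
        have "Isph (\<lambda>x. g x * rad Y x) = 0" using z[OF step(1)] by (simp add: sph_coeff_def g_def)
        then show ?thesis by (simp add: Isph_cmult p0)
      qed
      finally have "Isph (\<lambda>x. g x * rad ((\<lambda>x. c * Y x) + p) x) = 0" by (simp add: rad_def algebra_simps)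
      then show ?case
        using fun_space.subspace_add[OF subspace_Harm fun_space.subspace_scale[OF subspace_Harm YH] pH] by blast
    qed
    then show "Isph (\<lambda>x. g x * rad p x) = 0" by simp
  qed
  then show ?thesis using x1 by (simp add: g_def)
qed

lemma ode_sum:
  assumes "finite I" "\<And>i. i \<in> I \<Longrightarrow> \<exists>p. ode A B l m (a i) p"
  shows "\<exists>p. ode A B l m (\<lambda>r. \<Sum>i\<in>I. c i * a i r) p"
  using assms
proof (induction I rule: finite_induct)
  case empty then show ?case using ode_zero by (intro exI[of _ "\<lambda>r. 0"]) simp
next
  case (insert i I)
  then obtain p q where "ode A B l m (a i) p" "ode A B l m (\<lambda>r. \<Sum>i\<in>I. c i * a i r) q" by blast
  from ode_combine[OF this, of "c i" 1] show ?case using insert(1,2) by auto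
qed

section \<open>The modes of a profile and their completeness\<close>

definition modes :: "(nat \<times> bool \<times> (real^'n \<Rightarrow> real)) set" where
  "modes = {(e, t, Y). Y \<in> onb e}"

definition mode_val :: "(nat \<Rightarrow> bool \<Rightarrow> real) \<Rightarrow> nat \<times> bool \<times> (real^'n \<Rightarrow> real) \<Rightarrow> real" where
  "mode_val v m = v (fst m) (fst (snd m))"

lemma finite_modes:
  assumes "finite {e. \<exists>t. v e t \<le> s}"
  shows "finite {m \<in> modes. mode_val v m \<le> s}"
proof (rule finite_subset)
  show "{m \<in> modes. mode_val v m \<le> s} \<subseteq> (SIGMA e:{e. \<exists>t. v e t \<le> s}. UNIV \<times> onb e)"
    by (auto simp: modes_def mode_val_def)
  show "finite (SIGMA e:{e. \<exists>t. v e t \<le> s}. (UNIV :: bool set) \<times> onb e)"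
    using assms by (intro finite_SigmaI finite_cartesian_product) auto
qed

context
  fixes h :: "real \<Rightarrow> real" and L :: real
  assumes n: "CARD('n::finite) \<ge> 3" and h: "revolution_profile L h" and L: "L > 0"
begin

definition mode_fun :: "nat \<times> bool \<times> (real^'n \<Rightarrow> real) \<Rightarrow> real \<times> (real^'n) \<Rightarrow> real" where
  "mode_fun m = (SOME f. f \<in> steklov_space h L (mode_val (dn_eig CARD('n) h L) m) \<and>
    (\<forall>x\<in>sphere 0 1. f (0, x) = fst (dn_vec CARD('n) h L (fst m) (fst (snd m))) * snd (snd m) x
      \<and> f (L, x) = snd (dn_vec CARD('n) h L (fst m) (fst (snd m))) * snd (snd m) x))"

lemma mode_fun:
  assumes "(e, t, Y) \<in> modes"
  shows "mode_fun (e, t, Y) \<in> steklov_space h L (dn_eig CARD('n) h L e t)"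
    "x \<in> sphere 0 1 \<Longrightarrow> mode_fun (e, t, Y) (0, x) = fst (dn_vec CARD('n) h L e t) * Y x"
    "x \<in> sphere 0 1 \<Longrightarrow> mode_fun (e, t, Y) (L, x) = snd (dn_vec CARD('n) h L e t) * Y x"
proof -
  have Y: "Y \<in> Harm e" using assms onb_Harm by (auto simp: modes_def)
  have "\<exists>f. f \<in> steklov_space h L (mode_val (dn_eig CARD('n) h L) (e, t, Y)) \<and>
    (\<forall>x\<in>sphere 0 1. f (0, x) = fst (dn_vec CARD('n) h L (fst (e, t, Y)) (fst (snd (e, t, Y)))) * snd (snd (e, t, Y)) x
      \<and> f (L, x) = snd (dn_vec CARD('n) h L (fst (e, t, Y)) (fst (snd (e, t, Y)))) * snd (snd (e, t, Y)) x)"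
    using mode_function[OF n h L Y, of t] by (auto simp: mode_val_def)
  from someI_ex[OF this, folded mode_fun_def]
  show "mode_fun (e, t, Y) \<in> steklov_space h L (dn_eig CARD('n) h L e t)"
    "x \<in> sphere 0 1 \<Longrightarrow> mode_fun (e, t, Y) (0, x) = fst (dn_vec CARD('n) h L e t) * Y x"
    "x \<in> sphere 0 1 \<Longrightarrow> mode_fun (e, t, Y) (L, x) = snd (dn_vec CARD('n) h L e t) * Y x"
    by (auto simp: mode_val_def)
qed

lemma mode_fun_space: "m \<in> modes \<Longrightarrow> mode_fun m \<in> steklov_space h L (mode_val (dn_eig CARD('n) h L) m)"
  using mode_fun(1) by (cases m) (simp add: mode_val_def)

lemma steklov_space_continuous: "f \<in> steklov_space h L \<sigma> \<Longrightarrow> continuous_on (cyl L) f"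
  by (auto simp: steklov_space_def harmonic_on_cyl_def intro: smooth_on_continuous)

text \<open>The functional dual to \<open>mode_fun\<close>: the spherical coefficients of the two
  boundary traces, resolved along the eigenvectors of that degree.\<close>

definition mode_coord :: "(real \<times> (real^'n) \<Rightarrow> real) \<Rightarrow> nat \<times> bool \<times> (real^'n \<Rightarrow> real) \<Rightarrow> real" where
  "mode_coord f m = coord (dn_vec CARD('n) h L (fst m)) (fst (snd m)) (sph_coeff f (snd (snd m)) 0) (sph_coeff f (snd (snd m)) L)"

lemma L_mem: "0 \<in> {0..L}" "L \<in> {0..L}" using L by auto

lemma mode_coord_sum:
  assumes "finite I" "\<And>i. i \<in> I \<Longrightarrow> continuous_on (cyl L) (f i)" "m \<in> modes"
  shows "mode_coord (\<lambda>q. \<Sum>i\<in>I. c i * f i q) m = (\<Sum>i\<in>I. c i * mode_coord (f i) m)"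
proof -
  obtain e t Y where m: "m = (e, t, Y)" by (metis prod_cases3)
  have Y: "Y \<in> Harm e" using assms(3) onb_Harm by (auto simp: modes_def m)
  have "sph_coeff (\<lambda>q. \<Sum>i\<in>I. c i * f i q) Y r = (\<Sum>i\<in>I. c i * sph_coeff (f i) Y r)" if "r \<in> {0..L}" for r
    by (rule sph_coeff_sum[OF assms(1,2) Y that])
  from this[OF L_mem(1)] this[OF L_mem(2)] show ?thesis
    unfolding mode_coord_def m fst_conv snd_conv coord_def
    by (simp add: sum_distrib_right sum.distrib distrib_left mult.assoc)
qed

lemma mode_coord_mode_fun:
  assumes m: "m \<in> modes" "m' \<in> modes"
  shows "mode_coord (mode_fun m') m = (if m = m' then 1 else 0)"
proof -
  obtain e t Y where me: "m = (e, t, Y)" by (metis prod_cases3)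
  obtain e' t' Y' where me': "m' = (e', t', Y')" by (metis prod_cases3)
  have Y: "Y \<in> onb e" "Y' \<in> onb e'" using m by (auto simp: modes_def me me')
  note b = sph_coeff_boundary[of "mode_fun m'" 0 _ Y' Y, OF mode_fun(2)[OF m(2)[unfolded me'], folded me']]
    sph_coeff_boundary[of "mode_fun m'" L _ Y' Y, OF mode_fun(3)[OF m(2)[unfolded me'], folded me']]
  have ip: "sph_ip Y' Y = (if e' = e \<and> Y' = Y then 1 else 0)" by (rule sph_ip_onb[OF n Y(2,1)])
  show ?thesis
  proof (cases "e' = e \<and> Y' = Y")
    case True
    then show ?thesis
      using coord_w[OF dn_data_eig[OF n revolution_profile_pos[OF h L], of e], of t t'] ip b
      by (simp add: mode_coord_def me me')
  next
    case False
    then have "sph_ip Y' Y = 0" using ip by simp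
    then have "mode_coord (mode_fun m') m = 0" using b by (simp add: mode_coord_def me coord_def)
    then show ?thesis using False by (auto simp: me me')
  qed
qed

text \<open>The spherical coefficient of \<open>f\<close> solves the mode equation, and its outward
  derivatives are \<open>\<sigma>\<close> times its boundary values. The coordinate is therefore
  multiplied by \<open>\<sigma>\<close> and by the eigenvalue of the mode alike.\<close>

lemma mode_coord_eigen:
  assumes f: "f \<in> steklov_space h L \<sigma>" and m: "m \<in> modes" and ne: "mode_val (dn_eig CARD('n) h L) m \<noteq> \<sigma>"
  shows "mode_coord f m = 0"
proof -
  obtain e t Y where me: "m = (e, t, Y)" by (metis prod_cases3)
  have Y: "Y \<in> Harm e" using m onb_Harm by (auto simp: modes_def me)
  have "harmonic_on_cyl h L f" "steklov_condition L \<sigma> f" using f by (auto simp: steklov_space_def)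
  with modal_ode[OF n h L Y, of f] obtain p where p: "ode (mode_A CARD('n) h) (mode_B CARD('n) e h) 0 L (sph_coeff f Y) p"
    "- p 0 = \<sigma> * sph_coeff f Y 0" "p L = \<sigma> * sph_coeff f Y L" by blast
  define w where "w = dn_vec CARD('n) h L e"
  have "coord w t (\<sigma> * sph_coeff f Y 0) (\<sigma> * sph_coeff f Y L) = dn_eig CARD('n) h L e t * coord w t (sph_coeff f Y 0) (sph_coeff f Y L)"
    using dn_dataD(4)[OF dn_data_eig[OF n revolution_profile_pos[OF h L]] p(1), of t] unfolding p(2,3) w_def .
  moreover have "coord w t (\<sigma> * sph_coeff f Y 0) (\<sigma> * sph_coeff f Y L) = \<sigma> * coord w t (sph_coeff f Y 0) (sph_coeff f Y L)"
    by (simp add: coord_def distrib_left mult.assoc)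
  ultimately have "\<sigma> * mode_coord f m = dn_eig CARD('n) h L e t * mode_coord f m"
    by (simp only: mode_coord_def me w_def fst_conv snd_conv)
  then show ?thesis using ne by (auto simp: me mode_val_def)
qed

text \<open>The difference of \<open>f\<close> and its expansion has vanishing mode coordinates.
  Each of its spherical coefficients thus solves the mode equation with zero boundary values and is
  zero by Dirichlet uniqueness; completeness of the harmonics makes the difference zero on every
  slice.\<close>

lemma steklov_space_eq_combination:
  assumes f: "f \<in> steklov_space h L \<sigma>" and fin: "finite {m \<in> (modes :: (nat \<times> bool \<times> (real^'n \<Rightarrow> real)) set). mode_val (dn_eig CARD('n) h L) m = \<sigma>}"
  shows "f = (\<lambda>q. \<Sum>m | m \<in> modes \<and> mode_val (dn_eig CARD('n) h L) m = \<sigma>. mode_coord f m * mode_fun m q)"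
proof -
  define M where "M = {m \<in> (modes :: (nat \<times> bool \<times> (real^'n \<Rightarrow> real)) set). mode_val (dn_eig CARD('n) h L) m = \<sigma>}"
  have fM: "finite M" using fin by (simp add: M_def)
  \<comment> \<open>Indexing \<open>f\<close> together with the modes by an option type makes the
    difference one linear combination, to which \<open>mode_coord_sum\<close> and
    \<open>ode_sum\<close> apply directly.\<close>
  define G where "G i = (case i of None \<Rightarrow> f | Some m \<Rightarrow> mode_fun m)" for i
  define c where "c i = (case i of None \<Rightarrow> 1 | Some m \<Rightarrow> - mode_coord f m)" for i
  define I where "I = insert None (Some ` M)"
  have fI: "finite I" using fM by (simp add: I_def)
  have GS: "G i \<in> steklov_space h L \<sigma>" if "i \<in> I" for i
    using that f mode_fun_space by (auto simp: I_def G_def M_def)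
  have Gc: "continuous_on (cyl L) (G i)" if "i \<in> I" for i using steklov_space_continuous[OF GS[OF that]] .
  define F where "F q = (\<Sum>i\<in>I. c i * G i q)" for q
  have F_eq: "F q = f q - (\<Sum>m\<in>M. mode_coord f m * mode_fun m q)" for q
  proof -
    have "F q = f q + (\<Sum>i\<in>Some ` M. c i * G i q)" unfolding F_def I_def using fM by (subst sum.insert) (auto simp: c_def G_def)
    also have "(\<Sum>i\<in>Some ` M. c i * G i q) = (\<Sum>m\<in>M. - (mode_coord f m * mode_fun m q))"
      by (subst sum.reindex) (auto simp: c_def G_def)
    finally show ?thesis by (simp add: sum_negf)
  qed
  have coord0: "mode_coord F m = 0" if m: "m \<in> modes" for m
  proof -
    have "mode_coord F m = (\<Sum>i\<in>I. c i * mode_coord (G i) m)"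
      unfolding F_def by (rule mode_coord_sum[OF fI Gc m])
    also have "\<dots> = mode_coord f m + (\<Sum>i\<in>Some ` M. c i * mode_coord (G i) m)"
      unfolding I_def using fM by (subst sum.insert) (auto simp: c_def G_def)
    also have "(\<Sum>i\<in>Some ` M. c i * mode_coord (G i) m) = (\<Sum>m'\<in>M. - mode_coord f m' * mode_coord (mode_fun m') m)"
      by (subst sum.reindex) (auto simp: c_def G_def)
    also have "\<dots> = (\<Sum>m'\<in>M. if m = m' then - mode_coord f m' else 0)"
      by (rule sum.cong) (auto simp: mode_coord_mode_fun[OF m] M_def)
    also have "\<dots> = (if m \<in> M then - mode_coord f m else 0)" using fM by simp
    finally show ?thesis using mode_coord_eigen[OF f m] m by (auto simp: M_def split: if_splits)
  qed
  have "F (r, x) = 0" if r: "r \<in> {0..L}" and x: "x \<in> sphere 0 1" for r x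
  proof (rule sph_coeff_complete[OF n _ r _ x])
    show "continuous_on (cyl L) F" unfolding F_def by (intro continuous_intros Gc)
    fix e Y assume Yo: "Y \<in> (onb e :: (real^'n \<Rightarrow> real) set)"
    then have Y: "Y \<in> Harm e" using onb_Harm by blast
    note d = dn_data_eig[OF n revolution_profile_pos[OF h L], of e]
    have S: "sph_coeff F Y r = (\<Sum>i\<in>I. c i * sph_coeff (G i) Y r)" if "r \<in> {0..L}" for r
      unfolding F_def by (rule sph_coeff_sum[OF fI Gc Y that])
    have "\<exists>p. ode (mode_A CARD('n) h) (mode_B CARD('n) e h) 0 L (sph_coeff (G i) Y) p" if "i \<in> I" for i
      using modal_ode[OF n h L Y, of "G i"] GS[OF that] by (auto simp: steklov_space_def)
    then obtain p where p: "ode (mode_A CARD('n) h) (mode_B CARD('n) e h) 0 L (\<lambda>r. \<Sum>i\<in>I. c i * sph_coeff (G i) Y r) p"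
      using ode_sum[OF fI, where a = "\<lambda>i. sph_coeff (G i) Y" and c = c] by blast
    have "coord (dn_vec CARD('n) h L e) t (sph_coeff F Y 0) (sph_coeff F Y L) = coord (dn_vec CARD('n) h L e) t 0 0" for t
      using coord0[of "(e, t, Y)"] Yo by (simp add: modes_def mode_coord_def coord_def)
    note z = coord_inject[OF d this]
    have "(\<Sum>i\<in>I. c i * sph_coeff (G i) Y r) = 0"
    proof (rule ode_dirichlet_unique(1)[OF p L _ _ _ _ r])
      show "0 < mode_A CARD('n) h s" if "0 < s" "s < L" for s
        by (rule pos_profile_coeffs(1)[OF n revolution_profile_pos[OF h L]]) (use that in simp)
      show "0 \<le> mode_B CARD('n) e h s" if "0 < s" "s < L" for s
        by (rule pos_profile_coeffs(3)[OF n revolution_profile_pos[OF h L]]) (use that in simp)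
      show "(\<Sum>i\<in>I. c i * sph_coeff (G i) Y 0) = 0" using S[OF L_mem(1)] z(1) by simp
      show "(\<Sum>i\<in>I. c i * sph_coeff (G i) Y L) = 0" using S[OF L_mem(2)] z(2) by simp
    qed
    then show "sph_coeff F Y r = 0" using S[OF r] by simp
  qed
  then have "f q = (\<Sum>m\<in>M. mode_coord f m * mode_fun m q)" for q
  proof (cases "q \<in> cyl L")
    case True
    then show ?thesis using \<open>\<And>r x. r \<in> {0..L} \<Longrightarrow> x \<in> sphere 0 1 \<Longrightarrow> F (r, x) = 0\<close>[of "fst q" "snd q"] F_eq[of q]
      by (auto simp: cyl_def)
  next
    case False
    have "mode_fun m q = 0" if "m \<in> M" for m
      using GS[of "Some m"] that False by (cases q) (auto simp: steklov_space_def G_def I_def)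
    then show ?thesis using f False by (cases q) (simp add: steklov_space_def)
  qed
  then show ?thesis by (auto simp: M_def)
qed

text \<open>The mode functions of this eigenvalue span the eigenspace by the expansion, and the dual
  functionals \<open>mode_coord\<close> show that they are independent.\<close>

lemma steklov_multiplicity_eq:
  assumes fin: "finite {m \<in> (modes :: (nat \<times> bool \<times> (real^'n \<Rightarrow> real)) set). mode_val (dn_eig CARD('n) h L) m = \<sigma>}"
  shows "steklov_multiplicity TYPE('n) h L \<sigma> = card {m \<in> (modes :: (nat \<times> bool \<times> (real^'n \<Rightarrow> real)) set). mode_val (dn_eig CARD('n) h L) m = \<sigma>}"
proof -
  define M where "M = {m \<in> (modes :: (nat \<times> bool \<times> (real^'n \<Rightarrow> real)) set). mode_val (dn_eig CARD('n) h L) m = \<sigma>}"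
  have fM: "finite M" using fin by (simp add: M_def)
  have MS: "mode_fun m \<in> steklov_space h L \<sigma>" if "m \<in> M" for m
    using mode_fun_space[of m] that by (auto simp: M_def)
  have Mm: "m \<in> modes" if "m \<in> M" for m using that by (simp add: M_def)
  have inj: "inj_on mode_fun M"
  proof
    fix m m' assume m: "m \<in> M" "m' \<in> M" "mode_fun m = mode_fun m'"
    show "m = m'" using mode_coord_mode_fun[OF Mm[OF m(1)] Mm[OF m(2)]] mode_coord_mode_fun[OF Mm[OF m(1)] Mm[OF m(1)]] m(3)
      by (metis zero_neq_one)
  qed
  have "fun_space.dim (steklov_space h L \<sigma> :: (real \<times> (real^'n) \<Rightarrow> real) set) = card M"
  proof (rule fun_space.dim_unique)
    show "mode_fun ` M \<subseteq> steklov_space h L \<sigma>" using MS by blast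
    show "steklov_space h L \<sigma> \<subseteq> fun_space.span (mode_fun ` M)"
    proof
      fix f assume f: "f \<in> (steklov_space h L \<sigma> :: (real \<times> (real^'n) \<Rightarrow> real) set)"
      have "(\<Sum>m\<in>M. (\<lambda>q. mode_coord f m * mode_fun m q)) \<in> fun_space.span (mode_fun ` M)"
        by (intro fun_space.span_sum fun_space.span_scale fun_space.span_base) blast
      moreover have "(\<Sum>m\<in>M. (\<lambda>q. mode_coord f m * mode_fun m q)) = f"
        using steklov_space_eq_combination[OF f fin] by (auto simp: M_def fun_eq_iff sum_fun_eval)
      ultimately show "f \<in> fun_space.span (mode_fun ` M)" by simp
    qed
    show "fun_space.independent (mode_fun ` M)"
    proof (rule fun_space.independent_if_scalars_zero)
      fix c f assume z: "(\<Sum>x\<in>mode_fun ` M. (\<lambda>q. c x * x q)) = 0" and f: "f \<in> mode_fun ` M"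
      then obtain m where m: "m \<in> M" "f = mode_fun m" by blast
      have "(\<lambda>q. \<Sum>m\<in>M. c (mode_fun m) * mode_fun m q) = (\<lambda>q. 0)"
        using z by (simp add: sum.reindex[OF inj] fun_eq_iff sum_fun_eval)
      then have "mode_coord (\<lambda>q. \<Sum>m\<in>M. c (mode_fun m) * mode_fun m q) m = mode_coord (\<lambda>q. 0) m" by simp
      moreover have "mode_coord (\<lambda>q. 0) m = 0" by (simp add: mode_coord_def sph_coeff_def coord_def Isph_def)
      ultimately have "0 = (\<Sum>m'\<in>M. c (mode_fun m') * mode_coord (mode_fun m') m)"
        using mode_coord_sum[OF fM steklov_space_continuous[OF MS] Mm[OF m(1)], where c = "\<lambda>m. c (mode_fun m)"] by simp
      also have "\<dots> = (\<Sum>m'\<in>M. if m = m' then c (mode_fun m') else 0)"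
        by (rule sum.cong) (auto simp: mode_coord_mode_fun[OF Mm[OF m(1)] Mm])
      also have "\<dots> = c f" using fM m by simp
      finally show "c f = 0" by simp
    qed (use fM in simp)
    show "card (mode_fun ` M) = card M" by (rule card_image[OF inj])
  qed
  then show ?thesis by (simp add: steklov_multiplicity_def M_def)
qed

text \<open>A nonzero eigenfunction has a nonempty expansion, and conversely every mode function is
  nonzero because its own coordinate is 1.\<close>

lemma steklov_spectrum_eq:
  assumes fin: "\<And>\<sigma>. finite {m \<in> (modes :: (nat \<times> bool \<times> (real^'n \<Rightarrow> real)) set). mode_val (dn_eig CARD('n) h L) m = \<sigma>}"
  shows "steklov_spectrum TYPE('n) h L = mode_val (dn_eig CARD('n) h L) ` (modes :: (nat \<times> bool \<times> (real^'n \<Rightarrow> real)) set)"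
proof (intro subset_antisym subsetI)
  fix \<sigma> assume "\<sigma> \<in> steklov_spectrum TYPE('n) h L"
  then obtain f where f: "f \<in> (steklov_space h L \<sigma> :: (real \<times> (real^'n) \<Rightarrow> real) set)" "f \<noteq> (\<lambda>_. 0)"
    by (auto simp: steklov_spectrum_def)
  have "{m \<in> (modes :: (nat \<times> bool \<times> (real^'n \<Rightarrow> real)) set). mode_val (dn_eig CARD('n) h L) m = \<sigma>} \<noteq> {}"
  proof
    assume e: "{m \<in> (modes :: (nat \<times> bool \<times> (real^'n \<Rightarrow> real)) set). mode_val (dn_eig CARD('n) h L) m = \<sigma>} = {}"
    show False using steklov_space_eq_combination[OF f(1) fin] f(2) unfolding e by simp
  qed
  then show "\<sigma> \<in> mode_val (dn_eig CARD('n) h L) ` (modes :: (nat \<times> bool \<times> (real^'n \<Rightarrow> real)) set)" by blast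
next
  fix \<sigma> assume "\<sigma> \<in> mode_val (dn_eig CARD('n) h L) ` (modes :: (nat \<times> bool \<times> (real^'n \<Rightarrow> real)) set)"
  then obtain m where m: "m \<in> (modes :: (nat \<times> bool \<times> (real^'n \<Rightarrow> real)) set)" "\<sigma> = mode_val (dn_eig CARD('n) h L) m" by blast
  have "mode_fun m \<in> steklov_space h L \<sigma>" using mode_fun_space[OF m(1)] m(2) by simp
  moreover have "mode_fun m \<noteq> (\<lambda>_. 0)"
  proof
    assume "mode_fun m = (\<lambda>_. 0)"
    then have "mode_coord (mode_fun m) m = 0" by (simp add: mode_coord_def sph_coeff_def coord_def Isph_def)
    then show False using mode_coord_mode_fun[OF m(1) m(1)] by simp
  qed
  ultimately show "\<sigma> \<in> steklov_spectrum TYPE('n) h L" by (auto simp: steklov_spectrum_def)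
qed

end

section \<open>Counting eigenvalues\<close>

text \<open>The increasing enumeration with multiplicity, indexed from 0, expressed through the
  counting function. This form determines \<open>s\<close>, and comparing ordered values becomes
  comparing sublevel sets.\<close>

definition kth_values :: "'m set \<Rightarrow> ('m \<Rightarrow> real) \<Rightarrow> (nat \<Rightarrow> real) \<Rightarrow> bool" where
  "kth_values A f s \<longleftrightarrow> (\<forall>k t. s k \<le> t \<longleftrightarrow> k < card {m \<in> A. f m \<le> t})"

lemma kth_valuesD: "kth_values A f s \<Longrightarrow> s k \<le> t \<longleftrightarrow> k < card {m \<in> A. f m \<le> t}"
  by (simp add: kth_values_def)

lemma sublevel_attained:
  assumes "finite {m \<in> A. f m \<le> t}" "{m \<in> A. f m \<le> t} \<noteq> {}"
  obtains m where "m \<in> A" "f m \<le> t" "{m' \<in> A. f m' \<le> f m} = {m' \<in> A. f m' \<le> (t::real)}"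
proof -
  have "Max (f ` {m \<in> A. f m \<le> t}) \<in> f ` {m \<in> A. f m \<le> t}" using assms by (intro Max_in) auto
  then obtain m where m: "m \<in> A" "f m \<le> t" "f m = Max (f ` {m \<in> A. f m \<le> t})" by auto
  have "f m' \<le> f m" if "m' \<in> A" "f m' \<le> t" for m' unfolding m(3) using assms that by (intro Max_ge) auto
  then have "{m' \<in> A. f m' \<le> f m} = {m' \<in> A. f m' \<le> t}" using m(2) by (auto intro: order_trans)
  with m(1,2) show ?thesis by (rule that)
qed

text \<open>The \<open>k\<close>-th value is the least value of \<open>f\<close> whose sublevel set
  has more than \<open>k\<close> elements. The minimum exists because candidates can be confined
  below a level \<open>T\<close> that already has enough elements.\<close>

lemma kth_values_exists:
  assumes fin: "\<And>t. finite {m \<in> A. f m \<le> t}" and inf: "infinite A"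
  shows "\<exists>s. kth_values A f s"
proof -
  have "\<exists>v. \<forall>t. v \<le> t \<longleftrightarrow> k < card {m \<in> A. f m \<le> t}" for k
  proof -
    obtain F where F: "F \<subseteq> A" "finite F" "card F = Suc k" using infinite_arbitrarily_large[OF inf] by blast
    define T where "T = Max (f ` F)"
    have "F \<subseteq> {m \<in> A. f m \<le> T}" using F by (auto simp: T_def)
    from card_mono[OF fin this] have T: "k < card {m \<in> A. f m \<le> T}" using F by simp
    define W where "W = {v \<in> f ` {m \<in> A. f m \<le> T}. k < card {m \<in> A. f m \<le> v}}"
    have W: "\<exists>v\<in>W. v \<le> t" if t: "k < card {m \<in> A. f m \<le> t}" "t \<le> T" for t
    proof -
      have "{m \<in> A. f m \<le> t} \<noteq> {}" using t(1) by (intro notI) simp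
      then obtain m where m: "m \<in> A" "f m \<le> t" "{m' \<in> A. f m' \<le> f m} = {m' \<in> A. f m' \<le> t}"
        using sublevel_attained[OF fin] by blast
      then have "f m \<in> W" using t by (auto simp: W_def)
      then show ?thesis using m(2) by blast
    qed
    have fW: "finite W" "W \<noteq> {}" using fin[of T] W[OF T] by (auto simp: W_def)
    note MW = Min_in[OF fW]
    have "Min W \<le> t \<longleftrightarrow> k < card {m \<in> A. f m \<le> t}" for t
    proof
      assume le: "Min W \<le> t"
      have "k < card {m \<in> A. f m \<le> Min W}" using MW by (simp add: W_def)
      also have "\<dots> \<le> card {m \<in> A. f m \<le> t}" using le by (intro card_mono[OF fin]) auto
      finally show "k < card {m \<in> A. f m \<le> t}" .
    next
      assume k: "k < card {m \<in> A. f m \<le> t}"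
      show "Min W \<le> t"
      proof (cases "t \<le> T")
        case True
        then show ?thesis using W[OF k] Min_le[OF fW(1)] order_trans by blast
      next
        case False
        have "Min W \<le> T" using MW by (auto simp: W_def)
        then show ?thesis using False by simp
      qed
    qed
    then show ?thesis by blast
  qed
  then show ?thesis unfolding kth_values_def by metis
qed

lemma kth_values_unique: assumes "kth_values A f s" "kth_values A f s'" shows "s = s'"
proof
  fix k
  have "s k \<le> t \<longleftrightarrow> s' k \<le> t" for t using assms by (simp add: kth_values_def)
  from this[of "s k"] this[of "s' k"] show "s k = s' k" by simp
qed

lemma kth_values_mono:
  assumes s: "kth_values A f s" "kth_values A g s'" and fin: "\<And>t. finite {m \<in> A. f m \<le> t}" and le: "\<And>m. m \<in> A \<Longrightarrow> f m \<le> g m"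
  shows "s k \<le> s' k"
proof -
  have "k < card {m \<in> A. g m \<le> s' k}" using kth_valuesD[OF s(2), of k "s' k"] by simp
  also have "\<dots> \<le> card {m \<in> A. f m \<le> s' k}" by (intro card_mono[OF fin]) (auto intro: order_trans[OF le])
  finally show ?thesis using kth_valuesD[OF s(1)] by simp
qed

lemma kth_values_scale: assumes "kth_values A f s" "c > 0" shows "kth_values A (\<lambda>m. c * f m) (\<lambda>k. c * s k)"
proof -
  have "c * x \<le> t \<longleftrightarrow> x \<le> t / c" for x t using assms(2) by (simp add: field_simps)
  then show ?thesis using assms(1) by (simp add: kth_values_def)
qed

text \<open>The finitely many values below \<open>t\<close> have a maximum \<open>v < t\<close>, so
  the strict sublevel set at \<open>t\<close> lies in the closed one at \<open>v\<close>.\<close>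

lemma kth_values_less:
  assumes s: "kth_values A f s" and fin: "\<And>t. finite {m \<in> A. f m \<le> t}"
  shows "s k < t \<longleftrightarrow> k < card {m \<in> A. f m < t}"
proof
  have fin': "finite {m \<in> A. f m < t}" by (rule finite_subset[OF _ fin[of t]]) auto
  assume "s k < t"
  then have "card {m \<in> A. f m \<le> s k} \<le> card {m \<in> A. f m < t}" by (intro card_mono[OF fin']) auto
  moreover have "k < card {m \<in> A. f m \<le> s k}" using kth_valuesD[OF s, of k "s k"] by simp
  ultimately show "k < card {m \<in> A. f m < t}" by simp
next
  have fin': "finite {m \<in> A. f m < t}" by (rule finite_subset[OF _ fin[of t]]) auto
  assume k: "k < card {m \<in> A. f m < t}"
  then have ne: "{m \<in> A. f m < t} \<noteq> {}" by (intro notI) simp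
  define v where "v = Max (f ` {m \<in> A. f m < t})"
  have "v \<in> f ` {m \<in> A. f m < t}" unfolding v_def using fin' ne by (intro Max_in) auto
  then have vt: "v < t" by auto
  have "f m \<le> v" if "m \<in> A" "f m < t" for m unfolding v_def using fin' that by (intro Max_ge) auto
  then have "card {m \<in> A. f m < t} \<le> card {m \<in> A. f m \<le> v}" by (intro card_mono[OF fin]) auto
  then have "s k \<le> v" using k kth_valuesD[OF s] by simp
  then show "s k < t" using vt by simp
qed

lemma kth_values_fibre:
  assumes s: "kth_values A f s" and fin: "\<And>t. finite {m \<in> A. f m \<le> t}"
  shows "card {k. s k = t} = card {m \<in> A. f m = t}"
proof -
  have sub: "{m \<in> A. f m < t} \<subseteq> {m \<in> A. f m \<le> t}" by auto
  define a b where "a = card {m \<in> A. f m \<le> t}" and "b = card {m \<in> A. f m < t}"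
  have "s k = t \<longleftrightarrow> k < a \<and> \<not> k < b" for k
    unfolding a_def b_def kth_valuesD[OF s, symmetric] kth_values_less[OF s fin, symmetric] by auto
  then have "{k. s k = t} = {..<a} - {..<b}" by blast
  also have "card \<dots> = a - b"
    using card_mono[OF fin sub, folded a_def b_def] by (subst card_Diff_subset) simp_all
  also have "\<dots> = card ({m \<in> A. f m \<le> t} - {m \<in> A. f m < t})" unfolding a_def b_def
    by (rule card_Diff_subset[symmetric, OF finite_subset[OF sub fin] sub])
  also have "{m \<in> A. f m \<le> t} - {m \<in> A. f m < t} = {m \<in> A. f m = t}" by auto
  finally show ?thesis .
qed

text \<open>An equivalence, because \<open>steklov_eigenvalue\<close> is a definite description. For
  a Steklov sequence the number of indices with \<open>s k \<le> t\<close> is the sum of the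
  multiplicities up to \<open>t\<close>, which is the counting function of \<open>f\<close>;
  monotonicity makes these indices an initial segment.\<close>

lemma steklov_sequence_iff_kth_values:
  assumes spec: "steklov_spectrum N h L = f ` A"
    and mult: "\<And>\<sigma>. steklov_multiplicity N h L \<sigma> = card {m \<in> A. f m = \<sigma>}" and fin: "\<And>t. finite {m \<in> A. f m \<le> t}"
  shows "steklov_sequence N h L s \<longleftrightarrow> kth_values A f s"
proof
  assume s: "kth_values A f s"
  have mono: "mono s"
  proof (rule mono_iff_le_Suc[THEN iffD2], rule allI)
    fix k
    have "Suc k < card {m \<in> A. f m \<le> s (Suc k)}" using kth_valuesD[OF s, of "Suc k" "s (Suc k)"] by simp
    then show "s k \<le> s (Suc k)" using kth_valuesD[OF s, of k "s (Suc k)"] by simp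
  qed
  have top: "filterlim s at_top sequentially" unfolding filterlim_at_top eventually_sequentially
  proof (intro allI exI impI)
    fix Z k assume "card {m \<in> A. f m \<le> Z} \<le> k"
    then show "Z \<le> s k" using kth_valuesD[OF s, of k Z] by simp
  qed
  have fin_eq: "finite {m \<in> A. f m = t}" for t by (rule finite_subset[OF _ fin[of t]]) auto
  have "range s = f ` A"
  proof (intro subset_antisym subsetI)
    fix t assume "t \<in> range s"
    then have "{k. s k = t} \<noteq> {}" by auto
    moreover have "{k. s k = t} \<subseteq> {..<card {m \<in> A. f m \<le> t}}" by (auto simp: kth_valuesD[OF s, symmetric])
    then have "finite {k. s k = t}" using finite_subset by blast
    ultimately have "card {m \<in> A. f m = t} > 0" unfolding kth_values_fibre[OF s fin, symmetric] by (simp add: card_gt_0_iff)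
    then show "t \<in> f ` A" by (auto simp: card_gt_0_iff)
  next
    fix t assume "t \<in> f ` A"
    then have "card {m \<in> A. f m = t} > 0" using fin_eq by (auto simp: card_gt_0_iff)
    then have "{k. s k = t} \<noteq> {}" unfolding kth_values_fibre[OF s fin, symmetric] by (auto simp: card_gt_0_iff)
    then show "t \<in> range s" by auto
  qed
  then show "steklov_sequence N h L s"
    using mono top by (simp add: steklov_sequence_def spec mult kth_values_fibre[OF s fin])
next
  assume st: "steklov_sequence N h L s"
  then have mono: "mono s" and top: "filterlim s at_top sequentially" and ran: "range s = f ` A"
    and mu: "\<And>\<sigma>. \<sigma> \<in> f ` A \<Longrightarrow> card {k. s k = \<sigma>} = card {m \<in> A. f m = \<sigma>}"
    by (auto simp: steklov_sequence_def spec mult)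
  show "kth_values A f s" unfolding kth_values_def
  proof (intro allI)
    fix k t
    obtain K where K: "\<And>k. k \<ge> K \<Longrightarrow> t + 1 \<le> s k"
      using top unfolding filterlim_at_top eventually_sequentially by meson
    have "{k. s k \<le> t} \<subseteq> {..<K}"
    proof
      fix k assume "k \<in> {k. s k \<le> t}"
      then show "k \<in> {..<K}" using K[of k] by (cases "K \<le> k") auto
    qed
    then have finS: "finite {k. s k \<le> t}" using finite_subset by blast
    define V where "V = f ` {m \<in> A. f m \<le> t}"
    have fV: "finite V" using fin by (simp add: V_def)
    have fin_s: "finite {k. s k = v}" if "v \<in> V" for v
      by (rule finite_subset[OF _ finS]) (use that in \<open>auto simp: V_def\<close>)
    have fin_f: "finite {m \<in> A. f m = v}" if "v \<in> V" for v by (rule finite_subset[OF _ fin[of v]]) auto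
    have "{k. s k \<le> t} = (\<Union>v\<in>V. {k. s k = v})" using ran by (auto simp: V_def) (metis (mono_tags, lifting) imageE image_eqI mem_Collect_eq rangeI)
    then have "card {k. s k \<le> t} = (\<Sum>v\<in>V. card {k. s k = v})"
      using card_UN_disjoint[OF fV, of "\<lambda>v. {k. s k = v}"] fin_s by auto
    also have "\<dots> = (\<Sum>v\<in>V. card {m \<in> A. f m = v})" by (rule sum.cong) (auto intro!: mu simp: V_def)
    also have "\<dots> = card (\<Union>v\<in>V. {m \<in> A. f m = v})"
      using fin_f by (subst card_UN_disjoint[OF fV]) auto
    also have "(\<Union>v\<in>V. {m \<in> A. f m = v}) = {m \<in> A. f m \<le> t}" by (auto simp: V_def)
    finally have c: "card {k. s k \<le> t} = card {m \<in> A. f m \<le> t}" .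
    show "s k \<le> t \<longleftrightarrow> k < card {m \<in> A. f m \<le> t}" unfolding c[symmetric]
    proof
      assume "s k \<le> t"
      then have "{..k} \<subseteq> {k. s k \<le> t}" using monoD[OF mono] by (auto intro: order_trans)
      from card_mono[OF finS this] show "k < card {k. s k \<le> t}" by simp
    next
      assume k: "k < card {k. s k \<le> t}"
      show "s k \<le> t"
      proof (rule ccontr)
        assume n: "\<not> s k \<le> t"
        have "{j. s j \<le> t} \<subseteq> {..<k}"
        proof
          fix j assume "j \<in> {j. s j \<le> t}"
          then show "j \<in> {..<k}" using n monoD[OF mono, of k j] by (cases "k \<le> j") auto
        qed
        from card_mono[OF _ this] k show False by simp
      qed
    qed
  qed
qed

section \<open>Dependence of the tent eigenvalues on length and degree\<close>

lemma growth_mono: "L > 0 \<Longrightarrow> L \<le> L' \<Longrightarrow> growth n e L \<le> growth n e L'"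
  unfolding growth_def by (rule power_mono) auto

text \<open>Here \<open>growth\<close> occurs in the denominator alone, so monotonicity in
  \<open>L\<close> and the distance to \<open>e + n - 2\<close> can be read off.\<close>

lemma tent_N_eq:
  assumes n: "n \<ge> 3" and L: "L > 0"
  shows "tent_N n e L = (real e + real n - 2) - (real e + real n - 2) * (real e + (real e + real n - 2)) / (real e + real n - 2 + real e * growth n e L)"
    and "real e + real n - 2 + real e * growth n e L > 0"
proof -
  have "real e * growth n e L \<ge> 0" using growth_gt_1[OF n L, of e] by simp
  then show K: "real e + real n - 2 + real e * growth n e L > 0" using n by simp
  have "x * b * (T - 1) / (b + x * T) = b - b * (x + b) / (b + x * T)" if "b + x * T > 0" for b x T :: real
    using that by (simp add: field_simps)
  from this[OF K] show "tent_N n e L = (real e + real n - 2) - (real e + real n - 2) * (real e + (real e + real n - 2)) / (real e + real n - 2 + real e * growth n e L)"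
    by (simp only: tent_N_def)
qed

lemma tent_D_eq:
  assumes n: "n \<ge> 3" and L: "L > 0"
  shows "tent_D n e L = (real e + real n - 2) + (real e + (real e + real n - 2)) / (growth n e L - 1)"
proof -
  have "growth n e L - 1 > 0" using growth_gt_1[OF n L, of e] by simp
  moreover have "(x + b * T) / (T - 1) = b + (x + b) / (T - 1)" if "T - 1 > 0" for b x T :: real
    using that by (simp add: field_simps)
  ultimately show ?thesis unfolding tent_D_def by blast
qed

lemma tent_N_mono_length: assumes n: "n \<ge> 3" and L: "L > 0" "L \<le> L'" shows "tent_N n e L \<le> tent_N n e L'"
proof -
  have L': "L' > 0" using L by simp
  have "real e * growth n e L \<le> real e * growth n e L'" by (intro mult_left_mono growth_mono L) simp
  then show ?thesis unfolding tent_N_eq(1)[OF n L(1)] tent_N_eq(1)[OF n L'] using tent_N_eq(2)[OF n L(1), of e] tent_N_eq(2)[OF n L', of e] n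
    by (intro diff_left_mono divide_left_mono) auto
qed

lemma tent_D_strict_antimono_length: assumes n: "n \<ge> 3" and L: "L > 0" "L < L'" shows "tent_D n e L' < tent_D n e L"
proof -
  have L': "L' > 0" using L by simp
  have "growth n e L < growth n e L'" unfolding growth_def using L n by (intro power_strict_mono) auto
  moreover have "growth n e L > 1" "growth n e L' > 1" using growth_gt_1[OF n] L(1) L' by auto
  ultimately show ?thesis unfolding tent_D_eq[OF n L(1)] tent_D_eq[OF n L'] using n
    by (intro add_strict_left_mono divide_strict_left_mono mult_pos_pos) auto
qed

text \<open>Lengths with prescribed properties are found by prescribing the value of
  \<open>growth\<close> and recovering \<open>L\<close> with a root.\<close>

lemma growth_surj: assumes n: "n \<ge> 3" and T: "T > 1" obtains L where "L > 0" "growth n e L = T"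
proof -
  have j: "2 * e + n - 2 > 0" using n by simp
  define q where "q = root (2 * e + n - 2) T"
  have "q > 1" unfolding q_def using T j by simp
  moreover have "q ^ (2 * e + n - 2) = T" unfolding q_def using T by (intro real_root_pow_pos2 j) simp
  ultimately show ?thesis by (intro that[of "2 * (q - 1)"]) (simp_all add: growth_def diff_divide_distrib)
qed

lemma tent_N_gt: assumes n: "n \<ge> 3" and e: "e \<ge> 1" and x: "x < real e + real n - 2" shows "\<exists>L>0. x < tent_N n e L"
proof -
  define b where "b = real e + real n - 2"
  have b: "b > 0" "x < b" using n x by (auto simp: b_def)
  have a: "real e > 0" using e by simp
  \<comment> \<open>Cleared of denominators, the claim is \<open>e (b - x) T > b (e + x)\<close>.
    This \<open>T\<close> satisfies \<open>e (b - x) (T - 1) = b (e + |x|)\<close>, where the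
    absolute value covers negative \<open>x\<close>.\<close>
  define T where "T = 1 + b * (real e + \<bar>x\<bar>) / (real e * (b - x))"
  have "b * (real e + \<bar>x\<bar>) / (real e * (b - x)) > 0" using a b by (intro divide_pos_pos mult_pos_pos) auto
  then have "T > 1" by (simp add: T_def)
  then obtain L where L: "L > 0" "growth n e L = T" using growth_surj[OF n] by metis
  have "real e * (b - x) * (T - 1) = b * (real e + \<bar>x\<bar>)" unfolding T_def using a b by simp
  moreover have "real e * x < real e * b" "b * x \<le> b * \<bar>x\<bar>" using a b by (auto intro!: mult_left_mono)
  ultimately have "x * (b + real e * T) < real e * b * (T - 1)" by (simp add: algebra_simps)
  then have "x < tent_N n e L"
    unfolding tent_N_def b_def[symmetric] L(2) using tent_N_eq(2)[OF n L(1), of e] by (simp add: b_def[symmetric] L(2) pos_less_divide_eq)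
  then show ?thesis using L(1) by blast
qed

lemma tent_D_lt: assumes n: "n \<ge> 3" and x: "real e + real n - 2 < x" shows "\<exists>L>0. tent_D n e L < x"
proof -
  define b where "b = real e + real n - 2"
  have b: "real e + b > 0" "x > b" using n x by (auto simp: b_def)
  \<comment> \<open>The factor 2 places \<open>tent_D\<close> halfway between \<open>b\<close> and
    \<open>x\<close>.\<close>
  define T where "T = 1 + 2 * (real e + b) / (x - b)"
  have "2 * (real e + b) / (x - b) > 0" using b by (intro divide_pos_pos) auto
  then have "T > 1" by (simp add: T_def)
  then obtain L where L: "L > 0" "growth n e L = T" using growth_surj[OF n] by metis
  have "(real e + b) / (T - 1) = (x - b) / 2" unfolding T_def using b by (simp add: field_simps)
  then have "tent_D n e L = b + (x - b) / 2" unfolding tent_D_eq[OF n L(1)] b_def[symmetric] L(2) by simp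
  then show ?thesis using L(1) b by (intro exI[of _ L]) (simp add: field_simps)
qed

lemma tent_N_lt: assumes n: "n \<ge> 3" and x: "x > 0" shows "\<exists>L>0. tent_N n e L < x"
proof -
  define b where "b = real e + real n - 2"
  have b: "b > 0" using n by (simp add: b_def)
  \<comment> \<open>The denominator gives \<open>e (T - 1) < x\<close> and is positive for
    \<open>e = 0\<close> as well.\<close>
  define T where "T = 1 + x / (real e + 1)"
  have T: "T > 1" using x by (simp add: T_def)
  then obtain L where L: "L > 0" "growth n e L = T" using growth_surj[OF n] by metis
  have K: "b + real e * T > 0" using tent_N_eq(2)[OF n L(1), of e] by (simp add: b_def L(2))
  have "real e * (T - 1) < x" unfolding T_def using x by (simp add: field_simps)
  then have "b * (real e * (T - 1)) < b * x" using b by simp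
  also have "\<dots> \<le> x * (b + real e * T)" using x T by (simp add: algebra_simps)
  finally have "tent_N n e L < x" unfolding tent_N_def b_def[symmetric] L(2) pos_divide_less_eq[OF K] by (simp add: mult_ac)
  then show ?thesis using L(1) by blast
qed

text \<open>With \<open>j = 2 e + n - 2\<close> and \<open>q = 1 + L / 2\<close>, both distances are
  eventually at most a constant times \<open>j^2 / q^j\<close>.\<close>

lemma tent_eig_close:
  assumes n: "n \<ge> 3" and L: "L > 0" and \<delta>: "\<delta> > 0"
  shows "\<exists>E. \<forall>e\<ge>E. real e + real n - 2 - \<delta> < tent_N n e L \<and> tent_D n e L < real e + real n - 2 + \<delta>"
proof -
  define q where "q = 1 + L / 2"
  \<comment> \<open>\<open>(j y^j)^2\<close> is \<open>j^2 / q^j\<close>, which reduces the limit to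
    that of \<open>j y^j\<close>.\<close>
  define y where "y = sqrt (1 / q)"
  have q: "q > 1" using L by (simp add: q_def)
  have y: "norm y < 1" "y\<^sup>2 = 1 / q" using q by (simp_all add: y_def)
  have "(\<lambda>j. (of_nat j * y ^ j)\<^sup>2) \<longlonglongrightarrow> 0\<^sup>2" by (intro tendsto_power powser_times_n_limit_0 y(1))
  moreover have "(of_nat j * y ^ j)\<^sup>2 = (real j)\<^sup>2 / q ^ j" for j
  proof -
    have "(y ^ j)\<^sup>2 = (y\<^sup>2) ^ j" by (simp only: power_mult[symmetric] mult.commute)
    also have "\<dots> = 1 / q ^ j" unfolding y(2) by (simp add: power_divide)
    finally show ?thesis by (simp add: power_mult_distrib)
  qed
  ultimately have lim: "(\<lambda>j. (real j)\<^sup>2 / q ^ j) \<longlonglongrightarrow> 0" by simp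
  \<comment> \<open>The bound by 1/2 is what gives \<open>T - 1 \<ge> T / 2\<close> in the
    denominator of \<open>tent_D\<close>.\<close>
  have "eventually (\<lambda>j. (real j)\<^sup>2 / q ^ j < min \<delta> 1 / 2) sequentially"
    by (rule order_tendstoD(2)[OF lim]) (use \<delta> in simp)
  then obtain J where J: "\<And>j. j \<ge> J \<Longrightarrow> (real j)\<^sup>2 / q ^ j < min \<delta> 1 / 2"
    unfolding eventually_sequentially by blast
  show ?thesis
  proof (intro exI[of _ "Suc J"] allI impI conjI)
    fix e assume e: "Suc J \<le> e"
    define j where "j = 2 * e + n - 2"
    define b where "b = real e + real n - 2"
    define T where "T = growth n e L"
    have Tq: "T = q ^ j" by (simp add: T_def growth_def q_def j_def)
    have j: "j \<ge> J" "real j = real e + b" "real j \<ge> 1" using e n by (auto simp: j_def b_def of_nat_diff)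
    have T: "T > 1" unfolding T_def by (rule growth_gt_1[OF n L])
    have jT: "(real j)\<^sup>2 / T < \<delta> / 2" "(real j)\<^sup>2 / T < 1 / 2" using J[OF j(1)] by (auto simp: Tq)
    have b: "0 < b" "b \<le> real j" using n j by (auto simp: b_def)
    have e1: "real e \<ge> 1" using e by simp
    have "1 * T \<le> real e * T" by (rule mult_right_mono[OF e1]) (use T in simp)
    then have eT: "T \<le> b + real e * T" using b(1) by linarith
    have "b * (real e + b) / (b + real e * T) \<le> (real j)\<^sup>2 / T"
    proof (rule frac_le)
      show "b * (real e + b) \<le> (real j)\<^sup>2" unfolding j(2)[symmetric] power2_eq_square by (rule mult_right_mono[OF b(2)]) simp
    qed (use T eT in auto)
    then show "real e + real n - 2 - \<delta> < tent_N n e L"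
      using tent_N_eq(1)[OF n L, of e] jT(1) \<delta> unfolding T_def[symmetric] b_def[symmetric] by linarith
    have sq: "1 \<le> (real j)\<^sup>2" "real j \<le> (real j)\<^sup>2"
      by (rule one_le_power[OF j(3)], rule self_le_power[OF j(3)]) simp
    have "(real j)\<^sup>2 < T / 2" using jT(2) T by (simp add: pos_divide_less_eq)
    then have T2: "T - 1 \<ge> T / 2" using sq(1) by linarith
    have "real j / (T - 1) \<le> (real j)\<^sup>2 / (T / 2)" by (rule frac_le) (use sq T T2 in linarith)+
    also have "\<dots> < \<delta>" using jT(1) by simp
    finally show "tent_D n e L < real e + real n - 2 + \<delta>"
      unfolding tent_D_eq[OF n L] T_def[symmetric] b_def[symmetric] j(2)[symmetric] by simp
  qed
qed

lemma tent_eig_ge_N: "n \<ge> 3 \<Longrightarrow> L > 0 \<Longrightarrow> tent_N n e L \<le> tent_eig n L e t"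
  using tent_N_le_D[of n L e] by (simp add: tent_eig_def)

lemma finite_tent_eig_sublevel: assumes n: "n \<ge> 3" and L: "L > 0" shows "finite {e. \<exists>t. tent_eig n L e t \<le> s}"
proof -
  obtain E where E: "\<And>e. e \<ge> E \<Longrightarrow> real e + real n - 2 - 1 < tent_N n e L"
    using tent_eig_close[OF n L zero_less_one] by blast
  obtain S :: nat where S: "s < real S" using reals_Archimedean2 by blast
  have "{e. \<exists>t. tent_eig n L e t \<le> s} \<subseteq> {..<max E S}"
  proof
    fix e assume "e \<in> {e. \<exists>t. tent_eig n L e t \<le> s}"
    then obtain t where t: "tent_eig n L e t \<le> s" by blast
    have "tent_N n e L \<le> s" using tent_eig_ge_N[OF n L, of e t] t by simp
    then show "e \<in> {..<max E S}" using E[of e] S n by (cases "max E S \<le> e") auto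
  qed
  then show ?thesis using finite_subset by blast
qed

lemma infinite_modes: assumes n: "CARD('n) \<ge> 3" shows "infinite (modes :: (nat \<times> bool \<times> (real^'n \<Rightarrow> real)) set)"
proof
  assume "finite (modes :: (nat \<times> bool \<times> (real^'n \<Rightarrow> real)) set)"
  then have "finite (fst ` (modes :: (nat \<times> bool \<times> (real^'n \<Rightarrow> real)) set))" by (rule finite_imageI)
  moreover have "e \<in> fst ` (modes :: (nat \<times> bool \<times> (real^'n \<Rightarrow> real)) set)" for e
  proof -
    obtain Y where "Y \<in> (onb e :: (real^'n \<Rightarrow> real) set)" using onb_nonempty[OF n, of e] by blast
    then have "(e, True, Y) \<in> modes" by (simp add: modes_def)
    then show ?thesis by force
  qed
  then have "fst ` (modes :: (nat \<times> bool \<times> (real^'n \<Rightarrow> real)) set) = UNIV" by blast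
  ultimately show False by simp
qed

text \<open>The profile has a positive minimum and the tent is at most \<open>1 + L\<close>.
  Finiteness of the sublevel sets for \<open>h\<close> is inherited from the tent in this
  way.\<close>

lemma profile_above_multiple_of_tent:
  assumes h: "pos_profile L h"
  obtains c where "0 < c" "c \<le> 1" "\<And>r. r \<in> {0..L} \<Longrightarrow> c * tent L r \<le> h r"
proof -
  have L: "L > 0" "continuous_on {0..L} h" "\<And>r. r \<in> {0..L} \<Longrightarrow> h r > 0" using h by (auto simp: pos_profile_def)
  have "{0..L} \<noteq> {}" using L(1) by simp
  from continuous_attains_inf[OF compact_Icc this L(2)]
  obtain r0 where r0: "r0 \<in> {0..L}" "\<And>r. r \<in> {0..L} \<Longrightarrow> h r0 \<le> h r" by blast
  define c where "c = min 1 (h r0 / (1 + L))"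
  have c: "0 < c" "c \<le> 1" using L(1) L(3)[OF r0(1)] by (auto simp: c_def)
  have "c * tent L r \<le> h r" if r: "r \<in> {0..L}" for r
  proof -
    have "c * tent L r \<le> h r0 / (1 + L) * (1 + L)"
    proof (rule mult_mono)
      show "c \<le> h r0 / (1 + L)" by (simp add: c_def)
      show "tent L r \<le> 1 + L" "0 \<le> tent L r" using r by (auto simp: tent_def min_def)
      show "0 \<le> h r0 / (1 + L)" using L(1) L(3)[OF r0(1)] by simp
    qed
    also have "\<dots> = h r0" using L(1) by simp
    also have "\<dots> \<le> h r" by (rule r0(2)[OF r])
    finally show ?thesis .
  qed
  with c show ?thesis by (rule that)
qed

lemma finite_dn_eig_sublevel:
  assumes n: "n \<ge> 3" and h: "pos_profile L h" shows "finite {e. \<exists>t. dn_eig n h L e t \<le> s}"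
proof -
  have L: "L > 0" using h by (simp add: pos_profile_def)
  obtain c where c: "0 < c" "c \<le> 1" "\<And>r. r \<in> {0..L} \<Longrightarrow> c * tent L r \<le> h r" 
    using profile_above_multiple_of_tent[OF h] by blast
  define k where "k = c ^ (n - 1)"
  have k: "k > 0" using c by (simp add: k_def)
  have "{e. \<exists>t. dn_eig n h L e t \<le> s} \<subseteq> {e. \<exists>t. tent_eig n L e t \<le> s / k}"
  proof
    fix e assume "e \<in> {e. \<exists>t. dn_eig n h L e t \<le> s}"
    then obtain t where "dn_eig n h L e t \<le> s" by blast
    then have "k * tent_eig n L e t \<le> s" using tent_le_dn_eig[OF n h c, of e t] unfolding k_def by simp
    then show "e \<in> {e. \<exists>t. tent_eig n L e t \<le> s / k}" using k by (auto simp: pos_le_divide_eq mult.commute)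
  qed
  then show ?thesis using finite_subset finite_tent_eig_sublevel[OF n L] by blast
qed

lemma steklov_eigenvalue_kth:
  assumes n: "CARD('n::finite) \<ge> 3" and h: "revolution_profile L h" and L: "L > 0"
  shows "kth_values (modes :: (nat \<times> bool \<times> (real^'n \<Rightarrow> real)) set) (mode_val (dn_eig CARD('n) h L)) (steklov_eigenvalue TYPE('n) h L)"
proof -
  let ?A = "modes :: (nat \<times> bool \<times> (real^'n \<Rightarrow> real)) set" and ?f = "mode_val (dn_eig CARD('n) h L)"
  have fin: "finite {m \<in> ?A. ?f m \<le> t}" for t
    by (rule finite_modes[OF finite_dn_eig_sublevel[OF n revolution_profile_pos[OF h L]]])
  have fin': "finite {m \<in> ?A. ?f m = t}" for t by (rule finite_subset[OF _ fin[of t]]) auto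
  have iff: "steklov_sequence TYPE('n) h L s \<longleftrightarrow> kth_values ?A ?f s" for s
    by (rule steklov_sequence_iff_kth_values[OF steklov_spectrum_eq[OF n h L fin'] steklov_multiplicity_eq[OF n h L fin'] fin])
  obtain s where s: "kth_values ?A ?f s" using kth_values_exists[OF fin infinite_modes[OF n]] by blast
  have "steklov_eigenvalue TYPE('n) h L = s" unfolding steklov_eigenvalue_def iff
  proof (rule the_equality)
    show "kth_values ?A ?f s" by (rule s)
    show "s' = s" if "kth_values ?A ?f s'" for s' by (rule kth_values_unique[OF that s])
  qed
  then show ?thesis using s by simp
qed

text \<open>The ordered eigenvalues of the tent, defined through its modes: its corner keeps the
  tent itself out of \<open>revolution_profile\<close>.\<close>

definition tent_value :: "'n::finite itself \<Rightarrow> real \<Rightarrow> nat \<Rightarrow> real" where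
  "tent_value _ L = (SOME s. kth_values (modes :: (nat \<times> bool \<times> (real^'n \<Rightarrow> real)) set) (mode_val (tent_eig CARD('n) L)) s)"

lemma finite_tent_modes:
  assumes "CARD('n) \<ge> 3" "L > 0"
  shows "finite {m \<in> (modes :: (nat \<times> bool \<times> (real^'n \<Rightarrow> real)) set). mode_val (tent_eig CARD('n) L) m \<le> t}"
  by (rule finite_modes[OF finite_tent_eig_sublevel[OF assms]])

lemma tent_value_kth:
  assumes n: "CARD('n::finite) \<ge> 3" and L: "L > 0"
  shows "kth_values (modes :: (nat \<times> bool \<times> (real^'n \<Rightarrow> real)) set) (mode_val (tent_eig CARD('n) L)) (tent_value TYPE('n) L)"
  unfolding tent_value_def by (rule someI_ex[OF kth_values_exists[OF finite_tent_modes[OF n L] infinite_modes[OF n]]])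

text \<open>\<open>g\<close> is a hyperbola that smooths the absolute value, with slope at most 1
  and \<open>|x| \<le> g x \<le> |x| + \<eta>\<close>. The constants in \<open>h\<close> restore the
  boundary value 1.\<close>

lemma smoothed_tent_profile:
  assumes L: "L > 0" and \<eta>: "0 < \<eta>"
  obtains h where "revolution_profile L h" "\<And>r. r \<in> {0..L} \<Longrightarrow> (1 - \<eta>) * tent L r \<le> h r"
proof -
  define g where "g x = sqrt (x\<^sup>2 + \<eta>\<^sup>2)" for x
  define h where "h r = 1 + g (L / 2) - g (r - L / 2)" for r
  have pos: "x\<^sup>2 + \<eta>\<^sup>2 > 0" for x :: real using \<eta> by (intro add_nonneg_pos) auto
  have gmono: "g x \<le> g y" if "\<bar>x\<bar> \<le> \<bar>y\<bar>" for x y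
    unfolding g_def by (intro real_sqrt_le_mono add_right_mono abs_le_square_iff[THEN iffD1] that)
  have gd: "(g has_real_derivative x / g x) (at x)" for x
  proof -
    have "((\<lambda>x. x\<^sup>2 + \<eta>\<^sup>2) has_real_derivative 2 * x) (at x)" by (auto intro!: derivative_eq_intros)
    from DERIV_chain2[where f = sqrt and g = "\<lambda>x. x\<^sup>2 + \<eta>\<^sup>2", OF DERIV_real_sqrt[OF pos] this]
    have "(g has_real_derivative inverse (g x) / 2 * (2 * x)) (at x)" unfolding g_def[abs_def] .
    then show ?thesis by (rule DERIV_cong) (simp add: inverse_eq_divide)
  qed
  have hd: "(h has_real_derivative - ((r - L / 2) / g (r - L / 2))) (at r)" for r
  proof -
    have "((\<lambda>r. r - L / 2) has_real_derivative 1) (at r)" by (auto intro!: derivative_eq_intros)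
    from DERIV_diff[OF DERIV_const[of "1 + g (L / 2)"] DERIV_chain2[where f = g and g = "\<lambda>r. r - L / 2", OF gd this]]
    show ?thesis unfolding h_def[abs_def] by (rule DERIV_cong) simp
  qed
  have gabs: "\<bar>x\<bar> \<le> g x" "g x \<le> \<bar>x\<bar> + \<eta>" for x
  proof -
    show "\<bar>x\<bar> \<le> g x" unfolding g_def by (rule real_sqrt_ge_abs1)
    show "g x \<le> \<bar>x\<bar> + \<eta>" unfolding g_def using sqrt_sum_squares_le_sum_abs[of x \<eta>] \<eta> by simp
  qed
  have hpos: "h r > 0" if "r \<in> {0..L}" for r
  proof -
    have "0 \<le> r" "r \<le> L" using that by auto
    then have "\<bar>r - L / 2\<bar> \<le> \<bar>L / 2\<bar>" by linarith
    then have "g (r - L / 2) \<le> g (L / 2)" by (rule gmono)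
    then show ?thesis by (simp add: h_def)
  qed
  show ?thesis
  proof (rule that[of h])
    show "revolution_profile L h" unfolding revolution_profile_def
    proof (intro conjI ballI)
      have "Cinf UNIV h" unfolding h_def[abs_def] g_def by (intro cinf open_UNIV) (use pos in auto)
      then show "smooth_on {0..L} h" unfolding smooth_on_Cinf by (intro exI[of _ UNIV] exI[of _ h]) auto
      show "0 < h r" if "r \<in> {0..L}" for r by (rule hpos[OF that])
      show "\<bar>vector_derivative h (at r within {0..L})\<bar> \<le> 1" if "r \<in> {0..L}" for r
      proof -
        have "vector_derivative h (at r within {0..L}) = - ((r - L / 2) / g (r - L / 2))"
          by (rule vector_derivative_within_interval(2)[OF L that hd refl])
        moreover have "g (r - L / 2) > 0" unfolding g_def by (simp add: pos)
        ultimately show ?thesis using gabs(1)[of "r - L / 2"] by (simp add: abs_divide)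
      qed
      have "g (- (L / 2)) = g (L / 2)" by (simp add: g_def)
      then show "h 0 = 1" by (simp add: h_def)
      show "h L = 1" by (simp add: h_def)
    qed
    show "(1 - \<eta>) * tent L r \<le> h r" if r: "r \<in> {0..L}" for r
    proof -
      have "tent L r = 1 + L / 2 - \<bar>r - L / 2\<bar>" unfolding tent_def by linarith
      moreover have "L / 2 \<le> g (L / 2)" using gabs(1)[of "L / 2"] L by simp
      ultimately have "tent L r - \<eta> \<le> h r" using gabs(2)[of "r - L / 2"] by (simp add: h_def)
      \<comment> \<open>The tent is at least 1, which turns the additive error \<open>\<eta>\<close>
        into a relative one.\<close>
      moreover have "\<eta> * 1 \<le> \<eta> * tent L r" using \<eta> r by (intro mult_left_mono) (auto simp: tent_def)
      ultimately show ?thesis by (simp add: left_diff_distrib)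
    qed
  qed
qed

text \<open>For the lower bound, the factor \<open>(1 - \<eta>) ^ (n - 1)\<close> is the same for
  all modes, so it passes to the ordered values, and \<open>\<eta>\<close> tends to 0.\<close>

lemma sharp_bound_at_eq:
  assumes n: "CARD('n::finite) \<ge> 3" and L: "L > 0"
  shows "sharp_bound_at TYPE('n) k L = ereal (tent_value TYPE('n) L k)"
proof (rule antisym)
  let ?\<tau> = "tent_value TYPE('n) L k"
  note \<tau> = tent_value_kth[OF n L]
  show "sharp_bound_at TYPE('n) k L \<le> ereal ?\<tau>" unfolding sharp_bound_at_def
  proof (rule SUP_least)
    fix h assume "h \<in> {h. revolution_profile L h}"
    then have h: "revolution_profile L h" by simp
    have "steklov_eigenvalue TYPE('n) h L k \<le> ?\<tau>"
    proof (rule kth_values_mono[OF steklov_eigenvalue_kth[OF n h L] \<tau>])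
      show "finite {m \<in> modes. mode_val (dn_eig CARD('n) h L) m \<le> t}" for t
        by (rule finite_modes[OF finite_dn_eig_sublevel[OF n revolution_profile_pos[OF h L]]])
      show "mode_val (dn_eig CARD('n) h L) m \<le> mode_val (tent_eig CARD('n) L) m" for m :: "nat \<times> bool \<times> (real^'n \<Rightarrow> real)"
        unfolding mode_val_def by (rule dn_eig_le_tent[OF n revolution_profile_pos[OF h L] revolution_profile_le_tent[OF h L]])
    qed
    then show "ereal (steklov_eigenvalue TYPE('n) h L k) \<le> ereal ?\<tau>" by simp
  qed
  have ge: "ereal ((1 - \<eta>) ^ (CARD('n) - 1) * ?\<tau>) \<le> sharp_bound_at TYPE('n) k L" if \<eta>: "0 < \<eta>" "\<eta> < 1" for \<eta>
  proof -
    obtain h where h: "revolution_profile L h" "\<And>r. r \<in> {0..L} \<Longrightarrow> (1 - \<eta>) * tent L r \<le> h r"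
      using smoothed_tent_profile[OF L \<eta>(1)] by metis
    have c: "0 < 1 - \<eta>" "1 - \<eta> \<le> 1" using \<eta> by auto
    define c where "c = (1 - \<eta>) ^ (CARD('n) - 1)"
    have c0: "c > 0" using c by (simp add: c_def)
    have "c * ?\<tau> \<le> steklov_eigenvalue TYPE('n) h L k"
    proof (rule kth_values_mono[OF kth_values_scale[OF \<tau> c0] steklov_eigenvalue_kth[OF n h(1) L]])
      fix t
      have "{m \<in> (modes :: (nat \<times> bool \<times> (real^'n \<Rightarrow> real)) set). c * mode_val (tent_eig CARD('n) L) m \<le> t}
        = {m \<in> modes. mode_val (tent_eig CARD('n) L) m \<le> t / c}" using c0 by (simp add: pos_le_divide_eq mult.commute)
      then show "finite {m \<in> (modes :: (nat \<times> bool \<times> (real^'n \<Rightarrow> real)) set). c * mode_val (tent_eig CARD('n) L) m \<le> t}"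
        using finite_tent_modes[OF n L] by simp
    next
      show "c * mode_val (tent_eig CARD('n) L) m \<le> mode_val (dn_eig CARD('n) h L) m" for m :: "nat \<times> bool \<times> (real^'n \<Rightarrow> real)"
        unfolding mode_val_def c_def by (rule tent_le_dn_eig[OF n revolution_profile_pos[OF h(1) L] c h(2)])
    qed
    then have "ereal (c * ?\<tau>) \<le> ereal (steklov_eigenvalue TYPE('n) h L k)" by simp
    also have "\<dots> \<le> sharp_bound_at TYPE('n) k L" unfolding sharp_bound_at_def using h(1) by (intro SUP_upper) simp
    finally show ?thesis by (simp only: c_def)
  qed
  have inv0: "(\<lambda>i. inverse (real (Suc i))) \<longlonglongrightarrow> 0" by (rule LIMSEQ_inverse_real_of_nat)
  have "(\<lambda>i. (1 - inverse (real (Suc i))) ^ (CARD('n) - 1) * ?\<tau>) \<longlonglongrightarrow> (1 - 0) ^ (CARD('n) - 1) * ?\<tau>"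
    by (intro tendsto_intros inv0)
  then have lim: "(\<lambda>i. ereal ((1 - inverse (real (Suc i))) ^ (CARD('n) - 1) * ?\<tau>)) \<longlonglongrightarrow> ereal ?\<tau>" by simp
  show "ereal ?\<tau> \<le> sharp_bound_at TYPE('n) k L"
  proof (rule Lim_bounded[OF lim, where M = 1], intro allI impI)
    fix i :: nat assume i: "1 \<le> i"
    show "ereal ((1 - inverse (real (Suc i))) ^ (CARD('n) - 1) * ?\<tau>) \<le> sharp_bound_at TYPE('n) k L"
    proof (rule ge)
      have "1 < real (Suc i)" using i by simp
      then show "inverse (real (Suc i)) < 1" by (simp only: inverse_less_1_iff) simp
      show "0 < inverse (real (Suc i))" by simp
    qed
  qed
qed

lemma finite_critical_length_iff:
  assumes n: "CARD('n::finite) \<ge> 3"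
  shows "finite_critical_length TYPE('n) k L \<longleftrightarrow> L > 0 \<and> (\<forall>L'>0. tent_value TYPE('n) L' k \<le> tent_value TYPE('n) L k)"
proof -
  have sb: "sharp_bound TYPE('n) k = (SUP L\<in>{0<..}. ereal (tent_value TYPE('n) L k))"
    unfolding sharp_bound_def by (rule SUP_cong[OF refl]) (simp add: sharp_bound_at_eq[OF n])
  show ?thesis
  proof (cases "L > 0")
    case True
    have "sharp_bound TYPE('n) k = sharp_bound_at TYPE('n) k L \<longleftrightarrow> sharp_bound TYPE('n) k \<le> sharp_bound_at TYPE('n) k L"
      using SUP_upper[of L "{0<..}" "sharp_bound_at TYPE('n) k"] True by (auto simp: sharp_bound_def intro: antisym)
    also have "\<dots> \<longleftrightarrow> (\<forall>L'>0. tent_value TYPE('n) L' k \<le> tent_value TYPE('n) L k)"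
      unfolding sb sharp_bound_at_eq[OF n True] SUP_le_iff by auto
    finally show ?thesis using True by (simp add: finite_critical_length_def)
  qed (simp add: finite_critical_length_def)
qed

section \<open>Bounds on the ordered tent eigenvalues by counting modes\<close>

definition onb_sum :: "'n::finite itself \<Rightarrow> nat \<Rightarrow> nat" where
  "onb_sum _ i = (\<Sum>e<i. card (onb e :: (real^'n \<Rightarrow> real) set))"

text \<open>The degree bound \<open>i\<close> applies to the Neumann modes and \<open>j\<close> to
  the Dirichlet modes.\<close>

definition low_modes :: "nat \<Rightarrow> nat \<Rightarrow> (nat \<times> bool \<times> (real^'n \<Rightarrow> real)) set" where
  "low_modes i j = {(e, t, Y). Y \<in> onb e \<and> e < (if t then j else i)}"

lemma card_low_modes:
  shows "finite (low_modes i j :: (nat \<times> bool \<times> (real^'n::finite \<Rightarrow> real)) set)"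
    and "card (low_modes i j :: (nat \<times> bool \<times> (real^'n \<Rightarrow> real)) set) = onb_sum TYPE('n) i + onb_sum TYPE('n) j"
proof -
  define S where "S i = (SIGMA e:{..<i}. (onb e :: (real^'n \<Rightarrow> real) set))" for i :: nat
  have g: "inj_on (\<lambda>(e, Y). (e, t, Y)) (S i)" for t :: bool and i by (auto simp: inj_on_def)
  have fS: "finite (S i)" "card (S i) = onb_sum TYPE('n) i" for i
    unfolding S_def onb_sum_def by (simp_all add: finite_SigmaI)
  have eq: "low_modes i j = (\<lambda>(e, Y). (e, False, Y)) ` S i \<union> (\<lambda>(e, Y). (e, True, Y)) ` S j"
  proof (intro subset_antisym subsetI)
    fix m assume "m \<in> (low_modes i j :: (nat \<times> bool \<times> (real^'n \<Rightarrow> real)) set)"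
    then obtain e t Y where m: "m = (e, t, Y)" "Y \<in> onb e" "e < (if t then j else i)" by (auto simp: low_modes_def)
    then show "m \<in> (\<lambda>(e, Y). (e, False, Y)) ` S i \<union> (\<lambda>(e, Y). (e, True, Y)) ` S j"
      by (cases t) (auto simp: S_def image_iff)
  qed (auto simp: S_def low_modes_def)
  show "finite (low_modes i j :: (nat \<times> bool \<times> (real^'n \<Rightarrow> real)) set)" unfolding eq using fS by simp
  show "card (low_modes i j :: (nat \<times> bool \<times> (real^'n \<Rightarrow> real)) set) = onb_sum TYPE('n) i + onb_sum TYPE('n) j"
    unfolding eq by (subst card_Un_disjoint) (use fS in \<open>auto simp: card_image[OF g]\<close>)
qed

text \<open>The low modes all have values at most \<open>x\<close>, and there are more than
  \<open>k\<close> of them.\<close>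

lemma tent_value_le:
  assumes n: "CARD('n::finite) \<ge> 3" and L: "L > 0" and k: "k < onb_sum TYPE('n) i + onb_sum TYPE('n) j"
    and N: "\<And>e. e < i \<Longrightarrow> tent_N CARD('n) e L \<le> x" and D: "\<And>e. e < j \<Longrightarrow> tent_D CARD('n) e L \<le> x"
  shows "tent_value TYPE('n) L k \<le> x"
proof -
  have "low_modes i j \<subseteq> {m \<in> (modes :: (nat \<times> bool \<times> (real^'n \<Rightarrow> real)) set). mode_val (tent_eig CARD('n) L) m \<le> x}"
    using N D by (auto simp: low_modes_def modes_def mode_val_def tent_eig_def split: if_splits)
  from card_mono[OF finite_tent_modes[OF n L] this] k
  show ?thesis unfolding kth_valuesD[OF tent_value_kth[OF n L]] card_low_modes(2) by simp
qed

text \<open>A mode with value below \<open>x\<close> is a low mode, and there are at most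
  \<open>k\<close> of these.\<close>

lemma tent_value_ge:
  assumes n: "CARD('n::finite) \<ge> 3" and L: "L > 0" and k: "onb_sum TYPE('n) i + onb_sum TYPE('n) j \<le> k"
    and N: "\<And>e. i \<le> e \<Longrightarrow> x \<le> tent_N CARD('n) e L" and D: "\<And>e. j \<le> e \<Longrightarrow> x \<le> tent_D CARD('n) e L"
  shows "x \<le> tent_value TYPE('n) L k"
proof -
  have "{m \<in> (modes :: (nat \<times> bool \<times> (real^'n \<Rightarrow> real)) set). mode_val (tent_eig CARD('n) L) m < x} \<subseteq> low_modes i j"
  proof
    fix m assume m: "m \<in> {m \<in> (modes :: (nat \<times> bool \<times> (real^'n \<Rightarrow> real)) set). mode_val (tent_eig CARD('n) L) m < x}"
    obtain e t Y where me: "m = (e, t, Y)" by (metis prod_cases3)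
    have "tent_eig CARD('n) L e t < x" "Y \<in> onb e" using m by (auto simp: me modes_def mode_val_def)
    then have "e < (if t then j else i)" using N[of e] D[of e] by (cases "(if t then j else i) \<le> e") (auto simp: tent_eig_def split: if_splits)
    then show "m \<in> low_modes i j" using \<open>Y \<in> onb e\<close> by (simp add: me low_modes_def)
  qed
  from card_mono[OF card_low_modes(1) this] k
  have "\<not> k < card {m \<in> (modes :: (nat \<times> bool \<times> (real^'n \<Rightarrow> real)) set). mode_val (tent_eig CARD('n) L) m < x}"
    unfolding card_low_modes(2) by simp
  then show ?thesis unfolding kth_values_less[OF tent_value_kth[OF n L] finite_tent_modes[OF n L], symmetric] by simp
qed

section \<open>Upper semicontinuity in the length\<close>

lemma continuous_tent_eig: assumes n: "n \<ge> 3" shows "continuous_on {0<..} (\<lambda>L. tent_eig n L e t)"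
proof -
  have g: "continuous_on {0<..} (growth n e)" unfolding growth_def by (intro continuous_intros) simp
  have nz: "real e + real n - 2 + real e * growth n e L \<noteq> 0" "growth n e L - 1 \<noteq> 0" if "L \<in> {0<..}" for L
    using tent_N_eq(2)[OF n, of L e] growth_gt_1[OF n, of L e] that by auto
  have "continuous_on {0<..} (tent_N n e)" unfolding tent_N_def by (intro continuous_intros g ballI nz)
  moreover have "continuous_on {0<..} (tent_D n e)" unfolding tent_D_def by (intro continuous_intros g ballI nz)
  ultimately show ?thesis unfolding tent_eig_def by (cases t) (simp_all only: if_True if_False)
qed

text \<open>More than \<open>k\<close>, but finitely many, modes have value at most the
  \<open>k\<close>-th one, hence below \<open>x\<close>. Each of these values is continuous in the
  length, so they stay below \<open>x\<close> nearby, whatever crossings occur.\<close>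

lemma tent_value_usc:
  assumes n: "CARD('n::finite) \<ge> 3" and L: "L > 0" and x: "tent_value TYPE('n) L k < x"
  shows "eventually (\<lambda>L. tent_value TYPE('n) L k \<le> x) (nhds L)"
proof -
  define F where "F = {m \<in> (modes :: (nat \<times> bool \<times> (real^'n \<Rightarrow> real)) set). mode_val (tent_eig CARD('n) L) m \<le> tent_value TYPE('n) L k}"
  have fF: "finite F" unfolding F_def by (rule finite_tent_modes[OF n L])
  have kF: "k < card F" unfolding F_def using kth_valuesD[OF tent_value_kth[OF n L], of k] by blast
  have "eventually (\<lambda>L. mode_val (tent_eig CARD('n) L) m < x) (nhds L)" if m: "m \<in> F" for m
  proof -
    have "continuous_on {0<..} (\<lambda>L. mode_val (tent_eig CARD('n) L) m)" unfolding mode_val_def by (rule continuous_tent_eig[OF n])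
    then have "\<forall>x\<in>{0<..}. isCont (\<lambda>L. mode_val (tent_eig CARD('n) L) m) x"
      by (rule continuous_on_eq_continuous_at[OF open_greaterThan, THEN iffD1])
    then have "isCont (\<lambda>L. mode_val (tent_eig CARD('n) L) m) L" by (rule bspec) (use L in simp)
    then have "((\<lambda>L. mode_val (tent_eig CARD('n) L) m) \<longlongrightarrow> mode_val (tent_eig CARD('n) L) m) (nhds L)"
      unfolding isCont_def by (rule tendsto_at_iff_tendsto_nhds[where g = "\<lambda>L. mode_val (tent_eig CARD('n) L) m", THEN iffD1])
    then show ?thesis by (rule order_tendstoD(2)) (use m x in \<open>simp add: F_def\<close>)
  qed
  then have "eventually (\<lambda>L. \<forall>m\<in>F. mode_val (tent_eig CARD('n) L) m < x) (nhds L)"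
    by (intro eventually_ball_finite[OF fF] ballI)
  moreover have "eventually (\<lambda>L. L \<in> {0<..}) (nhds L)" by (rule eventually_nhds_in_open) (use L in simp_all)
  ultimately show ?thesis
  proof eventually_elim
    case (elim L')
    then have L': "L' > 0" by simp
    have sub: "F \<subseteq> {m \<in> modes. mode_val (tent_eig CARD('n) L') m \<le> x}"
    proof
      fix m assume m: "m \<in> F"
      have "mode_val (tent_eig CARD('n) L') m \<le> x" using elim(1) m by (blast intro: less_imp_le)
      moreover have "m \<in> modes" using m by (simp add: F_def)
      ultimately show "m \<in> {m \<in> modes. mode_val (tent_eig CARD('n) L') m \<le> x}" by blast
    qed
    have "k < card {m \<in> (modes :: (nat \<times> bool \<times> (real^'n \<Rightarrow> real)) set). mode_val (tent_eig CARD('n) L') m \<le> x}"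
      by (rule less_le_trans[OF kF card_mono[OF finite_tent_modes[OF n L'] sub]])
    then show ?case by (rule kth_valuesD[OF tent_value_kth[OF n L'], THEN iffD2])
  qed
qed

text \<open>Without a maximum, each \<open>y\<close> has a better point \<open>g y\<close> and a
  neighbourhood on which \<open>f\<close> stays below \<open>f (g y)\<close>. In a finite subcover
  take the centre \<open>c\<close> with the largest \<open>f (g c)\<close>: the point
  \<open>g c\<close> lies in some neighbourhood of the subcover, which gives a larger value.\<close>

lemma usc_attains_sup:
  fixes f :: "real \<Rightarrow> real"
  assumes ab: "a \<le> b" and usc: "\<And>y x. y \<in> {a..b} \<Longrightarrow> f y < x \<Longrightarrow> eventually (\<lambda>z. f z \<le> x) (nhds y)"
  shows "\<exists>y\<in>{a..b}. \<forall>z\<in>{a..b}. f z \<le> f y"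
proof (rule ccontr)
  assume "\<not> ?thesis"
  then have "\<forall>y\<in>{a..b}. \<exists>z\<in>{a..b}. f y < f z" by (meson not_le)
  then obtain g where g: "\<And>y. y \<in> {a..b} \<Longrightarrow> g y \<in> {a..b}" "\<And>y. y \<in> {a..b} \<Longrightarrow> f y < f (g y)" by metis
  have "\<exists>U. open U \<and> y \<in> U \<and> (\<forall>z\<in>U. f z < f (g y))" if y: "y \<in> {a..b}" for y
  proof -
    obtain x where x: "f y < x" "x < f (g y)" using dense[OF g(2)[OF y]] by blast
    from usc[OF y x(1)] x(2) show ?thesis unfolding eventually_nhds by (meson le_less_trans)
  qed
  then obtain U where U: "\<And>y. y \<in> {a..b} \<Longrightarrow> open (U y)" "\<And>y. y \<in> {a..b} \<Longrightarrow> y \<in> U y"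
    "\<And>y z. y \<in> {a..b} \<Longrightarrow> z \<in> U y \<Longrightarrow> f z < f (g y)" by metis
  obtain C where C: "C \<subseteq> {a..b}" "finite C" "{a..b} \<subseteq> (\<Union>c\<in>C. U c)"
    using compactE_image[OF compact_Icc[of a b], of "{a..b}" U] U(1,2) by (metis UN_I subsetI)
  have "C \<noteq> {}" using C(3) ab by auto
  define M where "M = Max ((\<lambda>c. f (g c)) ` C)"
  have "M \<in> (\<lambda>c. f (g c)) ` C" unfolding M_def using C(2) \<open>C \<noteq> {}\<close> by (intro Max_in) auto
  then obtain c where c: "c \<in> C" "M = f (g c)" by blast
  then obtain c' where c': "c' \<in> C" "g c \<in> U c'" using C(1,3) g(1) by blast
  then have "f (g c) < f (g c')" using U(3) C(1) by blast
  moreover have "f (g c') \<le> M" unfolding M_def using C(2) c'(1) by (intro Max_ge) auto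
  ultimately show False using c(2) by simp
qed

section \<open>Critical lengths\<close>

lemma onb_sum_Suc: assumes "CARD('n::finite) \<ge> 3" shows "onb_sum TYPE('n) i < onb_sum TYPE('n) (Suc i)"
  unfolding onb_sum_def using onb_nonempty[OF assms, of i] by (simp add: card_gt_0_iff)

lemma onb_sum_ge: assumes "CARD('n::finite) \<ge> 3" shows "i \<le> onb_sum TYPE('n) i"
proof (induction i)
  case (Suc i) then show ?case using onb_sum_Suc[OF assms, of i] by simp
qed simp

lemma onb_sum_mono: assumes "CARD('n::finite) \<ge> 3" shows "i \<le> j \<Longrightarrow> onb_sum TYPE('n) i \<le> onb_sum TYPE('n) j"
  unfolding onb_sum_def by (rule sum_mono2) auto

text \<open>For this \<open>k\<close> the bound at large \<open>L\<close> is the Dirichlet value of degree \<open>i\<close>, which decreases in \<open>L\<close>; at small \<open>L\<close> Neumann values of high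
  degree take over and are small. So the supremum over \<open>L\<close> is attained.\<close>

lemma critical_length_exists:
  assumes n: "CARD('n::finite) \<ge> 3"
  shows "\<exists>L. finite_critical_length TYPE('n) (2 * onb_sum TYPE('n) (Suc i) - 1) L"
proof -
  define k where "k = 2 * onb_sum TYPE('n) (Suc i) - 1"
  define b where "b = real i + real CARD('n) - 2"
  let ?\<tau> = "\<lambda>L. tent_value TYPE('n) L k" and ?n = "CARD('n)"
  have s: "onb_sum TYPE('n) i < onb_sum TYPE('n) (Suc i)" by (rule onb_sum_Suc[OF n])
  \<comment> \<open>\<open>k\<close> is the last index of the block between \<open>2 M_i\<close> and
    \<open>2 M_(i+1)\<close>. It lies in the upper half of that block because
    \<open>M_i < M_(i+1)\<close>.\<close>
  have k: "k < onb_sum TYPE('n) (Suc i) + onb_sum TYPE('n) (Suc i)" "onb_sum TYPE('n) (Suc i) + onb_sum TYPE('n) i \<le> k"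
    using s by (simp_all add: k_def)
  have le_D: "?\<tau> L \<le> tent_D ?n i L" if L: "L > 0" for L
  proof (rule tent_value_le[OF n L k(1)])
    fix e assume "e < Suc i"
    then show D: "tent_D ?n e L \<le> tent_D ?n i L" using tent_D_mono[OF n L] by simp
    show "tent_N ?n e L \<le> tent_D ?n i L" using D tent_N_le_D[OF n L, of e] by simp
  qed
  \<comment> \<open>\<open>b\<close> is the limit of the Dirichlet value of degree \<open>i\<close>.
    The Neumann value of the next degree can come close to \<open>b + 1\<close>, so at some
    \<open>L0\<close> it exceeds \<open>b\<close>, and with it the bound at
    \<open>L0\<close>.\<close>
  have "b < real (Suc i) + real ?n - 2" by (simp add: b_def)
  then obtain L0 where L0: "L0 > 0" "b < tent_N ?n (Suc i) L0" using tent_N_gt[OF n, of "Suc i" b] by auto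
  have "min (tent_D ?n i L0) (tent_N ?n (Suc i) L0) \<le> ?\<tau> L0"
  proof (rule tent_value_ge[OF n L0(1) k(2)])
    show "min (tent_D ?n i L0) (tent_N ?n (Suc i) L0) \<le> tent_N ?n e L0" if "Suc i \<le> e" for e
      using tent_N_mono[OF n L0(1) that] by simp
    show "min (tent_D ?n i L0) (tent_N ?n (Suc i) L0) \<le> tent_D ?n e L0" if "i \<le> e" for e
      using tent_D_mono[OF n L0(1) that] by simp
  qed
  moreover have "b < tent_D ?n i L0" unfolding b_def by (rule tent_D_greater[OF n L0(1)])
  ultimately have \<tau>0: "b < ?\<tau> L0" using L0(2) by simp
  \<comment> \<open>From \<open>\<beta>\<close> on, the upper bound \<open>tent_D\<close> is below
    the value at \<open>L0\<close>.\<close>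
  obtain \<beta> where \<beta>: "\<beta> > 0" "tent_D ?n i \<beta> < ?\<tau> L0" using tent_D_lt[OF n \<tau>0[unfolded b_def]] by auto
  have "b > 0" using n by (simp add: b_def)
  then have "?\<tau> L0 > 0" using \<tau>0 by simp
  \<comment> \<open>Degree \<open>k\<close> is large enough: the Neumann modes of degrees 0 to
    \<open>k\<close> number more than \<open>k\<close>, each degree having at least one.\<close>
  then obtain \<alpha> where \<alpha>: "\<alpha> > 0" "tent_N ?n k \<alpha> < ?\<tau> L0" using tent_N_lt[OF n] by blast
  have small: "?\<tau> L < ?\<tau> L0" if L: "0 < L" "L \<le> \<alpha>" for L
  proof -
    have "k < onb_sum TYPE('n) (Suc k) + onb_sum TYPE('n) 0" using onb_sum_ge[OF n, of "Suc k"] by simp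
    then have "?\<tau> L \<le> tent_N ?n k \<alpha>"
    proof (rule tent_value_le[OF n L(1)])
      show "tent_N ?n e L \<le> tent_N ?n k \<alpha>" if "e < Suc k" for e
        using tent_N_mono[OF n L(1), of e k] tent_N_mono_length[OF n L, of k] that by simp
    qed simp
    then show ?thesis using \<alpha>(2) by simp
  qed
  have large: "?\<tau> L < ?\<tau> L0" if "\<beta> \<le> L" for L
  proof -
    have "L > 0" using that \<beta>(1) by simp
    moreover have "tent_D ?n i L \<le> tent_D ?n i \<beta>"
      using tent_D_strict_antimono_length[OF n \<beta>(1), of L i] that by (cases "L = \<beta>") auto
    ultimately show ?thesis using le_D[of L] \<beta>(2) by simp
  qed
  have L0_mem: "L0 \<in> {\<alpha>..\<beta>}" using small[of L0] large[of L0] L0(1) by force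
  have "\<exists>y\<in>{\<alpha>..\<beta>}. \<forall>z\<in>{\<alpha>..\<beta>}. ?\<tau> z \<le> ?\<tau> y"
  proof (rule usc_attains_sup)
    show "\<alpha> \<le> \<beta>" using L0_mem by simp
    show "eventually (\<lambda>z. ?\<tau> z \<le> x) (nhds y)" if "y \<in> {\<alpha>..\<beta>}" "?\<tau> y < x" for y x
      by (rule tent_value_usc[OF n _ that(2)]) (use that(1) \<alpha>(1) in simp)
  qed
  then obtain y where y: "y \<in> {\<alpha>..\<beta>}" "\<And>z. z \<in> {\<alpha>..\<beta>} \<Longrightarrow> ?\<tau> z \<le> ?\<tau> y" by blast
  have "?\<tau> L \<le> ?\<tau> y" if "L > 0" for L
  proof (cases "L \<in> {\<alpha>..\<beta>}")
    case False
    then have "?\<tau> L \<le> ?\<tau> L0" using small[of L] large[of L] that by (cases "L \<le> \<alpha>") auto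
    then show ?thesis using y(2)[OF L0_mem] by simp
  qed (rule y(2))
  moreover have "y > 0" using y(1) \<alpha>(1) by simp
  ultimately have "finite_critical_length TYPE('n) k y" unfolding finite_critical_length_iff[OF n] by blast
  then show ?thesis unfolding k_def by blast
qed

text \<open>For large \<open>k\<close> every \<open>L \<ge> \<epsilon>\<close> is beaten by an
  explicit competitor: \<open>\<epsilon> / 2\<close> in the upper half of a block, a long cylinder
  in the lower half. The tolerance 1/2 is half the gap between consecutive limits.\<close>

lemma critical_length_small:
  assumes n: "CARD('n::finite) \<ge> 3" and \<epsilon>: "\<epsilon> > 0"
  shows "\<exists>K. \<forall>k\<ge>K. \<forall>L. finite_critical_length TYPE('n) k L \<longrightarrow> L < \<epsilon>"
proof -
  let ?n = "CARD('n)" and ?M = "onb_sum TYPE('n)"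
  have e2: "\<epsilon> / 2 > 0" "\<epsilon> / 2 < \<epsilon>" "(1/2::real) > 0" using \<epsilon> by auto
  obtain E1 where E1: "\<And>e. e \<ge> E1 \<Longrightarrow> tent_D ?n e \<epsilon> < real e + real ?n - 2 + 1/2"
    using tent_eig_close[OF n \<epsilon> e2(3)] by blast
  obtain E2 where E2: "\<And>e. e \<ge> E2 \<Longrightarrow> real e + real ?n - 2 - 1/2 < tent_N ?n e (\<epsilon> / 2)"
    using tent_eig_close[OF n e2(1,3)] by blast
  \<comment> \<open>The successor keeps degree \<open>i - 1\<close> at or above \<open>E1\<close>
    for every \<open>i \<ge> i0\<close>.\<close>
  define i0 where "i0 = Suc (max E1 E2)"
  have "\<not> finite_critical_length TYPE('n) k L" if k: "2 * ?M i0 \<le> k" and L: "L \<ge> \<epsilon>" for k L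
  proof
    assume "finite_critical_length TYPE('n) k L"
    then have crit: "tent_value TYPE('n) L' k \<le> tent_value TYPE('n) L k" if "L' > 0" for L'
      using that unfolding finite_critical_length_iff[OF n] by blast
    have L0: "L > 0" using L \<epsilon> by simp
    define P where "P i \<longleftrightarrow> k < 2 * ?M i" for i
    have P: "P (Suc k)" using onb_sum_ge[OF n, of "Suc k"] by (simp add: P_def)
    \<comment> \<open>The least index locates the block \<open>2 M_i \<le> k < 2 M_(i+1)\<close>
      with \<open>l = i + 1\<close>.\<close>
    define l where "l = (LEAST i. P i)"
    have l: "P l" "\<And>j. j < l \<Longrightarrow> \<not> P j" unfolding l_def using LeastI[of P, OF P] not_less_Least by blast+
    have "i0 < l"
    proof (rule ccontr)
      assume "\<not> i0 < l"
      then have "?M l \<le> ?M i0" by (intro onb_sum_mono[OF n]) simp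
      then show False using l(1) k by (simp add: P_def)
    qed
    then obtain i where i: "l = Suc i" "i0 \<le> i" by (cases l) auto
    have ki: "?M i + ?M i \<le> k" "k < ?M (Suc i) + ?M (Suc i)" using l(1) l(2)[of i] by (simp_all add: P_def i)
    define b where "b = real i + real ?n - 2"
    have D_L: "tent_D ?n e L \<le> tent_D ?n e \<epsilon>" for e
      using tent_D_strict_antimono_length[OF n \<epsilon>, of L e] L by (cases "L = \<epsilon>") auto
    obtain d where d: "i = Suc d" "d \<ge> E1" using i(2) by (cases i) (auto simp: i0_def)
    show False
    proof (cases "k < ?M (Suc i) + ?M i")
      case True
      \<comment> \<open>The Dirichlet degrees counted here are at most \<open>i - 1\<close>, whose
        limit is \<open>b - 1\<close>; within 1/2 of it at \<open>\<epsilon>\<close>, they stay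
        below \<open>b\<close> for longer cylinders.\<close>
      have "tent_D ?n d \<epsilon> < b" using E1[OF d(2)] by (simp add: b_def d(1))
      then have Dd: "tent_D ?n d L < b" using D_L[of d] by simp
      have "tent_value TYPE('n) L k \<le> max (tent_N ?n i L) (tent_D ?n d L)"
      proof (rule tent_value_le[OF n L0 True])
        show "tent_N ?n e L \<le> max (tent_N ?n i L) (tent_D ?n d L)" if "e < Suc i" for e
          using tent_N_mono[OF n L0, of e i] that by simp
        show "tent_D ?n e L \<le> max (tent_N ?n i L) (tent_D ?n d L)" if "e < i" for e
          using tent_D_mono[OF n L0, of e d] that d(1) by simp
      qed
      also have "\<dots> < b" using Dd tent_N_less[OF n L0, of i] by (simp add: b_def)
      finally have "tent_value TYPE('n) L k < b" .
      then obtain L' where L': "L' > 0" "tent_value TYPE('n) L k < tent_N ?n i L'"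
        using tent_N_gt[OF n, of i] d(1) unfolding b_def by auto
      have "tent_N ?n i L' \<le> tent_value TYPE('n) L' k"
      proof (rule tent_value_ge[OF n L'(1) ki(1)])
        show "tent_N ?n i L' \<le> tent_N ?n e L'" if "i \<le> e" for e by (rule tent_N_mono[OF n L'(1) that])
        show "tent_N ?n i L' \<le> tent_D ?n e L'" if "i \<le> e" for e
          using tent_N_mono[OF n L'(1) that] tent_N_le_D[OF n L'(1), of e] by simp
      qed
      then show False using crit[OF L'(1)] L'(2) by simp
    next
      case False
      \<comment> \<open>Both entries exceed \<open>tent_D\<close> of degree \<open>i\<close> at
        \<open>\<epsilon>\<close>: the first by strict decrease in the length, the second because
        \<open>b + 1/2\<close> separates degree \<open>i\<close> from degree
        \<open>i + 1\<close>.\<close>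
      define y where "y = min (tent_D ?n i (\<epsilon> / 2)) (tent_N ?n (Suc i) (\<epsilon> / 2))"
      have "tent_value TYPE('n) L k \<le> tent_D ?n i L"
      proof (rule tent_value_le[OF n L0 ki(2)])
        fix e assume "e < Suc i"
        then show D: "tent_D ?n e L \<le> tent_D ?n i L" using tent_D_mono[OF n L0] by simp
        show "tent_N ?n e L \<le> tent_D ?n i L" using D tent_N_le_D[OF n L0, of e] by simp
      qed
      also have "\<dots> \<le> tent_D ?n i \<epsilon>" by (rule D_L)
      also have "\<dots> < y"
      proof -
        have "tent_D ?n i \<epsilon> < tent_D ?n i (\<epsilon> / 2)" by (rule tent_D_strict_antimono_length[OF n e2(1,2)])
        moreover have "tent_D ?n i \<epsilon> < b + 1/2" using E1[of i] d by (simp add: b_def)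
        moreover have "b + 1/2 < tent_N ?n (Suc i) (\<epsilon> / 2)" using E2[of "Suc i"] i(2) by (simp add: b_def i0_def)
        ultimately show ?thesis by (simp add: y_def)
      qed
      also have "y \<le> tent_value TYPE('n) (\<epsilon> / 2) k"
      proof (rule tent_value_ge[OF n e2(1)])
        show "?M (Suc i) + ?M i \<le> k" using False by simp
        show "y \<le> tent_N ?n e (\<epsilon> / 2)" if "Suc i \<le> e" for e
          using tent_N_mono[OF n e2(1) that] by (simp add: y_def)
        show "y \<le> tent_D ?n e (\<epsilon> / 2)" if "i \<le> e" for e
          using tent_D_mono[OF n e2(1) that] by (simp add: y_def)
      qed
      finally show False using crit[OF e2(1)] by simp
    qed
  qed
  then show ?thesis by (intro exI[of _ "2 * ?M i0"]) (meson not_le)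
qed

theorem theorem9:
  assumes "CARD('n::finite) \<ge> 3"
  shows "infinite (critical_indices TYPE('n)) \<and>
    (\<forall>(k :: nat \<Rightarrow> nat) (L :: nat \<Rightarrow> real).
       strict_mono k \<and> range k = critical_indices TYPE('n) \<and>
       (\<forall>i. finite_critical_length TYPE('n) (k i) (L i))
       \<longrightarrow> L \<longlonglongrightarrow> 0)"
proof (intro conjI allI impI)
  show "infinite (critical_indices TYPE('n))" unfolding infinite_nat_iff_unbounded_le
  proof
    fix m
    define k where "k = 2 * onb_sum TYPE('n) (Suc m) - 1"
    have "Suc m \<le> onb_sum TYPE('n) (Suc m)" by (rule onb_sum_ge[OF assms])
    then have "m \<le> k" "1 \<le> k" by (simp_all add: k_def)
    then show "\<exists>k\<ge>m. k \<in> critical_indices TYPE('n)"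
      using critical_length_exists[OF assms, of m] by (intro exI[of _ k]) (simp add: critical_indices_def k_def)
  qed
  fix k :: "nat \<Rightarrow> nat" and L :: "nat \<Rightarrow> real"
  assume "strict_mono k \<and> range k = critical_indices TYPE('n) \<and> (\<forall>i. finite_critical_length TYPE('n) (k i) (L i))"
  then have k: "strict_mono k" and crit: "\<And>i. finite_critical_length TYPE('n) (k i) (L i)" by auto
  show "L \<longlonglongrightarrow> 0"
  proof (rule LIMSEQ_I)
    fix \<epsilon> :: real assume "\<epsilon> > 0"
    then obtain K where K: "\<And>j L. j \<ge> K \<Longrightarrow> finite_critical_length TYPE('n) j L \<Longrightarrow> L < \<epsilon>"
      using critical_length_small[OF assms] by metis
    show "\<exists>N. \<forall>i\<ge>N. norm (L i - 0) < \<epsilon>"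
    proof (intro exI allI impI)
      fix i assume "K \<le> i"
      then have "K \<le> k i" using strict_mono_imp_increasing[OF k, of i] by simp
      then have "L i < \<epsilon>" using K crit by blast
      moreover have "L i > 0" using crit[of i] by (simp add: finite_critical_length_def)
      ultimately show "norm (L i - 0) < \<epsilon>" by simp
    qed
  qed
qed

end
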